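(* Let $\Omega\subset\mathbb{R}^n$ be a bounded smooth domain, $H=L^2(\Omega)$ (complex Hilbert space), let $\gamma\in\mathbb{R}\setminus\{0\}$ be the coupling constant, and let $A_D$ and $A_N$ be the Dirichlet Laplacian and the Neumann Laplacian $-\Delta$ on $H$, with domains $D(A_D)=H^2(\Omega)\cap H_0^1(\Omega)$ and $D(A_N)=\{w\in H^2(\Omega):\frac{\partial w}{\partial n}|_{\partial\Omega}=0\}$. For $O,O'\in\{D,N\}$ let $\mathcal{H}_O=D(A_O^{1/2})\times H\times H$ and let $T_{OO'}(\cdot)$ be the contraction semigroup on $\mathcal{H}_O$ generated by $$\mathcal{A}_{OO'}(u,v,\theta)=(v,\,-A_Ou-\gamma\theta,\,-A_{O'}\theta+\gamma v),\qquad D(\mathcal{A}_{OO'})=D(A_O)\times D(A_O^{1/2})\times D(A_{O'}).$$ Then for all $O,O'\in\{D,N\}$ the semigroup $T_{OO'}(\cdot)$ is not exponentially stable.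
   Context: Here $n$ in $\frac{\partial}{\partial n}$ is the unit outward normal, $D(A_D^{1/2})=H_0^1(\Omega)$ and $D(A_N^{1/2})=H^1(\Omega)$. In the underlying abstract setting $A_D$ and $A_N$ are taken to be self-adjoint, strictly positive definite (unbounded) operators with compact resolvent on $H$. The space $\mathcal{H}_O$ carries $$\langle (u_1,v_1,\theta_1),(u_2,v_2,\theta_2)\rangle_{\mathcal{H}_O}=\langle A_O^{1/2}u_1,A_O^{1/2}u_2\rangle+\langle v_1,v_2\rangle+\langle\theta_1,\theta_2\rangle,$$ where $\langle\cdot,\cdot\rangle$ is the inner product of $H$, and the induced norm. A $C_0$-semigroup of contractions $T(\cdot)$ on a Hilbert space $\mathcal{H}$ is exponentially stable with decay rate $\omega>0$ if there is a constant $M\geq 1$ such that $\|T(t)U_0\|_{\mathcal{H}}\leq Me^{-\omega t}\|U_0\|_{\mathcal{H}}$ for all $t>0$ and $U_0\in\mathcal{H}$. With $v=u_t$, the operator $\mathcal{A}_{OO'}$ is the first-order form of the system $u_{tt}-\Delta u+\gamma\theta=0$, $\theta_t-\Delta\theta-\gamma u_t=0$ in $\Omega\times(0,\infty)$, with on $\partial\Omega\times(0,\infty)$ the boundary condition $u=0$ if $O=D$, $\frac{\partial u}{\partial n}=0$ if $O=N$, and $\theta=0$ if $O'=D$, $\frac{\partial\theta}{\partial n}=0$ if $O'=N$.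
   Formalization: For O=N the form on H_N is only a seminorm (constants lie in the kernel of A_N), so A_N is not assumed strictly positive and the semigroup and its generator are taken in the graph norm of A_O^{1/2}; contractivity and exponential stability use the given (semi)norm. *)

theory Defs
  imports "HOL-Analysis.Analysis"
begin

section \<open>The complex Hilbert space of square-integrable functions\<close>

definition square_integrable :: "('a::euclidean_space \<Rightarrow> complex) \<Rightarrow> bool" where
  "square_integrable f \<longleftrightarrow>
     f \<in> borel_measurable lborel \<and> integrable lborel (\<lambda>x. (cmod (f x))\<^sup>2)"

definition l2_rel :: "('a::euclidean_space \<Rightarrow> complex) \<Rightarrow> ('a \<Rightarrow> complex) \<Rightarrow> bool" where
  "l2_rel f g \<longleftrightarrow> square_integrable f \<and> square_integrable g \<and> (AE x in lborel. f x = g x)"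

lemma square_integrable_zero: "square_integrable (\<lambda>x. 0)"
  by (simp add: square_integrable_def)

lemma part_equivp_l2_rel: "part_equivp l2_rel"
proof (rule part_equivpI)
  show "\<exists>f. l2_rel f f"
    using square_integrable_zero by (auto simp: l2_rel_def)
  show "symp l2_rel"
    by (rule sympI) (auto simp: l2_rel_def elim: eventually_mono)
  show "transp l2_rel"
    by (rule transpI) (auto simp: l2_rel_def elim: eventually_elim2)
qed

quotient_type (overloaded) 'a l2 = "'a::euclidean_space \<Rightarrow> complex" / partial: l2_rel
  by (rule part_equivp_l2_rel)

lemma square_integrable_cmult:
  assumes "square_integrable f" shows "square_integrable (\<lambda>x. c * f x)"
  using assms by (auto simp: square_integrable_def norm_mult power_mult_distrib)

lemma square_integrable_add:
  assumes "square_integrable f" "square_integrable g"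
  shows "square_integrable (\<lambda>x. f x + g x)"
proof -
  have m: "f \<in> borel_measurable lborel" "g \<in> borel_measurable lborel"
    using assms by (auto simp: square_integrable_def)
  have "integrable lborel (\<lambda>x. (cmod (f x + g x))\<^sup>2)"
  proof (rule Bochner_Integration.integrable_bound)
    show "integrable lborel (\<lambda>x. 2 * (cmod (f x))\<^sup>2 + 2 * (cmod (g x))\<^sup>2)"
      using assms by (auto simp: square_integrable_def)
    have "(cmod (f x + g x))\<^sup>2 \<le> 2 * (cmod (f x))\<^sup>2 + 2 * (cmod (g x))\<^sup>2" for x
    proof -
      have "(cmod (f x + g x))\<^sup>2 \<le> (cmod (f x) + cmod (g x))\<^sup>2"
        by (intro power_mono norm_triangle_ineq) auto
      also have "\<dots> \<le> 2 * (cmod (f x))\<^sup>2 + 2 * (cmod (g x))\<^sup>2"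
        using sum_squares_bound[of "cmod (f x)" "cmod (g x)"] by (simp add: power2_sum)
      finally show ?thesis .
    qed
    then show "AE x in lborel. norm ((cmod (f x + g x))\<^sup>2)
        \<le> norm (2 * (cmod (f x))\<^sup>2 + 2 * (cmod (g x))\<^sup>2)"
      by auto
  qed (use m in measurable)
  with m show ?thesis by (auto simp: square_integrable_def)
qed

lemma square_integrable_uminus:
  "square_integrable f \<Longrightarrow> square_integrable (\<lambda>x. - f x)"
  by (auto simp: square_integrable_def)

lemma integrable_mult_cnj:
  assumes "square_integrable f" "square_integrable g"
  shows "integrable lborel (\<lambda>x. f x * cnj (g x))"
proof -
  have m: "f \<in> borel_measurable lborel" "g \<in> borel_measurable lborel"
    using assms by (auto simp: square_integrable_def)
  show ?thesis
  proof (rule Bochner_Integration.integrable_bound)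
    show "integrable lborel (\<lambda>x. (cmod (f x))\<^sup>2 + (cmod (g x))\<^sup>2)"
      using assms by (auto simp: square_integrable_def)
    have "cmod (f x) * cmod (g x) \<le> (cmod (f x))\<^sup>2 + (cmod (g x))\<^sup>2" for x
      using sum_squares_bound[of "cmod (f x)" "cmod (g x)"]
        mult_nonneg_nonneg[OF norm_ge_zero[of "f x"] norm_ge_zero[of "g x"]] by linarith
    then show "AE x in lborel. norm (f x * cnj (g x))
        \<le> norm ((cmod (f x))\<^sup>2 + (cmod (g x))\<^sup>2)"
      by (auto simp: norm_mult)
    show "(\<lambda>x. f x * cnj (g x)) \<in> borel_measurable lborel"
      using m by (intro borel_measurable_times borel_measurable_continuous_on[of cnj])
        (auto intro: continuous_intros)
  qed
qed

lift_definition cinner :: "'a::euclidean_space l2 \<Rightarrow> 'a l2 \<Rightarrow> complex" is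
  "\<lambda>f g. \<integral>x. f x * cnj (g x) \<partial>lborel"
proof -
  fix f f' g g' :: "'a \<Rightarrow> complex"
  assume r: "l2_rel f f'" "l2_rel g g'"
  show "(\<integral>x. f x * cnj (g x) \<partial>lborel) = (\<integral>x. f' x * cnj (g' x) \<partial>lborel)"
  proof (rule integral_cong_AE)
    show "AE x in lborel. f x * cnj (g x) = f' x * cnj (g' x)"
      using r by (auto simp: l2_rel_def elim: eventually_elim2)
  qed (use r integrable_mult_cnj in \<open>auto simp: l2_rel_def intro!: borel_measurable_integrable[where M = lborel, simplified]\<close>)
qed

lift_definition scaleC :: "complex \<Rightarrow> 'a::euclidean_space l2 \<Rightarrow> 'a l2" is "\<lambda>c f x. c * f x"
  by (auto simp: l2_rel_def square_integrable_cmult)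

instantiation l2 :: (euclidean_space) ab_group_add
begin

lift_definition zero_l2 :: "'a l2" is "\<lambda>x. 0"
  by (simp add: l2_rel_def square_integrable_zero)

lift_definition plus_l2 :: "'a l2 \<Rightarrow> 'a l2 \<Rightarrow> 'a l2" is "\<lambda>f g x. f x + g x"
  by (auto simp: l2_rel_def square_integrable_add elim: eventually_elim2)

lift_definition uminus_l2 :: "'a l2 \<Rightarrow> 'a l2" is "\<lambda>f x. - f x"
  by (auto simp: l2_rel_def square_integrable_uminus)

definition minus_l2 :: "'a l2 \<Rightarrow> 'a l2 \<Rightarrow> 'a l2" where
  "minus_l2 f g = f + (- g)"

instance
proof
  fix f g h :: "'a l2"
  show "f + g + h = f + (g + h)"
    by transfer (simp add: l2_rel_def square_integrable_add add.assoc)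
  show "f + g = g + f"
    by transfer (simp add: l2_rel_def square_integrable_add add.commute)
  show "0 + f = f"
    by transfer (simp add: l2_rel_def)
  show "- f + f = 0"
    by transfer (simp add: l2_rel_def square_integrable_zero)
  show "f - g = f + - g"
    by (simp add: minus_l2_def)
qed

end

instantiation l2 :: (euclidean_space) real_vector
begin

definition scaleR_l2 :: "real \<Rightarrow> 'a l2 \<Rightarrow> 'a l2" where
  "scaleR_l2 r f = scaleC (complex_of_real r) f"

instance
proof
  fix f g h :: "'a l2" and a b :: real
  show "a *\<^sub>R (f + g) = a *\<^sub>R f + a *\<^sub>R g"
    unfolding scaleR_l2_def
    by transfer (simp add: l2_rel_def square_integrable_add square_integrable_cmult distrib_left)
  show "(a + b) *\<^sub>R f = a *\<^sub>R f + b *\<^sub>R f"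
    unfolding scaleR_l2_def
    by transfer (simp add: l2_rel_def square_integrable_add square_integrable_cmult distrib_right)
  show "a *\<^sub>R b *\<^sub>R f = (a * b) *\<^sub>R f"
    unfolding scaleR_l2_def
    by transfer (auto simp: l2_rel_def mult.assoc intro!: square_integrable_cmult)
  show "1 *\<^sub>R f = f"
    unfolding scaleR_l2_def by transfer (simp add: l2_rel_def)
qed

end

instantiation l2 :: (euclidean_space) real_inner
begin

definition inner_l2 :: "'a l2 \<Rightarrow> 'a l2 \<Rightarrow> real" where
  "inner_l2 f g = Re (cinner f g)"

definition norm_l2 :: "'a l2 \<Rightarrow> real" where
  "norm_l2 f = sqrt (Re (cinner f f))"

definition sgn_l2 :: "'a l2 \<Rightarrow> 'a l2" where
  "sgn_l2 f = f /\<^sub>R norm f"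

definition dist_l2 :: "'a l2 \<Rightarrow> 'a l2 \<Rightarrow> real" where
  "dist_l2 f g = norm (f - g)"

definition uniformity_l2 :: "('a l2 \<times> 'a l2) filter" where
  "uniformity_l2 = (INF e\<in>{0<..}. principal {(f, g). dist f g < e})"

definition open_l2 :: "'a l2 set \<Rightarrow> bool" where
  "open_l2 U \<longleftrightarrow> (\<forall>f\<in>U. eventually (\<lambda>(f', g). f' = f \<longrightarrow> g \<in> U) uniformity)"

instance
proof
  fix f g h :: "'a l2" and a :: real
  show "inner f g = inner g f"
  proof -
    have "cinner f g = cnj (cinner g f)"
      by transfer (subst Bochner_Integration.integral_cnj[symmetric], simp add: mult.commute)
    then show ?thesis by (simp add: inner_l2_def)
  qed
  show "inner (f + g) h = inner f h + inner g h"
  proof -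
    have "cinner (f + g) h = cinner f h + cinner g h"
      by transfer (simp add: l2_rel_def distrib_right integrable_mult_cnj)
    then show ?thesis by (simp add: inner_l2_def)
  qed
  show "inner (a *\<^sub>R f) g = a * inner f g"
  proof -
    have "cinner (scaleC (complex_of_real a) f) g = of_real a * cinner f g"
      by transfer (simp add: mult.assoc)
    then show ?thesis by (simp add: inner_l2_def scaleR_l2_def)
  qed
  have sq: "cinner f f = of_real (\<integral>x. (cmod (rep_l2 f x))\<^sup>2 \<partial>lborel)"
    by (simp add: cinner.rep_eq complex_norm_square[symmetric] flip: integral_of_real of_real_power)
  have rep: "square_integrable (rep_l2 f)"
    using Quotient_rep_reflp[OF Quotient_l2] by (simp add: l2_rel_def)
  show "0 \<le> inner f f"
    by (simp add: inner_l2_def sq)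
  show "inner f f = 0 \<longleftrightarrow> f = 0"
  proof
    assume "inner f f = 0"
    then have "(\<integral>x. (cmod (rep_l2 f x))\<^sup>2 \<partial>lborel) = 0"
      by (simp add: inner_l2_def sq)
    then have "AE x in lborel. (cmod (rep_l2 f x))\<^sup>2 = 0"
      using rep by (subst (asm) integral_nonneg_eq_0_iff_AE) (auto simp: square_integrable_def)
    then have "l2_rel (rep_l2 f) (\<lambda>x. 0)"
      using rep square_integrable_zero by (auto simp: l2_rel_def)
    then have "abs_l2 (rep_l2 f) = abs_l2 (\<lambda>x. 0)"
      by (rule Quotient_rel_abs[OF Quotient_l2])
    then show "f = 0"
      by (simp add: zero_l2_def Quotient_abs_rep[OF Quotient_l2])
  next
    assume "f = 0"
    moreover have "cinner (0 :: 'a l2) 0 = 0"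
      by transfer simp
    ultimately show "inner f f = 0"
      by (simp add: inner_l2_def)
  qed
  show "norm f = sqrt (inner f f)"
    by (simp add: norm_l2_def inner_l2_def)
qed (auto simp: sgn_l2_def dist_l2_def uniformity_l2_def open_l2_def)

end

text \<open>The space $L^2(\Omega)$ is realised, through extension by zero, as the closed subspace of
  functions vanishing almost everywhere outside \<open>\<Omega>\<close>. Conversely \<open>restrict_l2 \<Omega> \<phi>\<close> is the
  element of this subspace given by the restriction of a function \<open>\<phi>\<close> to \<open>\<Omega>\<close>.\<close>

definition L2 :: "'a::euclidean_space set \<Rightarrow> 'a l2 set" where
  "L2 \<Omega> = {f. AE x in lborel. x \<notin> \<Omega> \<longrightarrow> rep_l2 f x = 0}"

definition restrict_l2 :: "'a::euclidean_space set \<Rightarrow> ('a \<Rightarrow> complex) \<Rightarrow> 'a l2" where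
  "restrict_l2 \<Omega> \<phi> = abs_l2 (\<lambda>x. if x \<in> \<Omega> then \<phi> x else 0)"

section \<open>Smooth functions and smooth domains\<close>

abbreviation partial :: "'a::euclidean_space \<Rightarrow> ('a \<Rightarrow> 'b::real_normed_vector) \<Rightarrow> 'a \<Rightarrow> 'b" where
  "partial b f \<equiv> (\<lambda>x. frechet_derivative f (at x) b)"

primrec Ck_on :: "nat \<Rightarrow> 'a::euclidean_space set \<Rightarrow> ('a \<Rightarrow> 'b::real_normed_vector) \<Rightarrow> bool" where
  "Ck_on 0 U f \<longleftrightarrow> continuous_on U f"
| "Ck_on (Suc k) U f \<longleftrightarrow>
     (\<forall>x\<in>U. f differentiable (at x)) \<and> (\<forall>b\<in>Basis. Ck_on k U (partial b f))"

definition smooth_on :: "'a::euclidean_space set \<Rightarrow> ('a \<Rightarrow> 'b::real_normed_vector) \<Rightarrow> bool" where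
  "smooth_on U f \<longleftrightarrow> (\<forall>k. Ck_on k U f)"

definition defining_function :: "'a::euclidean_space set \<Rightarrow> 'a set \<Rightarrow> ('a \<Rightarrow> real) \<Rightarrow> bool" where
  "defining_function \<Omega> U \<rho> \<longleftrightarrow>
     open U \<and> smooth_on U \<rho> \<and> (\<forall>x\<in>U. \<exists>D. (GDERIV \<rho> x :> D) \<and> D \<noteq> 0) \<and>
     \<Omega> \<inter> U = {x\<in>U. \<rho> x < 0}"

definition smooth_domain :: "'a::euclidean_space set \<Rightarrow> bool" where
  "smooth_domain \<Omega> \<longleftrightarrow>
     open \<Omega> \<and> connected \<Omega> \<and> \<Omega> \<noteq> {} \<and>
     (\<forall>p\<in>frontier \<Omega>. \<exists>U \<rho>. p \<in> U \<and> defining_function \<Omega> U \<rho>)"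

text \<open>For boundary points of a smooth domain the normalised gradient does not depend on the
  choice of the local defining function.\<close>

definition unit_normal :: "'a::euclidean_space set \<Rightarrow> 'a \<Rightarrow> 'a" where
  "unit_normal \<Omega> x =
     (THE \<nu>. \<exists>U \<rho> D. x \<in> U \<and> defining_function \<Omega> U \<rho> \<and> (GDERIV \<rho> x :> D) \<and> \<nu> = sgn D)"

text \<open>Surface measure is the Hausdorff measure of dimension one less than that of the space,
  normalised to agree with Lebesgue measure on hyperplanes. Empty covering sets are given weight
  \<open>0\<close> explicitly because \<open>0 ^ 0 = 1\<close>, and boundedness is required because \<open>diameter\<close> is
  not meaningful for unbounded sets.\<close>

definition hausdorff_outer :: "nat \<Rightarrow> 'a::euclidean_space set \<Rightarrow> ennreal" where
  "hausdorff_outer s E =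
     (SUP \<delta>\<in>{0<..}. INF C\<in>{C :: nat \<Rightarrow> 'a set.
          E \<subseteq> (\<Union>i. C i) \<and> (\<forall>i. bounded (C i) \<and> diameter (C i) \<le> \<delta>)}.
        \<Sum>i. if C i = {} then 0 else ennreal (unit_ball_vol (real s) * (diameter (C i) / 2) ^ s))"

definition surface_measure :: "'a::euclidean_space measure" where
  "surface_measure = measure_of UNIV (sets borel) (hausdorff_outer (DIM('a) - 1))"

section \<open>Sobolev spaces\<close>

definition test_function :: "'a::euclidean_space set \<Rightarrow> ('a \<Rightarrow> complex) \<Rightarrow> bool" where
  "test_function \<Omega> \<phi> \<longleftrightarrow>
     smooth_on UNIV \<phi> \<and> compact (closure {x. \<phi> x \<noteq> 0}) \<and> closure {x. \<phi> x \<noteq> 0} \<subseteq> \<Omega>"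

definition weak_partial :: "'a::euclidean_space set \<Rightarrow> 'a \<Rightarrow> 'a l2 \<Rightarrow> 'a l2 \<Rightarrow> bool" where
  "weak_partial \<Omega> b f g \<longleftrightarrow> f \<in> L2 \<Omega> \<and> g \<in> L2 \<Omega> \<and>
     (\<forall>\<phi>. test_function \<Omega> \<phi> \<longrightarrow>
        (\<integral>x. rep_l2 f x * partial b \<phi> x \<partial>lborel) = - (\<integral>x. rep_l2 g x * \<phi> x \<partial>lborel))"

definition H1 :: "'a::euclidean_space set \<Rightarrow> 'a l2 set" where
  "H1 \<Omega> = {f \<in> L2 \<Omega>. \<forall>b\<in>Basis. \<exists>g. weak_partial \<Omega> b f g}"

definition H2 :: "'a::euclidean_space set \<Rightarrow> 'a l2 set" where
  "H2 \<Omega> = {f \<in> L2 \<Omega>. \<forall>b\<in>Basis. \<exists>g\<in>H1 \<Omega>. weak_partial \<Omega> b f g}"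

definition H1_tendsto ::
  "'a::euclidean_space set \<Rightarrow> (nat \<Rightarrow> 'a \<Rightarrow> complex) \<Rightarrow> 'a l2 \<Rightarrow> bool" where
  "H1_tendsto \<Omega> \<Phi> f \<longleftrightarrow>
     (\<lambda>k. restrict_l2 \<Omega> (\<Phi> k)) \<longlonglongrightarrow> f \<and>
     (\<forall>b\<in>Basis. \<exists>g. weak_partial \<Omega> b f g \<and> (\<lambda>k. restrict_l2 \<Omega> (partial b (\<Phi> k))) \<longlonglongrightarrow> g)"

definition H10 :: "'a::euclidean_space set \<Rightarrow> 'a l2 set" where
  "H10 \<Omega> = {f \<in> H1 \<Omega>. \<exists>\<Phi>. (\<forall>k. test_function \<Omega> (\<Phi> k)) \<and> H1_tendsto \<Omega> \<Phi> f}"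

text \<open>The boundary trace of \<open>f \<in> H1 \<Omega>\<close> is the limit in $L^2(\partial\Omega)$ of the boundary values
  of smooth functions converging to \<open>f\<close> in $H^1(\Omega)$; only the values of \<open>g\<close> on \<open>frontier \<Omega>\<close>
  matter.\<close>

definition has_trace :: "'a::euclidean_space set \<Rightarrow> 'a l2 \<Rightarrow> ('a \<Rightarrow> complex) \<Rightarrow> bool" where
  "has_trace \<Omega> f g \<longleftrightarrow> f \<in> H1 \<Omega> \<and> g \<in> borel_measurable borel \<and>
     (\<exists>\<Phi>. (\<forall>k. smooth_on UNIV (\<Phi> k)) \<and> H1_tendsto \<Omega> \<Phi> f \<and>
        (\<lambda>k. \<integral>\<^sup>+x\<in>frontier \<Omega>. ennreal ((cmod (\<Phi> k x - g x))\<^sup>2) \<partial>surface_measure) \<longlonglongrightarrow> 0)"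

definition normal_derivative_zero :: "'a::euclidean_space set \<Rightarrow> 'a l2 \<Rightarrow> bool" where
  "normal_derivative_zero \<Omega> w \<longleftrightarrow>
     (\<exists>G g. (\<forall>b\<in>Basis. weak_partial \<Omega> b w (G b) \<and> has_trace \<Omega> (G b) (g b)) \<and>
        (AE x in surface_measure. x \<in> frontier \<Omega> \<longrightarrow>
           (\<Sum>b\<in>Basis. of_real (unit_normal \<Omega> x \<bullet> b) * g b x) = 0))"

section \<open>Unbounded operators, given by their graphs\<close>

type_synonym 'a l2_operator = "('a l2 \<times> 'a l2) set"

definition adjoint_on :: "'a::euclidean_space l2 set \<Rightarrow> 'a l2_operator \<Rightarrow> 'a l2_operator" where
  "adjoint_on H A = {(x, y). x \<in> H \<and> y \<in> H \<and> (\<forall>(u, a)\<in>A. cinner a x = cinner u y)}"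

definition self_adjoint_on :: "'a::euclidean_space l2 set \<Rightarrow> 'a l2_operator \<Rightarrow> bool" where
  "self_adjoint_on H A \<longleftrightarrow> H \<subseteq> closure (Domain A) \<and> A = adjoint_on H A"

definition square_root_on ::
  "'a::euclidean_space l2 set \<Rightarrow> 'a l2_operator \<Rightarrow> 'a l2_operator \<Rightarrow> bool" where
  "square_root_on H A S \<longleftrightarrow>
     self_adjoint_on H S \<and> (\<forall>(x, y)\<in>S. 0 \<le> Re (cinner y x)) \<and> A = S O S"

definition op_value :: "'a::euclidean_space l2_operator \<Rightarrow> 'a l2 \<Rightarrow> 'a l2" where
  "op_value A x = (THE y. (x, y) \<in> A)"

datatype boundary_condition = Dirichlet | Neumann

fun laplacian_domain :: "boundary_condition \<Rightarrow> 'a::euclidean_space set \<Rightarrow> 'a l2 set" where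
  "laplacian_domain Dirichlet \<Omega> = H2 \<Omega> \<inter> H10 \<Omega>"
| "laplacian_domain Neumann \<Omega> = {w \<in> H2 \<Omega>. normal_derivative_zero \<Omega> w}"

definition neg_laplacian ::
  "boundary_condition \<Rightarrow> 'a::euclidean_space set \<Rightarrow> 'a l2_operator" where
  "neg_laplacian bc \<Omega> = {(u, - (\<Sum>b\<in>Basis. h b)) | u g h. u \<in> laplacian_domain bc \<Omega> \<and>
     (\<forall>b\<in>Basis. weak_partial \<Omega> b u (g b) \<and> weak_partial \<Omega> b (g b) (h b))}"

section \<open>The coupled system\<close>

type_synonym 'a state = "'a l2 \<times> 'a l2 \<times> 'a l2"

text \<open>Below, \<open>S\<close> stands for the square root of the operator acting on the first component.\<close>

definition state_space :: "'a::euclidean_space set \<Rightarrow> 'a l2_operator \<Rightarrow> 'a state set" where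
  "state_space \<Omega> S = Domain S \<times> L2 \<Omega> \<times> L2 \<Omega>"

fun state_inner :: "'a::euclidean_space l2_operator \<Rightarrow> 'a state \<Rightarrow> 'a state \<Rightarrow> complex" where
  "state_inner S (u1, v1, \<theta>1) (u2, v2, \<theta>2) =
     cinner (op_value S u1) (op_value S u2) + cinner v1 v2 + cinner \<theta>1 \<theta>2"

definition state_norm :: "'a::euclidean_space l2_operator \<Rightarrow> 'a state \<Rightarrow> real" where
  "state_norm S U = sqrt (Re (state_inner S U U))"

text \<open>The Neumann Laplacian annihilates constants, so in that case \<open>state_norm\<close> is only a
  seminorm. The topology of the state space is therefore taken from the graph norm of \<open>S\<close> on the
  first component; for the Dirichlet Laplacian, by the Poincare inequality, this norm is
  equivalent to \<open>state_norm\<close>.\<close>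

definition graph_norm :: "'a::euclidean_space l2_operator \<Rightarrow> 'a state \<Rightarrow> real" where
  "graph_norm S U = sqrt ((norm (fst U))\<^sup>2 + (state_norm S U)\<^sup>2)"

fun state_scaleC :: "complex \<Rightarrow> 'a::euclidean_space state \<Rightarrow> 'a state" where
  "state_scaleC c (u, v, \<theta>) = (scaleC c u, scaleC c v, scaleC c \<theta>)"

definition bounded_operator_on ::
  "'a::euclidean_space state set \<Rightarrow> ('a state \<Rightarrow> real) \<Rightarrow> ('a state \<Rightarrow> 'a state) \<Rightarrow> bool" where
  "bounded_operator_on X N B \<longleftrightarrow>
     (\<forall>U\<in>X. B U \<in> X) \<and>
     (\<forall>U\<in>X. \<forall>V\<in>X. B (U + V) = B U + B V) \<and>
     (\<forall>c. \<forall>U\<in>X. B (state_scaleC c U) = state_scaleC c (B U)) \<and>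
     (\<exists>C. \<forall>U\<in>X. N (B U) \<le> C * N U)"

definition C0_semigroup ::
  "'a::euclidean_space state set \<Rightarrow> ('a state \<Rightarrow> real) \<Rightarrow> (real \<Rightarrow> 'a state \<Rightarrow> 'a state) \<Rightarrow> bool" where
  "C0_semigroup X N T \<longleftrightarrow>
     (\<forall>t\<ge>0. bounded_operator_on X N (T t)) \<and>
     (\<forall>U\<in>X. T 0 U = U) \<and>
     (\<forall>s\<ge>0. \<forall>t\<ge>0. \<forall>U\<in>X. T (s + t) U = T s (T t U)) \<and>
     (\<forall>U\<in>X. ((\<lambda>t. N (T t U - U)) \<longlongrightarrow> 0) (at_right 0))"

definition generator ::
  "'a::euclidean_space state set \<Rightarrow> ('a state \<Rightarrow> real) \<Rightarrow> (real \<Rightarrow> 'a state \<Rightarrow> 'a state) \<Rightarrow>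
     ('a state \<times> 'a state) set" where
  "generator X N T = {(U, V). U \<in> X \<and> V \<in> X \<and>
     ((\<lambda>t. N ((1 / t) *\<^sub>R (T t U - U) - V)) \<longlongrightarrow> 0) (at_right 0)}"

definition contractive ::
  "'a::euclidean_space state set \<Rightarrow> ('a state \<Rightarrow> real) \<Rightarrow> (real \<Rightarrow> 'a state \<Rightarrow> 'a state) \<Rightarrow> bool" where
  "contractive X N T \<longleftrightarrow> (\<forall>t\<ge>0. \<forall>U\<in>X. N (T t U) \<le> N U)"

definition exponentially_stable ::
  "'a::euclidean_space state set \<Rightarrow> ('a state \<Rightarrow> real) \<Rightarrow> (real \<Rightarrow> 'a state \<Rightarrow> 'a state) \<Rightarrow> bool" where
  "exponentially_stable X N T \<longleftrightarrow>
     (\<exists>\<omega>>0. \<exists>M\<ge>1. \<forall>t>0. \<forall>U\<in>X. N (T t U) \<le> M * exp (- \<omega> * t) * N U)"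

definition coupled_operator ::
  "boundary_condition \<Rightarrow> boundary_condition \<Rightarrow> 'a::euclidean_space set \<Rightarrow> real \<Rightarrow> 'a l2_operator \<Rightarrow>
     ('a state \<times> 'a state) set" where
  "coupled_operator bc bc' \<Omega> \<gamma> S =
     {((u, v, \<theta>), (v, - a - \<gamma> *\<^sub>R \<theta>, - a' + \<gamma> *\<^sub>R v)) | u v \<theta> a a'.
        (u, a) \<in> neg_laplacian bc \<Omega> \<and> v \<in> Domain S \<and> (\<theta>, a') \<in> neg_laplacian bc' \<Omega>}"

end

theory Submission
  imports Defs
begin

text \<open>The wave equation alone conserves the energy \<open>|S u|\<^sup>2 + |v|\<^sup>2\<close>; in the coupled system its time
derivative is \<open>-2 \<gamma> \<langle>\<theta>, v\<rangle>\<close>. A uniform decay rate is therefore refuted by states along whose orbits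
\<open>\<theta>\<close> and \<open>v\<close> stay almost uncorrelated during a fixed time. Such states come from test functions \<open>\<psi>\<close> that
live at scale \<open>1/m\<close>, normalised so that \<open>|\<nabla>\<psi>|\<close> does not depend on \<open>m\<close> whereas \<open>|\<psi>|\<close> is of order
\<open>1/m\<close>: the initial state \<open>U = (\<psi>, 0, \<gamma> \<psi>)\<close> is the image of \<open>Z = (0, \<psi>, 0)\<close> under the generator, its
wave energy is \<open>|\<nabla>\<psi>|\<^sup>2\<close>, and \<open>Z\<close> is small.

Write \<open>A\<close> and \<open>A'\<close> for the operators acting on \<open>u\<close> and on \<open>\<theta>\<close>. Since the orbit of \<open>U\<close> is the image under
the generator of the orbit \<open>(z\<^sub>1, z\<^sub>2, z\<^sub>3)\<close> of \<open>Z\<close>, its velocity is \<open>v = - A z\<^sub>1 - \<gamma> z\<^sub>3\<close>. If \<open>A'\<close> is the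
Dirichlet Laplacian, or if both operators agree, then \<open>|\<langle>\<theta>, A z\<^sub>1\<rangle>|\<^sup>2\<close> is at most
\<open>\<langle>A' \<theta>, \<theta>\<rangle> |S z\<^sub>1|\<^sup>2\<close>. Dissipation makes the first factor integrable in time with a bound independent of
\<open>m\<close>, and the second one is at most \<open>|Z|\<^sup>2\<close>, so the correlation tends to zero (\<open>energy_estimate\<close>).

There remains the Dirichlet condition for \<open>u\<close> with the Neumann condition for \<open>\<theta>\<close>, where \<open>\<theta>\<close> is estimated
only inside \<open>\<Omega>\<close>. Now \<open>m\<^sup>n\<close> bumps with disjoint supports, \<open>n\<close> being the dimension, evolve side by side.
They are orthogonal in the energy inner product, and contractivity turns this into a Bessel inequality for
their orbits (\<open>bessel\<close>). A Bessel inequality together with a modulus of continuity for translations limits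
how much of the members of a family can concentrate on a small set: a function is close to its averages over
balls of radius \<open>r\<close>, and at every point the averages of all members together are bounded by a multiple of
\<open>1/r\<^sup>n\<close> (\<open>concentration_bound\<close>). Two instances of this bound suffice. The velocities satisfy
\<open>|\<nabla>v| \<le> C m\<close>, and \<open>r = a/m\<close> shows that the mean share of a velocity in a boundary layer \<open>W\<close> is at most of
order \<open>a\<^sup>2 + |W|/a\<^sup>n\<close>. For a cutoff \<open>\<eta>\<close> the gradient of \<open>\<eta> \<theta>\<close> is controlled in the time mean by a local
energy identity (\<open>neumann_cutoff_estimate\<close>), and a fixed radius \<open>r = h\<close> shows that the mean of
\<open>|\<eta> \<theta>|\<^sup>2\<close> is at most of order \<open>h\<^sup>2 + 1/(h m)\<^sup>n\<close>. Hence the mean of \<open>|\<langle>\<theta>, v\<rangle>|\<close> over the family becomes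
small when first \<open>m\<close> tends to infinity, then \<open>h\<close> to zero, then the layer \<open>W\<close> shrinks and finally \<open>a\<close> tends
to zero (\<open>summed_estimate\<close>), and the mean energy cannot have decayed by a fixed factor.\<close>

section \<open>Smooth functions\<close>

lemma Ck_on_Suc_imp: "Ck_on (Suc k) UNIV f \<Longrightarrow> Ck_on k UNIV f"
proof (induction k arbitrary: f)
  case 0
  then show ?case
    by (auto intro!: continuous_at_imp_continuous_on differentiable_imp_continuous_within)
next
  case (Suc k)
  then show ?case by (meson Ck_on.simps(2))
qed

lemma smooth_on_UNIV_iff:
  "smooth_on UNIV f \<longleftrightarrow> (\<forall>x. f differentiable (at x)) \<and> (\<forall>b\<in>Basis. smooth_on UNIV (partial b f))"
  unfolding smooth_on_def by (metis Ck_on.simps(2) Ck_on_Suc_imp UNIV_I)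

lemma smooth_differentiable: "smooth_on UNIV f \<Longrightarrow> f differentiable (at x)"
  by (simp add: smooth_on_UNIV_iff[of f])

lemma smooth_partial: "smooth_on UNIV f \<Longrightarrow> b \<in> Basis \<Longrightarrow> smooth_on UNIV (partial b f)"
  by (simp add: smooth_on_UNIV_iff[of f])

lemma smooth_continuous_on: "smooth_on UNIV f \<Longrightarrow> continuous_on UNIV f"
  unfolding smooth_on_def using Ck_on.simps(1) by blast

lemma smooth_borel: "smooth_on UNIV f \<Longrightarrow> f \<in> borel_measurable borel"
  for f :: "'a::euclidean_space \<Rightarrow> 'b::{real_normed_vector,second_countable_topology}"
  by (intro borel_measurable_continuous_onI smooth_continuous_on)

lemma partial_eqI: "(f has_derivative f') (at x) \<Longrightarrow> partial b f x = f' b"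
  using frechet_derivative_at by metis

lemma smooth_has_derivative:
  "smooth_on UNIV f \<Longrightarrow> (f has_derivative frechet_derivative f (at x)) (at x)"
  using smooth_differentiable frechet_derivative_works by blast

text \<open>The recursion step of \<open>Ck_on\<close> for an explicitly given derivative, which is the form in which the
differentiation rules provide it.\<close>

lemma Ck_on_SucI:
  assumes "\<And>x. (f has_derivative f' x) (at x)" "\<And>b. b \<in> Basis \<Longrightarrow> Ck_on k UNIV (\<lambda>x. f' x b)"
  shows "Ck_on (Suc k) UNIV f"
proof -
  have "partial b f = (\<lambda>x. f' x b)" for b
    by (intro ext) (rule partial_eqI[OF assms(1)])
  then show ?thesis
    using assms(2) differentiableI[OF assms(1)] by simp
qed

lemma Ck_on_SucD:
  assumes "Ck_on (Suc k) UNIV f"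
  shows "(f has_derivative frechet_derivative f (at x)) (at x)"
    and "b \<in> Basis \<Longrightarrow> Ck_on k UNIV (partial b f)"
  using assms by (simp_all flip: frechet_derivative_works)

lemma Ck_on_bounded_linear:
  assumes "bounded_linear h"
  shows "Ck_on k UNIV f \<Longrightarrow> Ck_on k UNIV (\<lambda>x. h (f x))"
proof (induction k arbitrary: f)
  case 0
  then show ?case
    using assms by (simp add: bounded_linear.continuous_on)
next
  case (Suc k)
  show ?case
  proof (rule Ck_on_SucI)
    show "((\<lambda>x. h (f x)) has_derivative (\<lambda>v. h (frechet_derivative f (at x) v))) (at x)" for x
      by (rule bounded_linear.has_derivative[OF assms Ck_on_SucD(1)[OF Suc.prems]])
    show "Ck_on k UNIV (\<lambda>x. h (frechet_derivative f (at x) b))" if "b \<in> Basis" for b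
      by (rule Suc.IH[OF Ck_on_SucD(2)[OF Suc.prems that]])
  qed
qed

lemma Ck_on_add:
  "Ck_on k UNIV f \<Longrightarrow> Ck_on k UNIV g \<Longrightarrow> Ck_on k UNIV (\<lambda>x. f x + g x)"
proof (induction k arbitrary: f g)
  case 0
  then show ?case by (simp add: continuous_on_add)
next
  case (Suc k)
  show ?case
  proof (rule Ck_on_SucI)
    show "((\<lambda>x. f x + g x) has_derivative
      (\<lambda>v. frechet_derivative f (at x) v + frechet_derivative g (at x) v)) (at x)" for x
      by (rule has_derivative_add[OF Suc.prems[THEN Ck_on_SucD(1)]])
    show "Ck_on k UNIV (\<lambda>x. frechet_derivative f (at x) b + frechet_derivative g (at x) b)"
      if "b \<in> Basis" for b
      by (rule Suc.IH[OF Ck_on_SucD(2)[OF Suc.prems(1) that] Ck_on_SucD(2)[OF Suc.prems(2) that]])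
  qed
qed

lemma Ck_on_bilinear:
  assumes "bounded_bilinear h"
  shows "Ck_on k UNIV f \<Longrightarrow> Ck_on k UNIV g \<Longrightarrow> Ck_on k UNIV (\<lambda>x. h (f x) (g x))"
proof (induction k arbitrary: f g)
  case 0
  then show ?case using assms by (simp add: bounded_bilinear.continuous_on)
next
  case (Suc k)
  show ?case
  proof (rule Ck_on_SucI)
    show "((\<lambda>x. h (f x) (g x)) has_derivative
      (\<lambda>v. h (f x) (frechet_derivative g (at x) v) + h (frechet_derivative f (at x) v) (g x))) (at x)" for x
      by (rule bounded_bilinear.FDERIV[OF assms Suc.prems[THEN Ck_on_SucD(1)]])
    show "Ck_on k UNIV (\<lambda>x. h (f x) (frechet_derivative g (at x) b)
        + h (frechet_derivative f (at x) b) (g x))" if b: "b \<in> Basis" for b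
    proof (rule Ck_on_add)
    show "Ck_on k UNIV (\<lambda>x. h (f x) (frechet_derivative g (at x) b))"
      by (rule Suc.IH[OF Ck_on_Suc_imp[OF Suc.prems(1)] Ck_on_SucD(2)[OF Suc.prems(2) b]])
    show "Ck_on k UNIV (\<lambda>x. h (frechet_derivative f (at x) b) (g x))"
      by (rule Suc.IH[OF Ck_on_SucD(2)[OF Suc.prems(1) b] Ck_on_Suc_imp[OF Suc.prems(2)]])
    qed
  qed
qed

lemma smooth_add:
  "smooth_on UNIV f \<Longrightarrow> smooth_on UNIV g \<Longrightarrow> smooth_on UNIV (\<lambda>x. f x + g x)"
  unfolding smooth_on_def using Ck_on_add[of _ f g] by metis

lemma smooth_bounded_linear:
  "bounded_linear h \<Longrightarrow> smooth_on UNIV f \<Longrightarrow> smooth_on UNIV (\<lambda>x. h (f x))"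
  unfolding smooth_on_def using Ck_on_bounded_linear[of h _ f] by metis

lemma smooth_bilinear:
  "bounded_bilinear h \<Longrightarrow> smooth_on UNIV f \<Longrightarrow> smooth_on UNIV g \<Longrightarrow> smooth_on UNIV (\<lambda>x. h (f x) (g x))"
  unfolding smooth_on_def using Ck_on_bilinear[of h _ f g] by metis

lemma smooth_const: "smooth_on UNIV (\<lambda>x::'a::euclidean_space. c)"
proof -
  have "partial b (\<lambda>x::'a. d) = (\<lambda>x. 0)" for b and d :: 'b
    by (intro ext) (rule partial_eqI[OF has_derivative_const])
  then have "Ck_on k UNIV (\<lambda>x::'a. d)" for k and d :: 'b
    by (induction k arbitrary: d) (simp_all add: continuous_on_const)
  then show ?thesis by (simp add: smooth_on_def)
qed

lemma smooth_linear:
  assumes "bounded_linear h" shows "smooth_on UNIV h"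
proof -
  have D: "(h has_derivative h) (at x)" for x
    using assms by (rule bounded_linear.has_derivative) auto
  then have "partial b h = (\<lambda>x. h b)" for b
    by (intro ext) (rule partial_eqI[OF D])
  then show ?thesis
    using differentiableI[OF D] by (intro smooth_on_UNIV_iff[THEN iffD2]) (simp add: smooth_const)
qed

lemma smooth_mult:
  fixes f g :: "'a::euclidean_space \<Rightarrow> 'b::real_normed_algebra"
  shows "smooth_on UNIV f \<Longrightarrow> smooth_on UNIV g \<Longrightarrow> smooth_on UNIV (\<lambda>x. f x * g x)"
  by (rule smooth_bilinear[OF bounded_bilinear_mult])

lemma smooth_scaleR:
  "smooth_on UNIV f \<Longrightarrow> smooth_on UNIV g \<Longrightarrow> smooth_on UNIV (\<lambda>x. f x *\<^sub>R g x)"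
  by (rule smooth_bilinear[OF bounded_bilinear_scaleR])

lemma smooth_of_real: "smooth_on UNIV f \<Longrightarrow> smooth_on UNIV (\<lambda>x. complex_of_real (f x))"
  by (rule smooth_bounded_linear[OF bounded_linear_of_real])

lemma smooth_minus: "smooth_on UNIV f \<Longrightarrow> smooth_on UNIV (\<lambda>x. - f x)"
  by (rule smooth_bounded_linear[OF bounded_linear_minus[OF bounded_linear_ident]])

lemma smooth_diff:
  "smooth_on UNIV f \<Longrightarrow> smooth_on UNIV g \<Longrightarrow> smooth_on UNIV (\<lambda>x. f x - g x)"
  using smooth_add[OF _ smooth_minus, of f g] by simp

lemma smooth_prod:
  fixes f :: "'i \<Rightarrow> 'a::euclidean_space \<Rightarrow> 'b::{real_normed_algebra,comm_ring_1}"
  shows "(\<And>i. i \<in> I \<Longrightarrow> smooth_on UNIV (f i)) \<Longrightarrow> smooth_on UNIV (\<lambda>x. \<Prod>i\<in>I. f i x)"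
  by (induction I rule: infinite_finite_induct) (auto intro!: smooth_const smooth_mult)

lemma smooth_power:
  fixes f :: "'a::euclidean_space \<Rightarrow> 'b::real_normed_algebra_1"
  shows "smooth_on UNIV f \<Longrightarrow> smooth_on UNIV (\<lambda>x. f x ^ n)"
  by (induction n) (auto intro!: smooth_const smooth_mult)

lemma has_derivative_affine:
  assumes "smooth_on UNIV f"
  shows "((\<lambda>x. f (t + c *\<^sub>R x)) has_derivative
    (\<lambda>v. c *\<^sub>R frechet_derivative f (at (t + c *\<^sub>R x)) v)) (at x)"
proof -
  have "((\<lambda>x. f (t + c *\<^sub>R x)) has_derivative
      (\<lambda>v. frechet_derivative f (at (t + c *\<^sub>R x)) (c *\<^sub>R v))) (at x)"
    by (rule has_derivative_compose[of "\<lambda>x. t + c *\<^sub>R x" "\<lambda>v. c *\<^sub>R v" x UNIV f])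
      (auto intro!: derivative_eq_intros smooth_has_derivative[OF assms])
  then show ?thesis
    using linear_cmul[OF has_derivative_linear[OF smooth_has_derivative[OF assms]]] by simp
qed

lemma partial_affine:
  "smooth_on UNIV f \<Longrightarrow> partial b (\<lambda>x. f (t + c *\<^sub>R x)) x = c *\<^sub>R partial b f (t + c *\<^sub>R x)"
  by (rule partial_eqI[OF has_derivative_affine])

lemma Ck_on_affine:
  "smooth_on UNIV f \<Longrightarrow> Ck_on k UNIV (\<lambda>x. f (t + c *\<^sub>R x))"
proof (induction k arbitrary: f)
  case 0
  then show ?case
    by (auto intro!: continuous_on_compose2[OF smooth_continuous_on[OF 0]] continuous_intros)
next
  case (Suc k)
  show ?case
  proof (rule Ck_on_SucI)
    show "((\<lambda>x. f (t + c *\<^sub>R x)) has_derivative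
        (\<lambda>v. c *\<^sub>R frechet_derivative f (at (t + c *\<^sub>R x)) v)) (at x)" for x
      by (rule has_derivative_affine[OF Suc.prems])
    show "Ck_on k UNIV (\<lambda>x. c *\<^sub>R frechet_derivative f (at (t + c *\<^sub>R x)) b)" if "b \<in> Basis" for b
      by (rule Ck_on_bounded_linear[OF bounded_linear_scaleR_right Suc.IH[OF smooth_partial[OF Suc.prems that]]])
  qed
qed

lemma smooth_affine: "smooth_on UNIV f \<Longrightarrow> smooth_on UNIV (\<lambda>x. f (t + c *\<^sub>R x))"
  using Ck_on_affine by (auto simp: smooth_on_def)

lemma partial_bounded_linear:
  "bounded_linear h \<Longrightarrow> smooth_on UNIV f \<Longrightarrow> partial b (\<lambda>x. h (f x)) x = h (partial b f x)"
  by (rule partial_eqI[OF bounded_linear.has_derivative[OF _ smooth_has_derivative]])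

lemma partial_scaleR:
  "smooth_on UNIV f \<Longrightarrow> smooth_on UNIV g \<Longrightarrow>
    partial b (\<lambda>x. f x *\<^sub>R g x) x = f x *\<^sub>R partial b g x + partial b f x *\<^sub>R g x"
  by (rule partial_eqI[OF bounded_bilinear.FDERIV[OF bounded_bilinear_scaleR
        smooth_has_derivative smooth_has_derivative]])

lemma partial_cnj: "smooth_on UNIV f \<Longrightarrow> partial b (\<lambda>x. cnj (f x)) x = cnj (partial b f x)"
  by (rule partial_bounded_linear[OF bounded_linear_cnj])

lemma partial_cmult: "smooth_on UNIV f \<Longrightarrow> partial b (\<lambda>x. c * f x) x = c * partial b f x"
  for f :: "'a::euclidean_space \<Rightarrow> 'b::real_normed_algebra"
  by (rule partial_bounded_linear[OF bounded_linear_mult_right])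

text \<open>The functions \<open>p(1/t) exp(-1/t)\<close>, extended by zero to \<open>t \<le> 0\<close>: allowing a polynomial factor makes the
family closed under differentiation, so that smoothness follows by induction.\<close>

definition flat :: "real poly \<Rightarrow> real \<Rightarrow> real" where
  "flat p t = (if t > 0 then poly p (1 / t) * exp (- (1 / t)) else 0)"

lemma flat_tendsto_0: "(flat p \<longlongrightarrow> 0) (at_right 0)"
proof -
  have "((\<lambda>u. poly p u * exp (- u)) \<longlongrightarrow> 0) at_top"
  proof -
    have "((\<lambda>u. \<Sum>i\<le>degree p. coeff p i * (u ^ i / exp u)) \<longlongrightarrow> (\<Sum>i\<le>degree p. coeff p i * 0)) at_top"
      by (intro tendsto_intros tendsto_power_div_exp_0)
    then show ?thesis
      by (simp add: poly_altdef exp_minus divide_inverse sum_distrib_right mult.assoc)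
  qed
  then have "((\<lambda>t. poly p (inverse t) * exp (- inverse t)) \<longlongrightarrow> 0) (at_right 0)"
    by (rule filterlim_compose) (rule filterlim_inverse_at_top_right)
  then show ?thesis
    by (rule Lim_transform_eventually)
      (auto simp: flat_def inverse_eq_divide eventually_at_right_less intro: eventually_at_rightI[of 0 1])
qed

lemma flat_has_derivative:
  "(flat p has_real_derivative flat ((p - pderiv p) * [:0,0,1:]) t) (at t)"
proof -
  let ?q = "(p - pderiv p) * [:0,0,1:]"
  consider "t > 0" | "t < 0" | "t = 0" by linarith
  then show ?thesis
  proof cases
    case 1
    have "((\<lambda>t. poly p (1 / t) * exp (- (1 / t))) has_real_derivative flat ?q t) (at t)"
      using 1 by (auto intro!: derivative_eq_intros simp: flat_def field_simps power2_eq_square)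
    then show ?thesis
      by (rule has_field_derivative_transform_within_open[where S = "{0<..}"])
        (use 1 in \<open>auto simp: flat_def\<close>)
  next
    case 2
    have "((\<lambda>t. 0) has_real_derivative flat ?q t) (at t)"
      using 2 by (auto simp: flat_def)
    then show ?thesis
      by (rule has_field_derivative_transform_within_open[where S = "{..<0}"])
        (use 2 in \<open>auto simp: flat_def\<close>)
  next
    case 3
    have "((\<lambda>h. (flat p h - flat p 0) / (h - 0)) \<longlongrightarrow> 0) (at 0)"
    proof (rule filterlim_split_at)
      show "((\<lambda>h. (flat p h - flat p 0) / (h - 0)) \<longlongrightarrow> 0) (at_left 0)"
        by (rule tendsto_eventually) (auto simp: flat_def eventually_at_filter)
      have "\<forall>\<^sub>F h in at_right 0. flat (pCons 0 p) h = (flat p h - flat p 0) / (h - 0)"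
        by (auto simp: flat_def eventually_at_filter)
      with flat_tendsto_0[of "pCons 0 p"]
      show "((\<lambda>h. (flat p h - flat p 0) / (h - 0)) \<longlongrightarrow> 0) (at_right 0)"
        by (rule Lim_transform_eventually)
    qed
    then show ?thesis
      by (simp add: 3 has_field_derivative_iff flat_def)
  qed
qed

lemma Ck_on_flat:
  assumes "smooth_on UNIV (q :: 'a::euclidean_space \<Rightarrow> real)"
  shows "Ck_on k UNIV (\<lambda>x. flat p (q x))"
proof (induction k arbitrary: p)
  case 0
  have "continuous_on UNIV (flat p)"
    using flat_has_derivative DERIV_isCont by (blast intro: continuous_at_imp_continuous_on)
  then show ?case
    using smooth_continuous_on[OF assms] by (auto intro: continuous_on_compose2)
next
  case (Suc k)
  let ?p = "(p - pderiv p) * [:0,0,1:]"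
  show ?case
  proof (rule Ck_on_SucI)
    show "((\<lambda>x. flat p (q x)) has_derivative
      (\<lambda>v. frechet_derivative q (at x) v * flat ?p (q x))) (at x)" for x
      using has_derivative_compose[OF smooth_has_derivative[OF assms],
          OF flat_has_derivative[unfolded has_field_derivative_def]] by (simp add: mult.commute)
    show "Ck_on k UNIV (\<lambda>x. frechet_derivative q (at x) b * flat ?p (q x))" if "b \<in> Basis" for b
      using smooth_partial[OF assms that]
      by (intro Ck_on_bilinear[OF bounded_bilinear_mult] Suc.IH) (simp add: smooth_on_def)
  qed
qed

lemma smooth_flat: "smooth_on UNIV q \<Longrightarrow> smooth_on UNIV (\<lambda>x. flat p (q x))"
  unfolding smooth_on_def[of _ "\<lambda>x. flat p (q x)"] using Ck_on_flat by auto

definition bump :: "'a::euclidean_space \<Rightarrow> real \<Rightarrow> 'a \<Rightarrow> real" where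
  "bump c r x = flat 1 (r\<^sup>2 - (x - c) \<bullet> (x - c))"

lemma smooth_bump: "smooth_on UNIV (bump c r)"
proof -
  have "smooth_on UNIV (\<lambda>x::'a. x - c)"
    by (intro smooth_diff smooth_const smooth_linear bounded_linear_ident)
  then have "smooth_on UNIV (\<lambda>x::'a. r\<^sup>2 - (x - c) \<bullet> (x - c))"
    by (intro smooth_diff[OF smooth_const] smooth_bilinear[OF bounded_bilinear_inner])
  then show ?thesis
    unfolding bump_def by (rule smooth_flat)
qed

lemma bump_nonneg: "0 \<le> bump c r x"
  by (simp add: bump_def flat_def)

lemma bump_less_1: "bump c r x < 1"
  by (simp add: bump_def flat_def)

lemma bump_le_1: "bump c r x \<le> 1"
  using bump_less_1[of c r x] by simp

lemma bump_pos_iff: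
  assumes "r > 0" shows "bump c r x > 0 \<longleftrightarrow> x \<in> ball c r"
proof -
  have "(x - c) \<bullet> (x - c) = (dist c x)\<^sup>2"
    by (simp add: power2_norm_eq_inner[symmetric] dist_norm norm_minus_commute)
  then show ?thesis
    using assms by (auto simp: bump_def flat_def abs_le_square_iff[symmetric] not_le[symmetric])
qed

section \<open>Calculus with square-integrable functions\<close>

lemma l2_rel_refl_iff: "l2_rel f f \<longleftrightarrow> square_integrable f"
  by (simp add: l2_rel_def)

lemma square_integrable_rep: "square_integrable (rep_l2 f)"
  using Quotient_rep_reflp[OF Quotient_l2] by (simp add: l2_rel_def)

lemma abs_rep_l2: "abs_l2 (rep_l2 f) = f"
  by (rule Quotient_abs_rep[OF Quotient_l2])

lemma l2_cases: obtains F where "square_integrable F" "f = abs_l2 F"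
  using square_integrable_rep abs_rep_l2 by metis

lemma abs_l2_eq_iff:
  "square_integrable f \<Longrightarrow> square_integrable g \<Longrightarrow> abs_l2 f = abs_l2 g \<longleftrightarrow> (AE x in lborel. f x = g x)"
  using Quotient_rel[OF Quotient_l2, of f g] by (auto simp: l2_rel_def)

lemma AE_rep_abs: "square_integrable f \<Longrightarrow> AE x in lborel. rep_l2 (abs_l2 f) x = f x"
  by (metis abs_l2_eq_iff abs_rep_l2 square_integrable_rep)

lemma square_integrable_diff:
  "square_integrable f \<Longrightarrow> square_integrable g \<Longrightarrow> square_integrable (\<lambda>x. f x - g x)"
  using square_integrable_add[OF _ square_integrable_uminus, of f g] by simp

lemma square_integrable_scaleR:
  "square_integrable f \<Longrightarrow> square_integrable (\<lambda>x. a *\<^sub>R f x)"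
  using square_integrable_cmult[of f "complex_of_real a"] by (simp add: scaleR_conv_of_real)

lemma square_integrable_borel: "square_integrable f \<Longrightarrow> f \<in> borel_measurable borel"
  by (simp add: square_integrable_def)

lemma square_integrable_bound:
  assumes "square_integrable f" "g \<in> borel_measurable borel" "\<And>x. cmod (g x) \<le> C * cmod (f x)"
  shows "square_integrable g"
proof -
  have "integrable lborel (\<lambda>x. (cmod (g x))\<^sup>2)"
  proof (rule Bochner_Integration.integrable_bound)
    show "integrable lborel (\<lambda>x. C\<^sup>2 * (cmod (f x))\<^sup>2)"
      using assms(1) by (simp add: square_integrable_def)
    show "AE x in lborel. norm ((cmod (g x))\<^sup>2) \<le> norm (C\<^sup>2 * (cmod (f x))\<^sup>2)"
      using power_mono[OF assms(3) norm_ge_zero, of _ 2] by (simp add: power_mult_distrib)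
  qed (use assms(2) in measurable)
  then show ?thesis using assms(2) by (simp add: square_integrable_def)
qed

lemma abs_l2_zero: "abs_l2 (\<lambda>x. 0) = 0"
  by (simp add: zero_l2_def)

lemma abs_l2_add:
  "square_integrable f \<Longrightarrow> square_integrable g \<Longrightarrow> abs_l2 (\<lambda>x. f x + g x) = abs_l2 f + abs_l2 g"
  by (simp add: plus_l2.abs_eq l2_rel_refl_iff)

lemma abs_l2_minus: "square_integrable f \<Longrightarrow> abs_l2 (\<lambda>x. - f x) = - abs_l2 f"
  by (simp add: uminus_l2.abs_eq l2_rel_refl_iff)

lemma abs_l2_diff:
  "square_integrable f \<Longrightarrow> square_integrable g \<Longrightarrow> abs_l2 (\<lambda>x. f x - g x) = abs_l2 f - abs_l2 g"
  using abs_l2_add[OF _ square_integrable_uminus, of f g] by (simp add: abs_l2_minus)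

lemma abs_l2_scaleC: "square_integrable f \<Longrightarrow> abs_l2 (\<lambda>x. c * f x) = scaleC c (abs_l2 f)"
  by (simp add: scaleC.abs_eq l2_rel_refl_iff)

lemma abs_l2_scaleR: "square_integrable f \<Longrightarrow> abs_l2 (\<lambda>x. a *\<^sub>R f x) = a *\<^sub>R abs_l2 f"
  by (simp add: scaleR_l2_def scaleR_conv_of_real abs_l2_scaleC)

lemma square_integrable_sum:
  "(\<And>i. i \<in> I \<Longrightarrow> square_integrable (f i)) \<Longrightarrow> square_integrable (\<lambda>x. \<Sum>i\<in>I. f i x)"
  by (induction I rule: infinite_finite_induct) (auto intro!: square_integrable_zero square_integrable_add)

lemma abs_l2_sum:
  "(\<And>i. i \<in> I \<Longrightarrow> square_integrable (f i)) \<Longrightarrow> abs_l2 (\<lambda>x. \<Sum>i\<in>I. f i x) = (\<Sum>i\<in>I. abs_l2 (f i))"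
  by (induction I rule: infinite_finite_induct)
    (auto simp: abs_l2_zero abs_l2_add square_integrable_sum)

abbreviation ind :: "'a set \<Rightarrow> 'a \<Rightarrow> complex" where "ind A \<equiv> (\<lambda>x. of_real (indicat_real A x))"

lemma square_integrable_ind:
  assumes "A \<in> sets borel" "emeasure lborel A < \<infinity>"
  shows "square_integrable (ind A)"
proof -
  have "(\<lambda>x. (cmod (ind A x))\<^sup>2) = indicat_real A" by (auto simp: indicator_def)
  then show ?thesis
    using assms by (simp add: square_integrable_def)
qed

lemma cinner_abs:
  "square_integrable f \<Longrightarrow> square_integrable g \<Longrightarrow>
    cinner (abs_l2 f) (abs_l2 g) = (\<integral>x. f x * cnj (g x) \<partial>lborel)"
  by (simp add: cinner.abs_eq l2_rel_refl_iff)

lemma inner_abs: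
  "square_integrable f \<Longrightarrow> square_integrable g \<Longrightarrow>
    inner (abs_l2 f) (abs_l2 g) = Re (\<integral>x. f x * cnj (g x) \<partial>lborel)"
  by (simp add: inner_l2_def cinner_abs)

lemma norm_abs_sq:
  assumes "square_integrable f"
  shows "(norm (abs_l2 f))\<^sup>2 = (\<integral>x. (cmod (f x))\<^sup>2 \<partial>lborel)"
proof -
  have "(norm (abs_l2 f))\<^sup>2 = Re (\<integral>x. f x * cnj (f x) \<partial>lborel)"
    by (simp add: power2_norm_eq_inner inner_abs assms)
  also have "\<dots> = (\<integral>x. (cmod (f x))\<^sup>2 \<partial>lborel)"
    by (simp add: complex_norm_square[symmetric] flip: integral_of_real of_real_power)
  finally show ?thesis .
qed

text \<open>Dominated convergence in the quadratic mean.\<close>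

lemma abs_l2_tendsto:
  assumes "\<And>n. square_integrable (F n)" "square_integrable G" "integrable lborel w"
    and "\<And>x. (\<lambda>n. F n x) \<longlonglongrightarrow> G x" "\<And>n x. (cmod (F n x - G x))\<^sup>2 \<le> w x"
  shows "(\<lambda>n. abs_l2 (F n)) \<longlonglongrightarrow> abs_l2 G"
proof -
  have "(\<lambda>n. \<integral>x. (cmod (F n x - G x))\<^sup>2 \<partial>lborel) \<longlonglongrightarrow> integral\<^sup>L lborel (\<lambda>x::'a. 0::real)"
  proof (rule integral_dominated_convergence[where w = w])
    show "(\<lambda>x. (cmod (F n x - G x))\<^sup>2) \<in> borel_measurable lborel" for n
      using square_integrable_borel[OF assms(1)] square_integrable_borel[OF assms(2)] by measurable
    show "AE x in lborel. (\<lambda>n. (cmod (F n x - G x))\<^sup>2) \<longlonglongrightarrow> 0"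
    proof (intro AE_I2)
      fix x
      have "(\<lambda>n. (cmod (F n x - G x))\<^sup>2) \<longlonglongrightarrow> (cmod (G x - G x))\<^sup>2"
        by (intro tendsto_intros assms(4))
      then show "(\<lambda>n. (cmod (F n x - G x))\<^sup>2) \<longlonglongrightarrow> 0" by simp
    qed
    show "AE x in lborel. norm ((cmod (F n x - G x))\<^sup>2) \<le> w x" for n
      using assms(5) by simp
  qed (use assms(3) in auto)
  then have "(\<lambda>n. (norm (abs_l2 (F n) - abs_l2 G))\<^sup>2) \<longlonglongrightarrow> 0"
    by (simp add: norm_abs_sq square_integrable_diff assms(1,2) flip: abs_l2_diff)
  then have "(\<lambda>n. sqrt ((norm (abs_l2 (F n) - abs_l2 G))\<^sup>2)) \<longlonglongrightarrow> sqrt 0"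
    by (rule tendsto_real_sqrt)
  then have "(\<lambda>n. norm (abs_l2 (F n) - abs_l2 G)) \<longlonglongrightarrow> 0" by simp
  then show ?thesis by (rule LIM_zero_cancel[OF tendsto_norm_zero_cancel])
qed

lemma cinner_add_left: "cinner (f + g) h = cinner f h + cinner g h"
  by transfer (simp add: l2_rel_def distrib_right integrable_mult_cnj)

lemma cinner_commute: "cinner f g = cnj (cinner g f)"
  by transfer (subst Bochner_Integration.integral_cnj[symmetric], simp add: mult.commute)

lemma cinner_add_right: "cinner f (g + h) = cinner f g + cinner f h"
  by (subst (1 2 3) cinner_commute) (simp add: cinner_add_left)

lemma cinner_scaleC_left: "cinner (scaleC c f) g = c * cinner f g"
  by transfer (simp add: mult.assoc)

lemma cinner_scaleC_right: "cinner f (scaleC c g) = cnj c * cinner f g"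
  by (subst (1 2) cinner_commute) (simp add: cinner_scaleC_left)

lemma cinner_zero_left: "cinner 0 g = 0"
  by transfer simp

lemma Im_cinner: "Im (cinner f g) = inner f (scaleC \<i> g)"
  by (simp add: inner_l2_def cinner_scaleC_right)

lemma scaleC_add_right: "scaleC c (f + g) = scaleC c f + scaleC c g"
  by transfer (simp add: l2_rel_def square_integrable_add square_integrable_cmult distrib_left)

lemma norm_scaleC: "norm (scaleC c f) = cmod c * norm f"
proof -
  have "cinner (scaleC c f) (scaleC c f) = of_real ((cmod c)\<^sup>2) * cinner f f"
    by (simp add: cinner_scaleC_left cinner_scaleC_right complex_norm_square mult.assoc flip: of_real_power)
  then show ?thesis
    by (simp add: norm_l2_def real_sqrt_mult)
qed

lemma norm_cinner_sq_eq: "(cmod (cinner f g))\<^sup>2 = (inner f g)\<^sup>2 + (inner f (scaleC \<i> g))\<^sup>2"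
  by (simp add: cmod_power2 Im_cinner[symmetric]) (simp add: inner_l2_def)

lemma abs_mem_L2_iff:
  assumes "square_integrable F" shows "abs_l2 F \<in> L2 \<Omega> \<longleftrightarrow> (AE x in lborel. x \<notin> \<Omega> \<longrightarrow> F x = 0)"
proof -
  have "(AE x in lborel. x \<notin> \<Omega> \<longrightarrow> rep_l2 (abs_l2 F) x = 0) \<longleftrightarrow> (AE x in lborel. x \<notin> \<Omega> \<longrightarrow> F x = 0)"
    using AE_rep_abs[OF assms] by (auto elim!: AE_mp)
  then show ?thesis by (simp add: L2_def)
qed

lemma L2_add: "f \<in> L2 \<Omega> \<Longrightarrow> g \<in> L2 \<Omega> \<Longrightarrow> f + g \<in> L2 \<Omega>"
  by (cases f rule: l2_cases; cases g rule: l2_cases)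
    (auto simp: abs_l2_add[symmetric] abs_mem_L2_iff square_integrable_add elim: eventually_elim2)

lemma L2_scaleC: "f \<in> L2 \<Omega> \<Longrightarrow> scaleC c f \<in> L2 \<Omega>"
  by (cases f rule: l2_cases)
    (auto simp: abs_l2_scaleC[symmetric] abs_mem_L2_iff square_integrable_cmult elim: eventually_mono)

lemma L2_scaleR: "f \<in> L2 \<Omega> \<Longrightarrow> a *\<^sub>R f \<in> L2 \<Omega>"
  by (simp add: scaleR_l2_def L2_scaleC)

lemma L2_minus: "f \<in> L2 \<Omega> \<Longrightarrow> - f \<in> L2 \<Omega>"
  using L2_scaleR[of f \<Omega> "-1"] by simp

lemma L2_diff: "f \<in> L2 \<Omega> \<Longrightarrow> g \<in> L2 \<Omega> \<Longrightarrow> f - g \<in> L2 \<Omega>"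
  using L2_add[of f \<Omega> "-g"] L2_minus[of g] by simp

lemma L2_zero: "0 \<in> L2 \<Omega>"
  by (simp add: abs_l2_zero[symmetric] abs_mem_L2_iff square_integrable_zero)

definition bounded_borel :: "('a::euclidean_space \<Rightarrow> real) \<Rightarrow> bool" where
  "bounded_borel c \<longleftrightarrow> c \<in> borel_measurable borel \<and> bounded (range c)"

text \<open>Only real multipliers occur; they act as symmetric operators (\<open>inner_mul\<close>).\<close>

definition mul :: "('a::euclidean_space \<Rightarrow> real) \<Rightarrow> 'a l2 \<Rightarrow> 'a l2" where
  "mul c f = abs_l2 (\<lambda>x. c x *\<^sub>R rep_l2 f x)"

lemma bounded_borelI: "c \<in> borel_measurable borel \<Longrightarrow> (\<And>x. \<bar>c x\<bar> \<le> C) \<Longrightarrow> bounded_borel c"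
  by (auto simp: bounded_borel_def bounded_iff)

lemma bounded_borelE: assumes "bounded_borel c" obtains C where "c \<in> borel_measurable borel" "\<And>x. \<bar>c x\<bar> \<le> C"
  using assms by (auto simp: bounded_borel_def bounded_iff)

lemma bounded_borel_mult: "bounded_borel c \<Longrightarrow> bounded_borel d \<Longrightarrow> bounded_borel (\<lambda>x. c x * d x)"
proof (elim bounded_borelE)
  fix C D assume "c \<in> borel_measurable borel" "d \<in> borel_measurable borel"
    and "\<And>x. \<bar>c x\<bar> \<le> C" "\<And>x. \<bar>d x\<bar> \<le> D"
  then show ?thesis
    by (intro bounded_borelI[of _ "C * D"]) (auto simp: abs_mult intro!: mult_mono intro: order_trans[OF abs_ge_zero])
qed

lemma bounded_borel_add: "bounded_borel c \<Longrightarrow> bounded_borel d \<Longrightarrow> bounded_borel (\<lambda>x. c x + d x)"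
proof (elim bounded_borelE)
  fix C D assume c: "c \<in> borel_measurable borel" "d \<in> borel_measurable borel"
    and b: "\<And>x. \<bar>c x\<bar> \<le> C" "\<And>x. \<bar>d x\<bar> \<le> D"
  have "\<bar>c x + d x\<bar> \<le> C + D" for x using b[of x] by linarith
  with c show ?thesis by (intro bounded_borelI[of _ "C + D"]) auto
qed

lemma bounded_borel_indicator: "A \<in> sets borel \<Longrightarrow> bounded_borel (indicator A)"
  by (rule bounded_borelI[of _ 1]) (auto simp: indicator_def)

lemma square_integrable_mul:
  assumes "bounded_borel c" "square_integrable F" shows "square_integrable (\<lambda>x. c x *\<^sub>R F x)"
proof -
  obtain C where "c \<in> borel_measurable borel" and C: "\<And>x. \<bar>c x\<bar> \<le> C"
    using assms(1) by (metis bounded_borelE)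
  moreover have "F \<in> borel_measurable borel" using assms(2) by (rule square_integrable_borel)
  ultimately show ?thesis
    by (intro square_integrable_bound[OF assms(2), of _ C]) (auto intro!: mult_right_mono)
qed

lemma mul_abs: "bounded_borel c \<Longrightarrow> square_integrable F \<Longrightarrow> mul c (abs_l2 F) = abs_l2 (\<lambda>x. c x *\<^sub>R F x)"
  using AE_rep_abs[of F] unfolding mul_def
  by (subst abs_l2_eq_iff) (auto intro!: square_integrable_mul square_integrable_rep elim: eventually_mono)

lemma mul_add: "bounded_borel c \<Longrightarrow> mul c (f + g) = mul c f + mul c g"
  by (cases f rule: l2_cases; cases g rule: l2_cases)
    (simp add: mul_abs square_integrable_mul square_integrable_add scaleR_add_right flip: abs_l2_add)

lemma mul_scaleC: "bounded_borel c \<Longrightarrow> mul c (scaleC a f) = scaleC a (mul c f)"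
proof (cases f rule: l2_cases)
  case (1 F)
  assume c: "bounded_borel c"
  have "mul c (scaleC a f) = abs_l2 (\<lambda>x. a * (c x *\<^sub>R F x))"
    using 1 c by (simp add: mul_abs square_integrable_cmult flip: abs_l2_scaleC)
  also have "\<dots> = scaleC a (mul c f)"
    using 1 c abs_l2_scaleC[OF square_integrable_mul[OF c 1(1)]] by (simp add: mul_abs)
  finally show ?thesis .
qed

lemma mul_scaleR: "bounded_borel c \<Longrightarrow> mul c (a *\<^sub>R f) = a *\<^sub>R mul c f"
  by (simp add: scaleR_l2_def mul_scaleC)

lemma mul_minus: "bounded_borel c \<Longrightarrow> mul c (- f) = - mul c f"
  using mul_scaleR[of c "-1" f] by simp

lemma mul_diff: "bounded_borel c \<Longrightarrow> mul c (f - g) = mul c f - mul c g"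
  using mul_add[of c f "-g"] by (simp add: mul_minus)

lemma mul_mul: "bounded_borel c \<Longrightarrow> bounded_borel d \<Longrightarrow> mul c (mul d f) = mul (\<lambda>x. c x * d x) f"
  by (cases f rule: l2_cases) (simp add: mul_abs square_integrable_mul bounded_borel_mult)

lemma mul_add_left: "bounded_borel c \<Longrightarrow> bounded_borel d \<Longrightarrow> mul (\<lambda>x. c x + d x) f = mul c f + mul d f"
  by (cases f rule: l2_cases)
    (simp add: mul_abs square_integrable_mul bounded_borel_add scaleR_add_left flip: abs_l2_add)

lemma inner_mul: "bounded_borel c \<Longrightarrow> inner (mul c f) g = inner f (mul c g)"
  by (cases f rule: l2_cases; cases g rule: l2_cases)
    (simp add: mul_abs square_integrable_mul inner_abs complex_cnj_scaleR)

lemma norm_mul_le: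
  assumes "bounded_borel c" "\<And>x. \<bar>c x\<bar> \<le> C" shows "norm (mul c f) \<le> C * norm f"
proof (cases f rule: l2_cases)
  case (1 F)
  have C: "0 \<le> C" using assms(2) order_trans[OF abs_ge_zero] by blast
  have "(norm (mul c f))\<^sup>2 = (\<integral>x. (cmod (c x *\<^sub>R F x))\<^sup>2 \<partial>lborel)"
    using 1 assms by (simp add: mul_abs norm_abs_sq square_integrable_mul del: norm_scaleR)
  also have "\<dots> \<le> (\<integral>x. C\<^sup>2 * (cmod (F x))\<^sup>2 \<partial>lborel)"
  proof (rule integral_mono)
    show "integrable lborel (\<lambda>x. (cmod (c x *\<^sub>R F x))\<^sup>2)" "integrable lborel (\<lambda>x. C\<^sup>2 * (cmod (F x))\<^sup>2)"
      using 1 square_integrable_mul[OF assms(1), of F] by (simp_all add: square_integrable_def)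
    show "(cmod (c x *\<^sub>R F x))\<^sup>2 \<le> C\<^sup>2 * (cmod (F x))\<^sup>2" for x
      using assms(2) by (auto simp: power_mult_distrib intro!: mult_right_mono abs_le_square_iff[THEN iffD1] order_trans[OF _ abs_ge_self])
  qed
  also have "\<dots> = (C * norm f)\<^sup>2"
    using 1 by (simp add: norm_abs_sq power_mult_distrib)
  finally show ?thesis using C by (rule_tac power2_le_imp_le) auto
qed

lemma bounded_linear_mul:
  assumes "bounded_borel c" shows "bounded_linear (mul c)"
proof -
  obtain C where C: "\<And>x. \<bar>c x\<bar> \<le> C" using assms by (metis bounded_borelE)
  show ?thesis
    by (rule bounded_linear_intro[of _ C])
      (use norm_mul_le[OF assms C] in \<open>auto simp: mul_add mul_scaleR assms mult.commute\<close>)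
qed

lemma tendsto_mul: "bounded_borel c \<Longrightarrow> (f \<longlongrightarrow> l) F \<Longrightarrow> ((\<lambda>x. mul c (f x)) \<longlongrightarrow> mul c l) F"
  by (rule bounded_linear.tendsto[OF bounded_linear_mul])

lemma mul_L2_eq_self:
  assumes "f \<in> L2 \<Omega>" "\<Omega> \<in> sets borel" shows "mul (indicator \<Omega>) f = f"
proof (cases f rule: l2_cases)
  case (1 F)
  then have "AE x in lborel. indicator \<Omega> x *\<^sub>R F x = F x"
    using assms by (auto simp: abs_mem_L2_iff indicator_def elim: eventually_mono)
  with 1 show ?thesis
    by (simp add: mul_abs bounded_borel_indicator assms abs_l2_eq_iff square_integrable_mul)
qed

lemma mul_L2: "bounded_borel c \<Longrightarrow> f \<in> L2 \<Omega> \<Longrightarrow> mul c f \<in> L2 \<Omega>"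
  by (cases f rule: l2_cases)
    (auto simp: mul_abs abs_mem_L2_iff square_integrable_mul elim: eventually_mono)

definition shift :: "'a::euclidean_space \<Rightarrow> 'a l2 \<Rightarrow> 'a l2" where
  "shift z f = abs_l2 (\<lambda>x. rep_l2 f (x + z))"

lemma AE_lborel_shift:
  fixes z :: "'a::euclidean_space"
  assumes "AE x in lborel. P x" shows "AE x in lborel. P (x + z)"
proof -
  have "AE x in distr lborel borel ((+) z). P x"
    using assms by (subst lborel_distr_plus)
  then have "AE x in lborel. P (z + x)"
    by (rule AE_distrD[rotated]) simp
  then show ?thesis by (simp add: add.commute)
qed

lemma integrable_lborel_shift:
  fixes f :: "'a::euclidean_space \<Rightarrow> 'b::{banach, second_countable_topology}"
  assumes "integrable lborel f" shows "integrable lborel (\<lambda>x. f (x + z))"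
  using integrable_distr[of "(+) z" lborel borel f] assms
  by (simp add: lborel_distr_plus add.commute)

lemma integral_lborel_shift:
  fixes f :: "'a::euclidean_space \<Rightarrow> 'b::{banach, second_countable_topology}"
  assumes "f \<in> borel_measurable borel"
  shows "(\<integral>x. f (x + z) \<partial>lborel) = (\<integral>x. f x \<partial>lborel)"
  using integral_distr[of "(+) z" lborel borel f] assms
  by (simp add: lborel_distr_plus add.commute)

lemma square_integrable_shift:
  assumes "square_integrable F" shows "square_integrable (\<lambda>x. F (x + z))"
  using assms integrable_lborel_shift[of "\<lambda>x. (cmod (F x))\<^sup>2" z]
  by (auto simp: square_integrable_def)

lemma shift_abs: "square_integrable F \<Longrightarrow> shift z (abs_l2 F) = abs_l2 (\<lambda>x. F (x + z))"
  unfolding shift_def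
  using AE_lborel_shift[OF AE_rep_abs, of F z]
  by (subst abs_l2_eq_iff) (auto intro!: square_integrable_shift square_integrable_rep)

lemma shift_diff: "shift z (f - g) = shift z f - shift z g"
  by (cases f rule: l2_cases; cases g rule: l2_cases)
    (simp add: shift_abs square_integrable_shift square_integrable_diff flip: abs_l2_diff)

lemma shift_scaleR: "shift z (a *\<^sub>R f) = a *\<^sub>R shift z f"
  by (cases f rule: l2_cases)
    (simp add: shift_abs square_integrable_shift square_integrable_scaleR del: scaleR_conv_of_real flip: abs_l2_scaleR)

lemma inner_shift: "inner (shift z f) (shift z g) = inner f g"
proof (cases f rule: l2_cases; cases g rule: l2_cases)
  fix F G assume "square_integrable F" "f = abs_l2 F" "square_integrable G" "g = abs_l2 G"
  then show ?thesis
    using integral_lborel_shift[of "\<lambda>x. F x * cnj (G x)" z]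
    using borel_measurable_integrable[OF integrable_mult_cnj, of F G]
    by (simp add: shift_abs inner_abs square_integrable_shift)
qed

lemma norm_shift: "norm (shift z f) = norm f"
  by (simp add: norm_eq_sqrt_inner inner_shift)

lemma tendsto_shift:
  assumes "(f \<longlongrightarrow> l) F" shows "((\<lambda>x. shift z (f x)) \<longlongrightarrow> shift z l) F"
proof (rule LIM_zero_cancel[OF tendsto_norm_zero_cancel])
  show "((\<lambda>x. norm (shift z (f x) - shift z l)) \<longlongrightarrow> 0) F"
    using tendsto_norm_zero[OF LIM_zero[OF assms]] by (simp add: norm_shift flip: shift_diff)
qed

lemma shift_shift: "shift y (shift z f) = shift (y + z) f"
  by (cases f rule: l2_cases) (simp add: shift_abs square_integrable_shift add.assoc)

lemma shift_0: "shift 0 f = f"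
  by (cases f rule: l2_cases) (simp add: shift_abs)

section \<open>Test functions and weak derivatives\<close>

lemma test_functionI:
  assumes "smooth_on UNIV \<phi>" "compact K" "K \<subseteq> \<Omega>" "\<And>x. x \<notin> K \<Longrightarrow> \<phi> x = 0"
  shows "test_function \<Omega> \<phi>"
proof -
  have "closure {x. \<phi> x \<noteq> 0} \<subseteq> K"
    using assms by (intro closure_minimal compact_imp_closed) auto
  moreover from this have "K \<inter> closure {x. \<phi> x \<noteq> 0} = closure {x. \<phi> x \<noteq> 0}" by (rule Int_absorb1)
  then have "compact (closure {x. \<phi> x \<noteq> 0})"
    using compact_Int_closed[OF assms(2) closed_closure, of "{x. \<phi> x \<noteq> 0}"] by simp
  ultimately show ?thesis
    using assms(1,3) unfolding test_function_def by (meson order_trans)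
qed

lemma test_functionE:
  assumes "test_function \<Omega> \<phi>"
  obtains K where "smooth_on UNIV \<phi>" "compact K" "K \<subseteq> \<Omega>" "\<And>x. x \<notin> K \<Longrightarrow> \<phi> x = 0"
proof (rule that)
  show "x \<notin> closure {x. \<phi> x \<noteq> 0} \<Longrightarrow> \<phi> x = 0" for x
    using closure_subset[of "{x. \<phi> x \<noteq> 0}"] by auto
qed (use assms in \<open>auto simp: test_function_def\<close>)

lemma test_smooth: "test_function \<Omega> \<phi> \<Longrightarrow> smooth_on UNIV \<phi>"
  by (simp add: test_function_def)

lemma test_function_zero_outside: "test_function \<Omega> \<phi> \<Longrightarrow> x \<notin> \<Omega> \<Longrightarrow> \<phi> x = 0"
  by (erule test_functionE) blast

lemma test_function_mono: "test_function \<Omega> \<phi> \<Longrightarrow> \<Omega> \<subseteq> \<Omega>' \<Longrightarrow> test_function \<Omega>' \<phi>"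
  by (auto simp: test_function_def)

lemma partial_zero_outside:
  assumes "compact K" "\<And>x. x \<notin> K \<Longrightarrow> \<phi> x = 0" "x \<notin> K"
  shows "partial z \<phi> x = 0"
proof -
  have "(\<phi> has_derivative (\<lambda>_. 0)) (at x)"
    by (rule has_derivative_transform_within_open[of "\<lambda>_. 0" _ x UNIV "- K"])
      (use assms in \<open>auto intro: compact_imp_closed\<close>)
  then show ?thesis by (rule partial_eqI)
qed

lemma test_partial:
  assumes "test_function \<Omega> \<phi>" "b \<in> Basis"
  shows "test_function \<Omega> (partial b \<phi>)"
  using assms(1)
proof (rule test_functionE)
  fix K assume K: "smooth_on UNIV \<phi>" "compact K" "K \<subseteq> \<Omega>" "\<And>x. x \<notin> K \<Longrightarrow> \<phi> x = 0"
  show ?thesis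
    by (rule test_functionI[OF smooth_partial[OF K(1) assms(2)] K(2,3)])
      (rule partial_zero_outside[OF K(2,4)])
qed

lemma test_add:
  assumes "test_function \<Omega> \<phi>" "test_function \<Omega> \<psi>" shows "test_function \<Omega> (\<lambda>x. \<phi> x + \<psi> x)"
  using assms
proof (elim test_functionE)
  fix K L assume "smooth_on UNIV \<phi>" "compact K" "K \<subseteq> \<Omega>" "\<And>x. x \<notin> K \<Longrightarrow> \<phi> x = 0"
    and "smooth_on UNIV \<psi>" "compact L" "L \<subseteq> \<Omega>" "\<And>x. x \<notin> L \<Longrightarrow> \<psi> x = 0"
  then show ?thesis
    by (intro test_functionI[of _ "K \<union> L"] smooth_add) (simp_all add: compact_Un)
qed

lemma test_zero: "test_function \<Omega> (\<lambda>x. 0)"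
  by (rule test_functionI[of _ "{}"]) (simp_all add: smooth_const)

lemma test_sum:
  "(\<And>i. i \<in> I \<Longrightarrow> test_function \<Omega> (f i)) \<Longrightarrow> test_function \<Omega> (\<lambda>x. \<Sum>i\<in>I. f i x)"
  by (induction I rule: infinite_finite_induct) (auto intro: test_zero test_add)

lemma test_bounded_linear:
  assumes "bounded_linear h" "test_function \<Omega> \<phi>" shows "test_function \<Omega> (\<lambda>x. h (\<phi> x))"
  using assms(2)
proof (rule test_functionE)
  fix K assume K: "smooth_on UNIV \<phi>" "compact K" "K \<subseteq> \<Omega>" "\<And>x. x \<notin> K \<Longrightarrow> \<phi> x = 0"
  show ?thesis
    by (rule test_functionI[OF smooth_bounded_linear[OF assms(1) K(1)] K(2,3)])
      (simp add: K(4) linear_0 bounded_linear.linear[OF assms(1)])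
qed

lemma test_cmult: "test_function \<Omega> \<phi> \<Longrightarrow> test_function \<Omega> (\<lambda>x. c * \<phi> x)"
  by (rule test_bounded_linear[OF bounded_linear_mult_right])

lemma smooth_supported_bounded:
  assumes "smooth_on UNIV f" "compact K" "\<And>x. x \<notin> K \<Longrightarrow> f x = 0"
  obtains C where "\<And>x. norm (f x) \<le> C"
proof -
  have "bounded (f ` K)"
    using assms by (auto intro!: compact_imp_bounded compact_continuous_image
        intro: continuous_on_subset[OF smooth_continuous_on])
  then obtain C where "\<And>x. x \<in> K \<Longrightarrow> norm (f x) \<le> C" "0 \<le> C"
    by (auto simp: bounded_iff) (metis norm_ge_zero order_trans linear)
  then show ?thesis
    using assms(3) by (intro that[of C]) (metis norm_zero)
qed

lemma test_bounded:
  assumes "test_function \<Omega> \<phi>" obtains C where "\<And>x. cmod (\<phi> x) \<le> C"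
  by (rule test_functionE[OF assms], erule smooth_supported_bounded) (assumption | rule that | blast)+

lemma square_integrable_of_bounded:
  assumes "f \<in> borel_measurable borel" "compact K" "\<And>x. cmod (f x) \<le> C * indicator K x"
  shows "square_integrable f"
proof -
  have "integrable lborel (\<lambda>x. (cmod (f x))\<^sup>2)"
  proof (rule Bochner_Integration.integrable_bound)
    show "integrable lborel (\<lambda>x. C\<^sup>2 * indicat_real K x)"
      using assms(2) emeasure_compact_finite[of K] by (auto simp: compact_imp_closed)
    have "(cmod (f x))\<^sup>2 \<le> C\<^sup>2 * indicator K x" for x
      using power_mono[OF assms(3) norm_ge_zero, of x 2] by (auto simp: indicator_def split: if_splits)
    then show "AE x in lborel. norm ((cmod (f x))\<^sup>2) \<le> norm (C\<^sup>2 * indicat_real K x)"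
      by auto
  qed (use assms(1) in measurable)
  then show ?thesis using assms(1) by (simp add: square_integrable_def)
qed

lemma square_integrable_test: "test_function \<Omega> \<phi> \<Longrightarrow> square_integrable \<phi>"
proof (erule test_functionE)
  fix K assume K: "smooth_on UNIV \<phi>" "compact K" "K \<subseteq> \<Omega>" "\<And>x. x \<notin> K \<Longrightarrow> \<phi> x = 0"
  obtain C where "\<And>x. cmod (\<phi> x) \<le> C" using smooth_supported_bounded[OF K(1,2,4)] by blast
  with K show ?thesis
    by (intro square_integrable_of_bounded[of _ K C] smooth_borel) (auto simp: indicator_def)
qed

lemma test_mem_L2: "test_function \<Omega> \<phi> \<Longrightarrow> abs_l2 \<phi> \<in> L2 \<Omega>"
  by (auto simp: abs_mem_L2_iff square_integrable_test test_function_zero_outside)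

lemma restrict_l2_test: "test_function \<Omega> \<phi> \<Longrightarrow> restrict_l2 \<Omega> \<phi> = abs_l2 \<phi>"
  unfolding restrict_l2_def by (rule arg_cong[of _ _ abs_l2]) (auto simp: test_function_zero_outside)

lemma frechet_derivative_Basis_sum:
  assumes "smooth_on UNIV \<phi>"
  shows "frechet_derivative \<phi> (at x) z = (\<Sum>b\<in>Basis. (z \<bullet> b) *\<^sub>R partial b \<phi> x)"
proof -
  have "linear (frechet_derivative \<phi> (at x))"
    using smooth_has_derivative[OF assms] by (rule has_derivative_linear)
  then have "frechet_derivative \<phi> (at x) (\<Sum>b\<in>Basis. (z \<bullet> b) *\<^sub>R b) = (\<Sum>b\<in>Basis. (z \<bullet> b) *\<^sub>R partial b \<phi> x)"
    by (simp add: linear_sum linear_cmul)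
  then show ?thesis by (simp add: euclidean_representation)
qed

lemma partial_general_eq:
  "smooth_on UNIV \<phi> \<Longrightarrow> partial z \<phi> = (\<lambda>x. \<Sum>b\<in>Basis. (z \<bullet> b) *\<^sub>R partial b \<phi> x)"
  using frechet_derivative_Basis_sum by blast

lemma test_partial_general:
  assumes "test_function \<Omega> \<phi>" shows "test_function \<Omega> (partial z \<phi>)"
  unfolding partial_general_eq[OF test_smooth[OF assms], of z]
  by (intro test_sum test_bounded_linear[OF bounded_linear_scaleR_right] test_partial[OF assms])

lemma abs_partial_general:
  assumes "test_function \<Omega> \<phi>"
  shows "abs_l2 (partial z \<phi>) = (\<Sum>b\<in>Basis. (z \<bullet> b) *\<^sub>R abs_l2 (partial b \<phi>))"
  unfolding partial_general_eq[OF test_smooth[OF assms], of z]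
  using square_integrable_test[OF test_partial[OF assms]]
  by (subst abs_l2_sum) (auto intro!: square_integrable_scaleR sum.cong simp: abs_l2_scaleR simp del: scaleR_conv_of_real)

lemma has_vector_derivative_iff_quotient:
  fixes f :: "real \<Rightarrow> 'a::real_normed_vector"
  shows "(f has_vector_derivative D) (at x) \<longleftrightarrow> ((\<lambda>h. (f (x + h) - f x) /\<^sub>R h) \<longlongrightarrow> D) (at 0)"
proof -
  have eq: "norm (f (x + h) - f x - h *\<^sub>R D) / norm h = norm ((f (x + h) - f x) /\<^sub>R h - D)" if "h \<noteq> 0" for h
  proof -
    have "(f (x + h) - f x) /\<^sub>R h - D = (f (x + h) - f x - h *\<^sub>R D) /\<^sub>R h"
      using that by (simp only: scaleR_diff_right scaleR_scaleR) simp
    then show ?thesis by (simp only: norm_scaleR) (simp add: divide_inverse_commute)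
  qed
  have "(f has_vector_derivative D) (at x) \<longleftrightarrow> ((\<lambda>h. norm (f (x + h) - f x - h *\<^sub>R D) / norm h) \<longlongrightarrow> 0) (at 0)"
    by (simp add: has_vector_derivative_def has_derivative_at bounded_linear_scaleR_left)
  also have "\<dots> \<longleftrightarrow> ((\<lambda>h. norm ((f (x + h) - f x) /\<^sub>R h - D)) \<longlongrightarrow> 0) (at 0)"
    by (rule tendsto_cong) (use eq in \<open>simp add: eventually_at_filter del: real_norm_def\<close>)
  also have "\<dots> \<longleftrightarrow> ((\<lambda>h. (f (x + h) - f x) /\<^sub>R h) \<longlongrightarrow> D) (at 0)"
    by (simp only: tendsto_norm_zero_iff LIM_zero_iff)
  finally show ?thesis .
qed

text \<open>On a ball that contains the supports involved, the difference quotients are bounded by the supremum of the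
derivative; outside it they vanish. Dominated convergence applies.\<close>

lemma shift_tendsto_partial:
  fixes \<phi> :: "'a::euclidean_space \<Rightarrow> complex"
  assumes "test_function UNIV \<phi>"
  shows "((\<lambda>h. (shift (h *\<^sub>R z) (abs_l2 \<phi>) - abs_l2 \<phi>) /\<^sub>R h) \<longlongrightarrow> abs_l2 (partial z \<phi>)) (at 0)"
proof -
  obtain K where K: "smooth_on UNIV \<phi>" "compact K" "\<And>x. x \<notin> K \<Longrightarrow> \<phi> x = 0"
    by (rule test_functionE[OF assms]) (rule that)
  let ?d = "partial z \<phi>"
  have d: "test_function UNIV ?d" using assms by (rule test_partial_general)
  obtain M where M: "\<And>x. cmod (?d x) \<le> M" using test_bounded[OF d] by blast
  have M0: "0 \<le> M" using M[of 0] norm_ge_zero order_trans by blast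
  obtain R where R: "\<And>x. x \<in> K \<Longrightarrow> norm x \<le> R" "0 < R"
    using compact_imp_bounded[OF K(2)] by (meson bounded_pos)
  let ?B = "cball (0::'a) (R + norm z)"
  have line: "((\<lambda>t. \<phi> (x + t *\<^sub>R z)) has_derivative (\<lambda>h. h *\<^sub>R ?d (x + s *\<^sub>R z))) (at s)" for x s
  proof -
    have "((\<lambda>t. \<phi> (x + t *\<^sub>R z)) has_derivative (\<lambda>h. frechet_derivative \<phi> (at (x + s *\<^sub>R z)) (h *\<^sub>R z))) (at s)"
      by (rule has_derivative_compose[of "\<lambda>t. x + t *\<^sub>R z" "\<lambda>h. h *\<^sub>R z" s UNIV \<phi>])
        (auto intro!: derivative_eq_intros smooth_has_derivative[OF K(1)])
    then show ?thesis
      using linear_cmul[OF has_derivative_linear[OF smooth_has_derivative[OF K(1)]]] by simp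
  qed
  have lip: "cmod (\<phi> (x + h *\<^sub>R z) - \<phi> x) \<le> M * \<bar>h\<bar>" for x h
  proof -
    have "onorm (\<lambda>h. h *\<^sub>R ?d (x + s *\<^sub>R z)) \<le> M" for s
      by (intro onorm_le) (simp add: mult.commute[of M] mult_left_mono[OF M])
    then have "cmod (\<phi> (x + h *\<^sub>R z) - \<phi> (x + 0 *\<^sub>R z)) \<le> M * norm (h - 0)"
      using has_derivative_at_withinI[OF line]
      by (intro differentiable_bound[of UNIV "\<lambda>t. \<phi> (x + t *\<^sub>R z)" "\<lambda>s h. h *\<^sub>R ?d (x + s *\<^sub>R z)"]) auto
    then show ?thesis by simp
  qed
  have sq: "square_integrable \<phi>" "square_integrable ?d"
    using assms d by (auto intro: square_integrable_test)
  define q where "q h x = (\<phi> (x + h *\<^sub>R z) - \<phi> x) /\<^sub>R h - ?d x" for h :: real and x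
  have sq_q: "square_integrable (q h)" for h
    unfolding q_def
    by (intro square_integrable_diff square_integrable_scaleR square_integrable_shift sq)
  have eq: "(shift (h *\<^sub>R z) (abs_l2 \<phi>) - abs_l2 \<phi>) /\<^sub>R h - abs_l2 ?d = abs_l2 (q h)" for h
    unfolding q_def
    by (simp add: abs_l2_diff abs_l2_scaleR square_integrable_diff square_integrable_scaleR
        square_integrable_shift sq shift_abs del: scaleR_conv_of_real)
  show ?thesis
    unfolding tendsto_at_iff_sequentially
  proof (intro allI impI)
    fix X :: "nat \<Rightarrow> real" assume X: "\<forall>i. X i \<in> UNIV - {0}" "X \<longlonglongrightarrow> 0"
    then have Xne: "X i \<noteq> 0" for i by auto
    obtain N where N: "\<And>i. i \<ge> N \<Longrightarrow> \<bar>X i\<bar> \<le> 1"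
      using LIMSEQ_D[OF X(2), of 1] by (auto intro: less_imp_le)
    have "(\<lambda>i. abs_l2 (q (X (i + N)))) \<longlonglongrightarrow> abs_l2 (\<lambda>x. 0)"
    proof (rule abs_l2_tendsto[where w = "\<lambda>x. (2 * M)\<^sup>2 * indicat_real ?B x"])
      show "square_integrable (q (X (i + N)))" for i by (rule sq_q)
      show "integrable lborel (\<lambda>x. (2 * M)\<^sup>2 * indicat_real ?B x)"
        using emeasure_compact_finite[of ?B] by auto
      show "(\<lambda>i. q (X (i + N)) x) \<longlonglongrightarrow> 0" for x
      proof -
        have "((\<lambda>t. \<phi> (x + t *\<^sub>R z)) has_vector_derivative ?d x) (at 0)"
          using line[of x 0] by (simp add: has_vector_derivative_def)
        then have "((\<lambda>h. q h x) \<longlongrightarrow> 0) (at 0)"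
          unfolding q_def has_vector_derivative_iff_quotient by (intro LIM_zero) simp
        moreover have "filterlim (\<lambda>i. X (i + N)) (at 0) sequentially"
          using LIMSEQ_ignore_initial_segment[OF X(2)] Xne by (simp add: filterlim_at)
        ultimately show ?thesis
          by (rule filterlim_compose)
      qed
      show "(cmod (q (X (i + N)) x - 0))\<^sup>2 \<le> (2 * M)\<^sup>2 * indicat_real ?B x" for i x
      proof -
        let ?h = "X (i + N)"
        have "cmod (q ?h x) \<le> cmod ((\<phi> (x + ?h *\<^sub>R z) - \<phi> x) /\<^sub>R ?h) + cmod (?d x)"
          unfolding q_def by (rule norm_triangle_ineq4)
        also have "cmod ((\<phi> (x + ?h *\<^sub>R z) - \<phi> x) /\<^sub>R ?h) = cmod (\<phi> (x + ?h *\<^sub>R z) - \<phi> x) / \<bar>?h\<bar>"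
          by (simp only: norm_scaleR) (simp add: divide_inverse_commute)
        also have "\<dots> \<le> M" using lip[of x ?h] Xne by (simp add: divide_le_eq)
        finally have "cmod (q ?h x) \<le> 2 * M" using M[of x] by simp
        moreover have "q ?h x = 0" if "x \<notin> ?B"
        proof -
          have x: "R + norm z < norm x" using that by auto
          have "norm x \<le> norm (x + ?h *\<^sub>R z) + norm (?h *\<^sub>R z)"
            using norm_triangle_ineq4[of "x + ?h *\<^sub>R z" "?h *\<^sub>R z"] by simp
          also have "norm (?h *\<^sub>R z) \<le> norm z"
            using N[of "i + N"] by (simp add: mult_left_le_one_le)
          finally have "R < norm (x + ?h *\<^sub>R z)" "R < norm x" 
            using x norm_ge_zero[of z] by linarith+
          then have "x \<notin> K" "x + ?h *\<^sub>R z \<notin> K" using R(1) by force+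
          moreover from \<open>x \<notin> K\<close> have "?d x = 0" using partial_zero_outside[of K \<phi> x z] K(2,3) by simp
          ultimately show ?thesis by (simp add: q_def K(3))
        qed
        ultimately show ?thesis
          using power_mono[of "cmod (q ?h x)" "2 * M" 2] by (cases "x \<in> ?B") auto
      qed
    qed (rule square_integrable_zero)
    then have "(\<lambda>i. abs_l2 (q (X i))) \<longlonglongrightarrow> 0"
      unfolding abs_l2_zero by (rule LIMSEQ_offset)
    then show "((\<lambda>h. (shift (h *\<^sub>R z) (abs_l2 \<phi>) - abs_l2 \<phi>) /\<^sub>R h) \<circ> X) \<longlonglongrightarrow> abs_l2 ?d"
      unfolding eq[symmetric] comp_def by (rule LIM_zero_cancel)
  qed
qed

lemma shift_test_has_vector_derivative:
  assumes "test_function UNIV \<phi>"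
  shows "((\<lambda>s. shift (s *\<^sub>R z) (abs_l2 \<phi>)) has_vector_derivative shift (s *\<^sub>R z) (abs_l2 (partial z \<phi>))) (at s)"
proof -
  have "((\<lambda>h. shift (s *\<^sub>R z) ((shift (h *\<^sub>R z) (abs_l2 \<phi>) - abs_l2 \<phi>) /\<^sub>R h))
      \<longlongrightarrow> shift (s *\<^sub>R z) (abs_l2 (partial z \<phi>))) (at 0)"
    by (rule tendsto_shift[OF shift_tendsto_partial[OF assms]])
  then show ?thesis
    unfolding has_vector_derivative_iff_quotient
    by (simp add: shift_diff shift_scaleR shift_shift scaleR_add_left)
qed

text \<open>Translations preserve the inner product; differentiating this invariance at zero gives integration by parts.\<close>

lemma inner_partial_test:
  assumes "test_function UNIV \<phi>" "test_function UNIV \<psi>"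
  shows "inner (abs_l2 (partial z \<phi>)) (abs_l2 \<psi>) = - inner (abs_l2 \<phi>) (abs_l2 (partial z \<psi>))"
proof -
  let ?f = "\<lambda>s. inner (shift (s *\<^sub>R z) (abs_l2 \<phi>)) (shift (s *\<^sub>R z) (abs_l2 \<psi>))"
  have "(?f has_real_derivative
      inner (abs_l2 \<phi>) (abs_l2 (partial z \<psi>)) + inner (abs_l2 (partial z \<phi>)) (abs_l2 \<psi>)) (at 0)"
    using bounded_bilinear.has_vector_derivative[OF bounded_bilinear_inner
        shift_test_has_vector_derivative[OF assms(1), of z 0] shift_test_has_vector_derivative[OF assms(2), of z 0]]
    by (simp add: has_real_derivative_iff_has_vector_derivative shift_0)
  moreover have "(?f has_real_derivative 0) (at 0)"
    by (simp add: inner_shift)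
  ultimately have "inner (abs_l2 \<phi>) (abs_l2 (partial z \<psi>)) + inner (abs_l2 (partial z \<phi>)) (abs_l2 \<psi>) = 0"
    by (rule DERIV_unique)
  then show ?thesis by simp
qed

lemma integral_rep_test:
  assumes "test_function \<Omega> \<phi>"
  shows "(\<integral>x. rep_l2 f x * \<phi> x \<partial>lborel) = cinner f (abs_l2 (\<lambda>x. cnj (\<phi> x)))"
  using cinner_abs[OF square_integrable_rep[of f]
      square_integrable_test[OF test_bounded_linear[OF bounded_linear_cnj assms]]]
  by (simp add: abs_rep_l2)

text \<open>Conjugating the test function turns the bilinear pairing that defines weak derivatives into the inner
product, and multiplying it by \<open>\<i>\<close> recovers the imaginary part from real inner products.\<close>

lemma weak_partialD:
  assumes "weak_partial \<Omega> b f g" "test_function \<Omega> \<phi>"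
  shows "inner f (abs_l2 (partial b \<phi>)) = - inner g (abs_l2 \<phi>)"
proof -
  note c = test_bounded_linear[OF bounded_linear_cnj assms(2)]
  have p: "partial b (\<lambda>x. cnj (\<phi> x)) = (\<lambda>x. cnj (partial b \<phi> x))"
    using partial_cnj[OF test_smooth[OF assms(2)]] by blast
  have "(\<integral>x. rep_l2 f x * partial b (\<lambda>x. cnj (\<phi> x)) x \<partial>lborel) = - (\<integral>x. rep_l2 g x * cnj (\<phi> x) \<partial>lborel)"
    using assms(1) c unfolding weak_partial_def by blast
  then have "cinner f (abs_l2 (partial b \<phi>)) = - cinner g (abs_l2 \<phi>)"
    using integral_rep_test[OF test_partial_general[OF c], of f b] integral_rep_test[OF c, of g]
    by (simp add: fun_cong[OF p])
  then show ?thesis by (simp add: inner_l2_def)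
qed

lemma weak_partialI:
  assumes "f \<in> L2 \<Omega>" "g \<in> L2 \<Omega>"
    and *: "\<And>\<phi>. test_function \<Omega> \<phi> \<Longrightarrow> inner f (abs_l2 (partial b \<phi>)) = - inner g (abs_l2 \<phi>)"
  shows "weak_partial \<Omega> b f g"
  unfolding weak_partial_def
proof (intro conjI allI impI assms(1,2))
  fix \<phi> assume t: "test_function \<Omega> \<phi>"
  note c = test_bounded_linear[OF bounded_linear_cnj t]
  let ?c = "\<lambda>x. cnj (\<phi> x)"
  note ic = test_cmult[OF c, of \<i>]
  have p: "partial b (\<lambda>x. \<i> * ?c x) = (\<lambda>x. \<i> * partial b ?c x)"
    using partial_cmult[OF test_smooth[OF c]] by blast
  have pc: "partial b ?c = (\<lambda>x. cnj (partial b \<phi> x))"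
    using partial_cnj[OF test_smooth[OF t]] by blast
  have "Re (cinner f (abs_l2 (partial b ?c))) = - Re (cinner g (abs_l2 ?c))"
    using *[OF c] by (simp add: inner_l2_def)
  moreover have "Im (cinner f (abs_l2 (partial b ?c))) = - Im (cinner g (abs_l2 ?c))"
    using *[OF ic] unfolding p
    by (simp only: abs_l2_scaleC square_integrable_test[OF c]
        square_integrable_test[OF test_partial_general[OF c]] Im_cinner)
  ultimately have "cinner f (abs_l2 (partial b ?c)) = - cinner g (abs_l2 ?c)"
    by (simp add: complex_eq_iff)
  then show "(\<integral>x. rep_l2 f x * partial b \<phi> x \<partial>lborel) = - (\<integral>x. rep_l2 g x * \<phi> x \<partial>lborel)"
    by (simp add: integral_rep_test[OF t] integral_rep_test[OF test_partial_general[OF t]] pc)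
qed

lemma weak_partial_test:
  assumes "test_function \<Omega> \<phi>"
  shows "weak_partial \<Omega> b (abs_l2 \<phi>) (abs_l2 (partial b \<phi>))"
proof (rule weak_partialI)
  show "abs_l2 \<phi> \<in> L2 \<Omega>" "abs_l2 (partial b \<phi>) \<in> L2 \<Omega>"
    using assms test_partial_general by (blast intro: test_mem_L2)+
  fix \<psi> assume "test_function \<Omega> \<psi>"
  then show "inner (abs_l2 \<phi>) (abs_l2 (partial b \<psi>)) = - inner (abs_l2 (partial b \<phi>)) (abs_l2 \<psi>)"
    using inner_partial_test[of \<phi> \<psi> b] assms by (simp add: test_function_mono)
qed

definition lap :: "('a::euclidean_space \<Rightarrow> complex) \<Rightarrow> 'a \<Rightarrow> complex" where
  "lap \<phi> x = (\<Sum>b\<in>Basis. partial b (partial b \<phi>) x)"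

lemma test_lap: "test_function \<Omega> \<phi> \<Longrightarrow> test_function \<Omega> (lap \<phi>)"
  unfolding lap_def[abs_def] by (intro test_sum test_partial)

lemma abs_l2_lap:
  "test_function \<Omega> \<phi> \<Longrightarrow> abs_l2 (lap \<phi>) = (\<Sum>b\<in>Basis. abs_l2 (partial b (partial b \<phi>)))"
  unfolding lap_def[abs_def] by (intro abs_l2_sum square_integrable_test[of \<Omega>] test_partial)

lemma test_mem_H1:
  assumes "test_function \<Omega> \<phi>" shows "abs_l2 \<phi> \<in> H1 \<Omega>"
  using weak_partial_test[OF assms] test_mem_L2[OF assms] by (auto simp: H1_def)

lemma test_H1_tendsto:
  assumes "test_function \<Omega> \<phi>" shows "H1_tendsto \<Omega> (\<lambda>k. \<phi>) (abs_l2 \<phi>)"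
  unfolding H1_tendsto_def
proof (intro conjI ballI)
  show "(\<lambda>k. restrict_l2 \<Omega> \<phi>) \<longlonglongrightarrow> abs_l2 \<phi>"
    by (simp add: restrict_l2_test[OF assms])
  fix b :: 'a
  show "\<exists>g. weak_partial \<Omega> b (abs_l2 \<phi>) g \<and> (\<lambda>k. restrict_l2 \<Omega> (partial b \<phi>)) \<longlonglongrightarrow> g"
    using weak_partial_test[OF assms, of b] restrict_l2_test[OF test_partial_general[OF assms, of b]]
    by (intro exI[of _ "abs_l2 (partial b \<phi>)"]) simp
qed

lemma test_has_trace:
  assumes "test_function \<Omega> \<phi>" "open \<Omega>" shows "has_trace \<Omega> (abs_l2 \<phi>) (\<lambda>_. 0)"
proof -
  have "ennreal ((cmod (\<phi> x))\<^sup>2) * indicator (frontier \<Omega>) x = 0" for x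
    using test_function_zero_outside[OF assms(1), of x] assms(2)
    by (auto simp: frontier_def interior_open indicator_def)
  then have "(\<lambda>x. ennreal ((cmod (\<phi> x - 0))\<^sup>2) * indicator (frontier \<Omega>) x) = (\<lambda>x. 0)"
    by (intro ext) (simp only: diff_zero)
  then have "(\<integral>\<^sup>+x\<in>frontier \<Omega>. ennreal ((cmod (\<phi> x - 0))\<^sup>2) \<partial>surface_measure) = 0"
    by (simp only: nn_integral_const mult_zero_left)
  then show ?thesis
    unfolding has_trace_def
    using test_mem_H1[OF assms(1)] test_H1_tendsto[OF assms(1)] test_smooth[OF assms(1)]
    by (intro conjI exI[of _ "\<lambda>k. \<phi>"]) auto
qed

lemma test_mem_H2:
  assumes "test_function \<Omega> \<phi>" shows "abs_l2 \<phi> \<in> H2 \<Omega>"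
  using weak_partial_test[OF assms] test_mem_L2[OF assms] test_mem_H1[OF test_partial_general[OF assms]]
  by (auto simp: H2_def)

text \<open>A test function vanishes near the boundary and so satisfies either boundary condition, its boundary values
and those of its derivatives being zero.\<close>

lemma test_in_neg_laplacian:
  assumes "test_function \<Omega> \<phi>" "open \<Omega>"
  shows "(abs_l2 \<phi>, - abs_l2 (lap \<phi>)) \<in> neg_laplacian bc \<Omega>"
proof -
  have "abs_l2 \<phi> \<in> laplacian_domain bc \<Omega>"
  proof (cases bc)
    case Dirichlet
    have "abs_l2 \<phi> \<in> H10 \<Omega>"
      unfolding H10_def using test_mem_H1[OF assms(1)] test_H1_tendsto[OF assms(1)] assms(1)
      by (auto intro!: exI[of _ "\<lambda>k. \<phi>"])
    then show ?thesis using Dirichlet test_mem_H2[OF assms(1)] by simp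
  next
    case Neumann
    have "normal_derivative_zero \<Omega> (abs_l2 \<phi>)"
      unfolding normal_derivative_zero_def
      using weak_partial_test[OF assms(1)] test_has_trace[OF test_partial_general[OF assms(1)] assms(2)]
      by (intro exI[of _ "\<lambda>b. abs_l2 (partial b \<phi>)"] exI[of _ "\<lambda>b _. 0"]) simp
    then show ?thesis using Neumann test_mem_H2[OF assms(1)] by simp
  qed
  moreover have "\<forall>b\<in>Basis. weak_partial \<Omega> b (abs_l2 \<phi>) (abs_l2 (partial b \<phi>)) \<and>
      weak_partial \<Omega> b (abs_l2 (partial b \<phi>)) (abs_l2 (partial b (partial b \<phi>)))"
    using weak_partial_test[OF assms(1)] weak_partial_test[OF test_partial_general[OF assms(1)]] by simp
  ultimately show ?thesis
    unfolding neg_laplacian_def abs_l2_lap[OF assms(1)]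
    by (intro CollectI exI[of _ "abs_l2 \<phi>"] exI[of _ "\<lambda>b. abs_l2 (partial b \<phi>)"]
        exI[of _ "\<lambda>b. abs_l2 (partial b (partial b \<phi>))"]) simp
qed

lemma norm_gradient_test:
  assumes "test_function \<Omega> \<phi>"
  shows "inner (- abs_l2 (lap \<phi>)) (abs_l2 \<phi>) = (\<Sum>b\<in>Basis. (norm (abs_l2 (partial b \<phi>)))\<^sup>2)"
proof -
  have t: "test_function UNIV \<phi>" using assms by (rule test_function_mono) simp
  have "inner (abs_l2 (partial b (partial b \<phi>))) (abs_l2 \<phi>) = - (norm (abs_l2 (partial b \<phi>)))\<^sup>2" for b
    using inner_partial_test[OF test_partial_general[OF t] t] by (simp add: power2_norm_eq_inner)
  then show ?thesis
    by (simp add: abs_l2_lap[OF assms] inner_sum_left sum_negf)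
qed

section \<open>Density of test functions\<close>

definition cutoff :: "'a::euclidean_space set \<Rightarrow> ('a \<Rightarrow> real) \<Rightarrow> bool" where
  "cutoff \<Omega> \<eta> \<longleftrightarrow> smooth_on UNIV \<eta> \<and> (\<forall>x. 0 \<le> \<eta> x \<and> \<eta> x \<le> 1) \<and>
     (\<exists>K. compact K \<and> K \<subseteq> \<Omega> \<and> (\<forall>x. x \<notin> K \<longrightarrow> \<eta> x = 0))"

lemma cutoffE:
  assumes "cutoff \<Omega> \<eta>"
  obtains K where "compact K" "K \<subseteq> \<Omega>" "\<And>x. x \<notin> K \<Longrightarrow> \<eta> x = 0"
  using assms by (auto simp: cutoff_def)

lemma cutoffD:
  assumes "cutoff \<Omega> \<eta>"
  shows "smooth_on UNIV \<eta>" "0 \<le> \<eta> x" "\<eta> x \<le> 1" "x \<notin> \<Omega> \<Longrightarrow> \<eta> x = 0"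
  using assms by (auto simp: cutoff_def)

text \<open>For bumps on balls that cover \<open>K\<close>, the product of the functions one minus bump is below one on \<open>K\<close> and equal
to one outside the balls. By compactness its powers tend to zero uniformly on \<open>K\<close>.\<close>

lemma smooth_cutoff:
  fixes K U :: "'a::euclidean_space set"
  assumes "compact K" "open U" "K \<subseteq> U" "0 < d"
  obtains \<eta> where "cutoff U \<eta>" "\<And>x. x \<in> K \<Longrightarrow> 1 - d \<le> \<eta> x"
proof -
  have "\<forall>x\<in>K. \<exists>r>0. cball x r \<subseteq> U"
    using assms(2,3) by (meson open_contains_cball subsetD)
  then obtain r where r: "\<And>x. x \<in> K \<Longrightarrow> r x > 0" "\<And>x. x \<in> K \<Longrightarrow> cball x (r x) \<subseteq> U"
    by metis
  have "K \<subseteq> (\<Union>c\<in>K. ball c (r c))" using r(1) by auto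
  then obtain C where C: "C \<subseteq> K" "finite C" "K \<subseteq> (\<Union>c\<in>C. ball c (r c))"
    using compactE_image[OF assms(1), of K "\<lambda>c. ball c (r c)"] by auto
  define P where "P x = (\<Prod>c\<in>C. 1 - bump c (r c) x)" for x
  have sm: "smooth_on UNIV P"
    unfolding P_def[abs_def] by (intro smooth_prod smooth_diff smooth_const smooth_bump)
  have P: "0 \<le> P x" "P x \<le> 1" for x
    unfolding P_def by (auto intro!: prod_nonneg prod_le_1 simp: bump_nonneg bump_le_1)
  have P_less: "P x < 1" if xK: "x \<in> K" for x
  proof -
    obtain c where c: "c \<in> C" "x \<in> ball c (r c)" using subsetD[OF C(3) xK] by auto
    then have "bump c (r c) x > 0" using C(1) r(1) bump_pos_iff by blast
    have "P x = (1 - bump c (r c) x) * (\<Prod>c\<in>C - {c}. 1 - bump c (r c) x)"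
      unfolding P_def using c(1) C(2) by (simp add: prod.remove)
    also have "\<dots> \<le> (1 - bump c (r c) x) * 1"
      by (intro mult_left_mono prod_le_1) (auto simp: bump_nonneg bump_le_1)
    finally show ?thesis using \<open>bump c (r c) x > 0\<close> by simp
  qed
  obtain m where m: "\<And>x. x \<in> K \<Longrightarrow> P x ^ m \<le> d"
  proof (cases "K = {}")
    case False
    have "continuous_on K P" using smooth_continuous_on[OF sm] continuous_on_subset by blast
    then obtain x0 where x0: "x0 \<in> K" "\<And>x. x \<in> K \<Longrightarrow> P x \<le> P x0"
      using continuous_attains_sup[OF assms(1) False] by blast
    obtain m where "P x0 ^ m < d"
      using real_arch_pow_inv[OF assms(4) P_less[OF x0(1)]] by blast
    then have "P x ^ m \<le> d" if "x \<in> K" for x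
      using power_mono[OF x0(2)[OF that] P(1), of m] by linarith
    then show ?thesis by (rule that)
  qed (use that in auto)
  let ?L = "\<Union>c\<in>C. cball c (r c)"
  show ?thesis
  proof (rule that[of "\<lambda>x. 1 - P x ^ m"])
    have "smooth_on UNIV (\<lambda>x. 1 - P x ^ m)"
      by (intro smooth_diff smooth_const smooth_power sm)
    moreover have "0 \<le> 1 - P x ^ m \<and> 1 - P x ^ m \<le> 1" for x
      using P[of x] by (simp add: power_le_one)
    moreover have "compact ?L" using C(2) by (intro compact_UN) auto
    moreover have "?L \<subseteq> U" using C(1) r(2) by blast
    moreover have "1 - P x ^ m = 0" if "x \<notin> ?L" for x
    proof -
      have "bump c (r c) x = 0" if "c \<in> C" for c
      proof -
        have "c \<in> K" "x \<notin> ball c (r c)" using C(1) that \<open>x \<notin> _\<close> by auto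
        then have "\<not> bump c (r c) x > 0" using r(1) bump_pos_iff by blast
        then show ?thesis using bump_nonneg[of c "r c" x] by linarith
      qed
      then show ?thesis by (simp add: P_def)
    qed
    ultimately show "cutoff U (\<lambda>x. 1 - P x ^ m)"
      unfolding cutoff_def by blast
    show "1 - d \<le> 1 - P x ^ m" if "x \<in> K" for x using m[OF that] by simp
  qed
qed

lemma smooth_exhaustion:
  fixes U :: "'a::euclidean_space set"
  assumes "open U"
  obtains \<eta> where "\<And>n::nat. cutoff U (\<eta> n)" "\<And>x. (\<lambda>n. \<eta> n x) \<longlonglongrightarrow> indicator U x"
proof -
  obtain C where C: "\<And>n::nat. compact (C n)" "\<And>n. C n \<subseteq> U"
    and absorb: "\<And>K. compact K \<Longrightarrow> K \<subseteq> U \<Longrightarrow> \<exists>N. \<forall>n\<ge>N. K \<subseteq> C n"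
    by (rule open_Union_compact_subsets[OF assms]) (rule that)
  have "\<exists>\<eta>. cutoff U \<eta> \<and> (\<forall>x\<in>C n. 1 - inverse (real (Suc n)) \<le> \<eta> x)" for n
    by (rule smooth_cutoff[OF C(1) assms C(2), of "inverse (real (Suc n))" n]) auto
  then obtain \<eta> where \<eta>: "\<And>n. cutoff U (\<eta> n)"
    and lower: "\<And>n x. x \<in> C n \<Longrightarrow> 1 - inverse (real (Suc n)) \<le> \<eta> n x"
    by metis
  have "(\<lambda>n. \<eta> n x) \<longlonglongrightarrow> indicator U x" for x
  proof (cases "x \<in> U")
    case True
    then obtain N where N: "\<And>n. N \<le> n \<Longrightarrow> x \<in> C n" using absorb[of "{x}"] by auto
    then have "\<forall>\<^sub>F n in sequentially. 1 - inverse (real (Suc n)) \<le> \<eta> n x"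
      using lower N by (intro eventually_sequentiallyI[of N]) auto
    moreover have "\<forall>\<^sub>F n in sequentially. \<eta> n x \<le> 1" using cutoffD(3)[OF \<eta>] by simp
    moreover have "(\<lambda>n. 1 - inverse (real (Suc n))) \<longlonglongrightarrow> 1"
      using tendsto_diff[OF tendsto_const[of 1] LIMSEQ_inverse_real_of_nat] by simp
    ultimately have "(\<lambda>n. \<eta> n x) \<longlonglongrightarrow> 1"
      using tendsto_const[of 1] by (rule tendsto_sandwich)
    then show ?thesis using True by simp
  next
    case False
    then show ?thesis using cutoffD(4)[OF \<eta>] by simp
  qed
  with \<eta> show ?thesis by (rule that)
qed

lemma test_cutoff:
  assumes "cutoff U \<eta>" "U \<subseteq> \<Omega>" shows "test_function \<Omega> (\<lambda>x. complex_of_real (\<eta> x))"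
proof (rule cutoffE[OF assms(1)])
  fix K assume "compact K" "K \<subseteq> U" "\<And>x. x \<notin> K \<Longrightarrow> \<eta> x = 0"
  then show ?thesis
    using assms(2) by (intro test_functionI[OF smooth_of_real[OF cutoffD(1)[OF assms(1)]], of K]) auto
qed

definition approx :: "'a::euclidean_space set \<Rightarrow> 'a l2 \<Rightarrow> bool" where
  "approx \<Omega> f \<longleftrightarrow> (\<forall>e>0. \<exists>\<phi>. test_function \<Omega> \<phi> \<and> norm (abs_l2 \<phi> - f) < e)"

lemma approx_iff_sequence:
  "approx \<Omega> f \<longleftrightarrow> (\<exists>\<Phi>. (\<forall>n. test_function \<Omega> (\<Phi> n)) \<and> (\<lambda>n::nat. abs_l2 (\<Phi> n)) \<longlonglongrightarrow> f)"
proof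
  assume "approx \<Omega> f"
  then have "\<forall>n. \<exists>\<phi>. test_function \<Omega> \<phi> \<and> norm (abs_l2 \<phi> - f) < inverse (real (Suc n))"
    by (simp add: approx_def)
  then obtain \<Phi> where \<Phi>: "\<And>n. test_function \<Omega> (\<Phi> n)" "\<And>n. norm (abs_l2 (\<Phi> n) - f) < inverse (real (Suc n))"
    by metis
  have "(\<lambda>n. abs_l2 (\<Phi> n) - f) \<longlonglongrightarrow> 0"
    by (rule Lim_null_comparison[OF _ LIMSEQ_inverse_real_of_nat]) (use \<Phi>(2) in \<open>auto intro!: always_eventually less_imp_le\<close>)
  then have "(\<lambda>n. abs_l2 (\<Phi> n)) \<longlonglongrightarrow> f" by (rule LIM_zero_cancel)
  with \<Phi>(1) show "\<exists>\<Phi>. (\<forall>n. test_function \<Omega> (\<Phi> n)) \<and> (\<lambda>n::nat. abs_l2 (\<Phi> n)) \<longlonglongrightarrow> f"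
    by blast
next
  assume "\<exists>\<Phi>. (\<forall>n. test_function \<Omega> (\<Phi> n)) \<and> (\<lambda>n::nat. abs_l2 (\<Phi> n)) \<longlonglongrightarrow> f"
  then show "approx \<Omega> f"
    unfolding approx_def using LIMSEQ_D[of _ f] by (meson order_refl)
qed

lemma approxI:
  "(\<And>n. test_function \<Omega> (\<Phi> n)) \<Longrightarrow> (\<lambda>n::nat. abs_l2 (\<Phi> n)) \<longlonglongrightarrow> f \<Longrightarrow> approx \<Omega> f"
  unfolding approx_iff_sequence by blast

lemma approx_limit:
  assumes "\<And>n::nat. approx \<Omega> (F n)" "F \<longlonglongrightarrow> f" shows "approx \<Omega> f"
  unfolding approx_def
proof (intro allI impI)
  fix e :: real assume "0 < e"
  then obtain n where n: "norm (F n - f) < e / 2" using LIMSEQ_D[OF assms(2), of "e / 2"] by auto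
  obtain \<phi> where \<phi>: "test_function \<Omega> \<phi>" "norm (abs_l2 \<phi> - F n) < e / 2"
    using assms(1)[of n] \<open>0 < e\<close> by (auto simp: approx_def dest: spec[of _ "e / 2"])
  have "norm (abs_l2 \<phi> - f) \<le> norm (abs_l2 \<phi> - F n) + norm (F n - f)"
    using norm_triangle_ineq[of "abs_l2 \<phi> - F n" "F n - f"] by simp
  with n \<phi> show "\<exists>\<phi>. test_function \<Omega> \<phi> \<and> norm (abs_l2 \<phi> - f) < e"
    by (intro exI[of _ \<phi>]) simp
qed

lemma approx_add:
  assumes "approx \<Omega> f" "approx \<Omega> g" shows "approx \<Omega> (f + g)"
proof -
  obtain \<Phi> \<Psi> where s: "\<And>n. test_function \<Omega> (\<Phi> n)" "(\<lambda>n::nat. abs_l2 (\<Phi> n)) \<longlonglongrightarrow> f"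
    "\<And>n. test_function \<Omega> (\<Psi> n)" "(\<lambda>n::nat. abs_l2 (\<Psi> n)) \<longlonglongrightarrow> g"
    using assms unfolding approx_iff_sequence by blast
  have "(\<lambda>n. abs_l2 (\<lambda>x. \<Phi> n x + \<Psi> n x)) \<longlonglongrightarrow> f + g"
    using tendsto_add[OF s(2,4)]
    by (simp only: abs_l2_add[OF square_integrable_test[OF s(1)] square_integrable_test[OF s(3)]])
  then show ?thesis by (rule approxI[OF test_add[OF s(1) s(3)]])
qed

lemma bounded_linear_scaleC: "bounded_linear (scaleC c)"
proof (rule bounded_linear_intro[of _ "cmod c"])
  show "scaleC c (r *\<^sub>R f) = r *\<^sub>R scaleC c f" for r f
    by (cases f rule: l2_cases)
      (simp add: scaleR_l2_def square_integrable_cmult mult.left_commute flip: abs_l2_scaleC)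
qed (simp_all add: scaleC_add_right norm_scaleC mult.commute)

lemma approx_scaleC:
  assumes "approx \<Omega> f" shows "approx \<Omega> (scaleC c f)"
proof -
  obtain \<Phi> where s: "\<And>n. test_function \<Omega> (\<Phi> n)" "(\<lambda>n::nat. abs_l2 (\<Phi> n)) \<longlonglongrightarrow> f"
    using assms unfolding approx_iff_sequence by blast
  have "(\<lambda>n. abs_l2 (\<lambda>x. c * \<Phi> n x)) \<longlonglongrightarrow> scaleC c f"
    using bounded_linear.tendsto[OF bounded_linear_scaleC s(2), of c]
    by (simp only: abs_l2_scaleC[OF square_integrable_test[OF s(1)]])
  then show ?thesis by (rule approxI[OF test_cmult[OF s(1)]])
qed

lemma approx_zero: "approx \<Omega> 0"
  unfolding approx_def by (intro allI impI exI[of _ "\<lambda>x. 0"]) (simp add: test_zero abs_l2_zero)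

lemma approx_sum: "(\<And>i. i \<in> I \<Longrightarrow> approx \<Omega> (f i)) \<Longrightarrow> approx \<Omega> (\<Sum>i\<in>I. f i)"
  by (induction I rule: infinite_finite_induct) (auto intro: approx_zero approx_add)

lemma approx_ind_open:
  assumes "open U" "U \<subseteq> \<Omega>" "emeasure lborel U < \<infinity>"
  shows "approx \<Omega> (abs_l2 (ind U))"
proof -
  obtain \<eta> where \<eta>: "\<And>n::nat. cutoff U (\<eta> n)" and lim: "\<And>x. (\<lambda>n. \<eta> n x) \<longlonglongrightarrow> indicator U x"
    by (rule smooth_exhaustion[OF assms(1)]) (rule that)
  have t: "test_function \<Omega> (\<lambda>x. complex_of_real (\<eta> n x))" for n
    by (rule test_cutoff[OF \<eta> assms(2)])
  have "(\<lambda>n. abs_l2 (\<lambda>x. complex_of_real (\<eta> n x))) \<longlonglongrightarrow> abs_l2 (ind U)"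
  proof (rule abs_l2_tendsto)
    show "square_integrable (\<lambda>x. complex_of_real (\<eta> n x))" for n
      using t by (rule square_integrable_test)
    show "square_integrable (ind U)" using assms by (intro square_integrable_ind) auto
    show "integrable lborel (indicat_real U)" using assms by simp
    show "(\<lambda>n. complex_of_real (\<eta> n x)) \<longlonglongrightarrow> complex_of_real (indicator U x)" for x
      by (intro tendsto_of_real lim)
    show "(cmod (complex_of_real (\<eta> n x) - complex_of_real (indicator U x)))\<^sup>2 \<le> indicator U x" for n x
    proof (cases "x \<in> U")
      case True
      have "cmod (complex_of_real (\<eta> n x - 1)) \<le> 1"
        using cutoffD(2,3)[OF \<eta>, of n x] by (simp only: norm_of_real)
      then have "(cmod (complex_of_real (\<eta> n x - 1)))\<^sup>2 \<le> 1"
        by (simp only: power_le_one norm_ge_zero)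
      then show ?thesis using True by simp
    next
      case False
      then show ?thesis using cutoffD(4)[OF \<eta>] by simp
    qed
  qed
  then show ?thesis by (rule approxI[OF t])
qed

lemma approx_ind:
  assumes "open \<Omega>" "A \<in> sets borel" "A \<subseteq> \<Omega>" "emeasure lborel A < \<infinity>"
  shows "approx \<Omega> (abs_l2 (ind A))"
  unfolding approx_def
proof (intro allI impI)
  fix e :: real assume e: "0 < e"
  obtain V where V: "open V" "A \<subseteq> V" "emeasure lborel (V - A) < ennreal ((e / 2)\<^sup>2)"
    using outer_regular_lborel[OF assms(2), of "(e / 2)\<^sup>2"] e by auto
  define U where "U = V \<inter> \<Omega>"
  have U: "open U" "A \<subseteq> U" "U \<subseteq> \<Omega>" "emeasure lborel (U - A) < ennreal ((e / 2)\<^sup>2)"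
    using V assms by (auto simp: U_def intro!: le_less_trans[OF emeasure_mono V(3)])
  have "emeasure lborel U \<le> emeasure lborel A + emeasure lborel (U - A)"
    using U assms emeasure_subadditive[of A lborel "U - A"] by (simp add: Un_absorb1)
  also have "\<dots> < \<infinity>"
    using assms(4) U(4) by (auto simp: less_top[symmetric] ennreal_add_eq_top)
  finally have fin: "emeasure lborel U < \<infinity>" .
  obtain \<phi> where \<phi>: "test_function \<Omega> \<phi>" "norm (abs_l2 \<phi> - abs_l2 (ind U)) < e / 2"
    using approx_ind_open[OF U(1,3) fin] e unfolding approx_def by (meson half_gt_zero)
  have "(norm (abs_l2 (ind U) - abs_l2 (ind A)))\<^sup>2 = (\<integral>x. (cmod (ind U x - ind A x))\<^sup>2 \<partial>lborel)"
    using fin assms U(1)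
    by (simp add: norm_abs_sq square_integrable_diff square_integrable_ind flip: abs_l2_diff)
  also have "(\<lambda>x. (cmod (ind U x - ind A x))\<^sup>2) = indicat_real (U - A)"
    using U(2) by (intro ext) (auto simp: indicator_def)
  also have "integral\<^sup>L lborel (indicat_real (U - A)) < (e / 2)\<^sup>2"
  proof -
    have "integral\<^sup>L lborel (indicat_real (U - A)) = measure lborel (U - A)"
      using U(1) assms(2) by simp
    also have "\<dots> < (e / 2)\<^sup>2"
    proof -
      have "emeasure lborel (U - A) = ennreal (measure lborel (U - A))"
        using U(4) by (intro emeasure_eq_ennreal_measure) (auto simp: less_top[symmetric] dest: less_trans)
      then show ?thesis using U(4) by (simp add: ennreal_less_iff)
    qed
    finally show ?thesis .
  qed
  finally have "norm (abs_l2 (ind U) - abs_l2 (ind A)) < e / 2"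
    by (rule power_less_imp_less_base) (use e in simp)
  then have "norm (abs_l2 \<phi> - abs_l2 (ind A)) < e"
    using \<phi>(2) norm_triangle_ineq[of "abs_l2 \<phi> - abs_l2 (ind U)" "abs_l2 (ind U) - abs_l2 (ind A)"] by simp
  with \<phi>(1) show "\<exists>\<phi>. test_function \<Omega> \<phi> \<and> norm (abs_l2 \<phi> - abs_l2 (ind A)) < e" by blast
qed

text \<open>Indicators of open sets are limits of cutoffs, those of Borel sets follow by outer regularity, and simple
functions exhaust the rest.\<close>

lemma approx_L2:
  fixes \<Omega> :: "'a::euclidean_space set"
  assumes "open \<Omega>" "f \<in> L2 \<Omega>" shows "approx \<Omega> f"
proof -
  obtain F0 where F0: "square_integrable F0" "f = abs_l2 F0" by (rule l2_cases)
  define F where "F x = indicat_real \<Omega> x *\<^sub>R F0 x" for x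
  have F: "square_integrable F" "f = abs_l2 F" "\<And>x. x \<notin> \<Omega> \<Longrightarrow> F x = 0"
    using F0 assms mul_L2_eq_self[OF assms(2)]
    by (auto simp: F_def[abs_def] mul_abs bounded_borel_indicator square_integrable_mul)
  obtain s where s: "\<And>i. simple_function lborel (s i)" "\<And>x. (\<lambda>i. s i x) \<longlonglongrightarrow> F x"
    "\<And>i x. cmod (s i x) \<le> 2 * cmod (F x)"
    using borel_measurable_implies_sequence_metric[of F lborel 0] square_integrable_borel[OF F(1)]
    by (auto simp: dist_norm)
  have sb: "s i \<in> borel_measurable borel" for i
    using borel_measurable_simple_function[OF s(1)] by simp
  have sq: "square_integrable (s i)" for i
    using F(1) sb s(3) by (rule square_integrable_bound)
  have lim: "(\<lambda>i. abs_l2 (s i)) \<longlonglongrightarrow> f"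
    unfolding F(2)
  proof (rule abs_l2_tendsto[OF sq F(1) _ s(2)])
    show "integrable lborel (\<lambda>x. 9 * (cmod (F x))\<^sup>2)"
      using F(1) by (simp add: square_integrable_def)
    show "(cmod (s i x - F x))\<^sup>2 \<le> 9 * (cmod (F x))\<^sup>2" for i x
    proof -
      have "cmod (s i x - F x) \<le> 3 * cmod (F x)"
        using norm_triangle_ineq4[of "s i x" "F x"] s(3)[of i x] by linarith
      then show ?thesis using power_mono[of _ _ 2] by (fastforce simp: power_mult_distrib)
    qed
  qed
  have "approx \<Omega> (abs_l2 (s i))" for i
  proof -
    let ?A = "\<lambda>y. {x. s i x = y}"
    have fin: "finite (range (s i))" using s(1)[of i] by (simp add: simple_function_def)
    have A: "?A y \<in> sets borel" for y
      using measurable_sets[OF sb[of i], of "{y}"] by (simp add: vimage_def)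
    have fm: "emeasure lborel (?A y) < \<infinity>" if "y \<noteq> 0" for y
    proof -
      have "integrable lborel (\<lambda>x. (cmod y)\<^sup>2 * indicat_real (?A y) x)"
      proof (rule Bochner_Integration.integrable_bound)
        show "integrable lborel (\<lambda>x. (cmod (s i x))\<^sup>2)" using sq[of i] by (simp add: square_integrable_def)
        show "AE x in lborel. norm ((cmod y)\<^sup>2 * indicat_real (?A y) x) \<le> norm ((cmod (s i x))\<^sup>2)"
          by (auto simp: indicator_def)
      qed (use A in measurable)
      then show ?thesis
        using that A[of y] by (simp add: integrable_indicator_iff)
    qed
    have "s i = (\<lambda>x. \<Sum>y\<in>range (s i) - {0}. y * ind (?A y) x)"
    proof
      fix x
      have "(\<Sum>y\<in>range (s i) - {0}. y * ind (?A y) x) = (\<Sum>y\<in>range (s i) - {0}. if y = s i x then y else 0)"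
        by (intro sum.cong) (auto simp: indicator_def)
      also have "\<dots> = s i x" using fin by (simp add: sum.delta)
      finally show "s i x = (\<Sum>y\<in>range (s i) - {0}. y * ind (?A y) x)" by simp
    qed
    then have "abs_l2 (s i) = abs_l2 (\<lambda>x. \<Sum>y\<in>range (s i) - {0}. y * ind (?A y) x)"
      by (rule arg_cong)
    also have "\<dots> = (\<Sum>y\<in>range (s i) - {0}. abs_l2 (\<lambda>x. y * ind (?A y) x))"
      by (intro abs_l2_sum square_integrable_cmult square_integrable_ind A fm) auto
    also have "\<dots> = (\<Sum>y\<in>range (s i) - {0}. scaleC y (abs_l2 (ind (?A y))))"
      by (intro sum.cong refl abs_l2_scaleC square_integrable_ind A fm) auto
    also have "approx \<Omega> \<dots>"
    proof (intro approx_sum approx_scaleC approx_ind assms(1) A)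
      fix y assume y: "y \<in> range (s i) - {0}"
      then show "emeasure lborel (?A y) < \<infinity>" using fm by auto
      show "?A y \<subseteq> \<Omega>"
        using s(3)[of i] F(3) y by (metis (mono_tags, lifting) DiffE mem_Collect_eq mult_zero_right norm_le_zero_iff norm_zero singletonI subsetI)
    qed
    finally show ?thesis .
  qed
  then show ?thesis using lim by (rule approx_limit)
qed

lemma L2_test_sequence:
  assumes "open \<Omega>" "f \<in> L2 \<Omega>"
  obtains \<Phi> where "\<And>n. test_function \<Omega> (\<Phi> n)" "(\<lambda>n::nat. abs_l2 (\<Phi> n)) \<longlonglongrightarrow> f"
proof -
  have "\<exists>\<Phi>. (\<forall>n. test_function \<Omega> (\<Phi> n)) \<and> (\<lambda>n::nat. abs_l2 (\<Phi> n)) \<longlonglongrightarrow> f"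
    using approx_L2[OF assms] by (simp only: approx_iff_sequence)
  then obtain \<Phi> where "\<forall>n. test_function \<Omega> (\<Phi> n)" "(\<lambda>n::nat. abs_l2 (\<Phi> n)) \<longlonglongrightarrow> f"
    by (elim exE conjE) (rule that)
  then show ?thesis by (rule_tac that[of \<Phi>]) simp_all
qed

lemma norm_le_by_tests:
  assumes "open \<Omega>" "f \<in> L2 \<Omega>" and "\<And>\<phi>. test_function \<Omega> \<phi> \<Longrightarrow> inner f (abs_l2 \<phi>) \<le> B * norm (abs_l2 \<phi>)"
    and "0 \<le> B"
  shows "norm f \<le> B"
proof -
  obtain \<Phi> where \<Phi>: "\<And>n. test_function \<Omega> (\<Phi> n)" "(\<lambda>n::nat. abs_l2 (\<Phi> n)) \<longlonglongrightarrow> f"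
    by (rule L2_test_sequence[OF assms(1,2)]) (rule that)
  have "inner f f \<le> B * norm f"
    by (rule LIMSEQ_le[of "\<lambda>n. inner f (abs_l2 (\<Phi> n))" _ "\<lambda>n. B * norm (abs_l2 (\<Phi> n))"])
      (use assms(3) \<Phi>(1) in \<open>auto intro!: tendsto_intros \<Phi>(2)\<close>)
  then have "norm f * norm f \<le> B * norm f" by (simp add: norm_eq_sqrt_inner)
  then show ?thesis using assms(4) by (cases "norm f = 0") auto
qed

lemma weak_partial_unique:
  assumes "open \<Omega>" "weak_partial \<Omega> b f g" "weak_partial \<Omega> b f g'"
  shows "g = g'"
proof -
  have "g - g' \<in> L2 \<Omega>" using assms(2,3) by (auto simp: weak_partial_def intro: L2_diff)
  moreover have "inner (g - g') (abs_l2 \<phi>) \<le> 0 * norm (abs_l2 \<phi>)" if "test_function \<Omega> \<phi>" for \<phi>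
    using weak_partialD[OF assms(2) that] weak_partialD[OF assms(3) that] by (simp add: inner_diff_left)
  ultimately have "norm (g - g') \<le> 0" by (intro norm_le_by_tests[OF assms(1)]) auto
  then show ?thesis by simp
qed

text \<open>By duality it is enough to pair the difference with a test function. There the translation can be shifted
to the test function and differentiated along the segment from \<open>0\<close> to \<open>z\<close>, after which the weak derivative
moves back to \<open>f\<close>.\<close>

lemma shift_estimate:
  fixes f :: "'a::euclidean_space l2"
  assumes "\<And>b. b \<in> Basis \<Longrightarrow> weak_partial UNIV b f (g b)"
  shows "norm (shift z f - f) \<le> norm z * sqrt (\<Sum>b\<in>Basis. (norm (g b))\<^sup>2)"
proof (rule norm_le_by_tests[of UNIV])
  show "shift z f - f \<in> L2 UNIV" by (simp add: L2_def)
  show "0 \<le> norm z * sqrt (\<Sum>b\<in>Basis. (norm (g b))\<^sup>2)" by (simp add: sum_nonneg)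
  fix \<phi> :: "'a \<Rightarrow> complex" assume t: "test_function UNIV \<phi>"
  let ?B = "norm z * sqrt (\<Sum>b\<in>Basis. (norm (g b))\<^sup>2)"
  define G where "G = (\<Sum>b\<in>Basis. (z \<bullet> b) *\<^sub>R g b)"
  have normG: "norm G \<le> ?B"
  proof -
    have "norm G \<le> (\<Sum>b\<in>Basis. \<bar>z \<bullet> b\<bar> * \<bar>norm (g b)\<bar>)"
      unfolding G_def by (rule order_trans[OF norm_sum]) simp
    also have "\<dots> \<le> L2_set (\<lambda>b. z \<bullet> b) Basis * L2_set (\<lambda>b. norm (g b)) Basis"
      by (rule L2_set_mult_ineq)
    also have "L2_set (\<lambda>b. z \<bullet> b) Basis = norm z"
      using euclidean_dist_l2[of z 0] by (simp add: L2_set_def)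
    finally show ?thesis by (simp add: L2_set_def)
  qed
  have der: "inner f (abs_l2 (partial z \<psi>)) = - inner G (abs_l2 \<psi>)" if "test_function UNIV \<psi>" for \<psi>
    unfolding abs_partial_general[OF that, of z] G_def
    by (simp add: inner_sum_left inner_sum_right weak_partialD[OF assms that] sum_negf cong: sum.cong)
  define q where "q s = inner f (shift (s *\<^sub>R z) (abs_l2 \<phi>))" for s :: real
  have q': "(q has_derivative (\<lambda>h. h * - inner G (shift (s *\<^sub>R z) (abs_l2 \<phi>)))) (at s within S)" for s S
  proof -
    let ?\<psi> = "\<lambda>x. \<phi> (s *\<^sub>R z + 1 *\<^sub>R x)"
    have sm: "smooth_on UNIV ?\<psi>" by (rule smooth_affine[OF test_smooth[OF t]])
    have tt: "test_function UNIV ?\<psi>"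
    proof (rule test_functionE[OF t])
      fix K assume K: "compact K" "\<And>x. x \<notin> K \<Longrightarrow> \<phi> x = 0"
      show ?thesis
      proof (rule test_functionI[OF sm compact_translation[OF K(1), of "- (s *\<^sub>R z)"]])
        fix x assume x: "x \<notin> (+) (- (s *\<^sub>R z)) ` K"
        have "s *\<^sub>R z + 1 *\<^sub>R x \<notin> K"
        proof
          assume "s *\<^sub>R z + 1 *\<^sub>R x \<in> K"
          then have "- (s *\<^sub>R z) + (s *\<^sub>R z + 1 *\<^sub>R x) \<in> (+) (- (s *\<^sub>R z)) ` K" by blast
          then show False using x by simp
        qed
        then show "?\<psi> x = 0" by (rule K(2))
      qed simp
    qed
    have e1: "shift (s *\<^sub>R z) (abs_l2 \<phi>) = abs_l2 ?\<psi>"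
      by (simp add: shift_abs[OF square_integrable_test[OF t]] add.commute)
    have e2: "shift (s *\<^sub>R z) (abs_l2 (partial z \<phi>)) = abs_l2 (partial z ?\<psi>)"
      unfolding shift_abs[OF square_integrable_test[OF test_partial_general[OF t]]]
      by (rule arg_cong[of _ _ abs_l2], rule ext, subst partial_affine[OF test_smooth[OF t]])
        (simp add: add.commute)
    have "(q has_vector_derivative inner f (shift (s *\<^sub>R z) (abs_l2 (partial z \<phi>)))) (at s within S)"
      unfolding q_def
      by (rule has_vector_derivative_at_within,
          rule bounded_linear.has_vector_derivative[OF bounded_linear_inner_right shift_test_has_vector_derivative[OF t]])
    then show ?thesis
      unfolding e2 der[OF tt] e1 by (simp add: has_vector_derivative_def)
  qed
  have "\<exists>s\<in>{- 1..0}. q 0 - q (- 1) = (0 - (- 1)) * - inner G (shift (s *\<^sub>R z) (abs_l2 \<phi>))"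
    by (rule mvt_very_simple) (use q' in auto)
  then obtain s where "q 0 - q (- 1) = (0 - (- 1)) * - inner G (shift (s *\<^sub>R z) (abs_l2 \<phi>))"
    by (elim bexE)
  then have s: "q (- 1) - q 0 = inner G (shift (s *\<^sub>R z) (abs_l2 \<phi>))" by simp
  have "inner (shift z f - f) (abs_l2 \<phi>) = q (- 1) - q 0"
    using inner_shift[of "- z" "shift z f" "abs_l2 \<phi>"]
    by (simp add: q_def inner_diff_left shift_shift shift_0)
  also have "\<dots> \<le> norm G * norm (abs_l2 \<phi>)"
    unfolding s using norm_cauchy_schwarz[of G "shift (s *\<^sub>R z) (abs_l2 \<phi>)"] by (simp add: norm_shift)
  also have "\<dots> \<le> ?B * norm (abs_l2 \<phi>)" using normG by (intro mult_right_mono) auto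
  finally show "inner (shift z f - f) (abs_l2 \<phi>) \<le> ?B * norm (abs_l2 \<phi>)" .
qed auto

section \<open>Averages over balls\<close>

text \<open>Rotating \<open>f\<close> by the phase of the inner product reduces this to the real Cauchy-Schwarz inequality.\<close>

lemma norm_cinner_le: "cmod (cinner f g) \<le> norm f * norm g"
proof (cases "cinner f g = 0")
  case False
  let ?c = "cinner f g"
  let ?u = "cnj ?c / of_real (cmod ?c)"
  have "cinner (scaleC ?u f) g = of_real (cmod ?c)"
    using False by (simp add: cinner_scaleC_left complex_norm_square[symmetric] power2_eq_square mult.commute field_simps flip: of_real_mult)
  then have "cmod ?c = inner (scaleC ?u f) g" by (simp add: inner_l2_def)
  also have "\<dots> \<le> norm (scaleC ?u f) * norm g" by (rule norm_cauchy_schwarz)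
  also have "norm (scaleC ?u f) = norm f" using False by (simp add: norm_scaleC norm_divide)
  finally show ?thesis .
qed simp

text \<open>The mean of \<open>F\<close> over the ball of radius \<open>\<epsilon>\<close> around \<open>x\<close>.\<close>

definition avg :: "real \<Rightarrow> ('a::euclidean_space \<Rightarrow> complex) \<Rightarrow> 'a \<Rightarrow> complex" where
  "avg \<epsilon> F x = (\<integral>z. F (x + z) * ind (ball 0 \<epsilon>) z \<partial>lborel) / of_real (measure lborel (ball (0::'a) \<epsilon>))"

lemma ball_sets_borel [measurable]: "ball (c::'a::euclidean_space) \<epsilon> \<in> sets borel"
  by simp

lemma square_integrable_ball:
  fixes c :: "'a::euclidean_space"
  shows "square_integrable (ind (ball c \<epsilon>))"
  using emeasure_lborel_ball_finite[of c \<epsilon>] by (intro square_integrable_ind) auto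

lemma measure_lborel_ball_center:
  fixes x :: "'a::euclidean_space"
  shows "measure lborel (ball x \<epsilon>) = measure lborel (ball (0::'a) \<epsilon>)"
  using content_ball_conv_unit_ball[of \<epsilon> x] content_ball_conv_unit_ball[of \<epsilon> "0::'a"]
  by (cases "0 \<le> \<epsilon>") (auto simp: ball_empty)

lemma norm_ball_sq:
  "(norm (abs_l2 (ind (ball (c::'a::euclidean_space) \<epsilon>))))\<^sup>2 = measure lborel (ball (0::'a) \<epsilon>)"
proof -
  have "(\<lambda>x. (cmod (complex_of_real (indicat_real (ball c \<epsilon>) x)))\<^sup>2) = indicat_real (ball c \<epsilon>)"
    by (auto simp: indicator_def)
  then show ?thesis
    using measure_lborel_ball_center[of c \<epsilon>] by (simp add: norm_abs_sq square_integrable_ball)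
qed

lemma borel_measurable_avg:
  fixes F :: "'a::euclidean_space \<Rightarrow> complex"
  assumes [measurable]: "F \<in> borel_measurable borel" shows "avg \<epsilon> F \<in> borel_measurable borel"
proof -
  define \<beta> where "\<beta> = complex_of_real (measure lborel (ball (0::'a) \<epsilon>))"
  have "(\<lambda>x. (\<integral>z. F (x + z) * ind (ball 0 \<epsilon>) z \<partial>lborel) / \<beta>) \<in> borel_measurable borel"
    by measurable
  then show ?thesis unfolding avg_def[abs_def] \<beta>_def .
qed

lemma avg_eq_cinner:
  fixes F :: "'a::euclidean_space \<Rightarrow> complex"
  assumes "square_integrable F"
  shows "avg \<epsilon> F x = cinner (abs_l2 F) (abs_l2 (ind (ball x \<epsilon>)))
    / of_real (measure lborel (ball (0::'a) \<epsilon>))"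
proof -
  have [measurable]: "F \<in> borel_measurable borel" using assms by (rule square_integrable_borel)
  have "(\<integral>y. F y * ind (ball x \<epsilon>) y \<partial>lborel)
      = (\<integral>z. F (z + x) * ind (ball x \<epsilon>) (z + x) \<partial>lborel)"
    by (rule integral_lborel_shift[symmetric]) measurable
  also have "\<dots> = (\<integral>z. F (x + z) * ind (ball 0 \<epsilon>) z \<partial>lborel)"
    by (intro Bochner_Integration.integral_cong) (auto simp: indicator_def dist_norm add.commute)
  finally show ?thesis
    by (simp add: avg_def cinner_abs[OF assms square_integrable_ball])
qed

text \<open>At each point the squared error is at most the mean of \<open>|F x - F (x + z)|\<^sup>2\<close> over the ball, by
Cauchy-Schwarz; by Fubini the integral of this mean is a mean of squared norms of \<open>F\<close> minus its translates.\<close>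

lemma avg_error:
  fixes F :: "'a::euclidean_space \<Rightarrow> complex"
  assumes F: "square_integrable F" and "0 < \<epsilon>"
    and D: "\<And>z. norm z < \<epsilon> \<Longrightarrow> norm (shift z (abs_l2 F) - abs_l2 F) \<le> D"
  shows "square_integrable (\<lambda>x. F x - avg \<epsilon> F x)"
    and "(\<integral>x. (cmod (F x - avg \<epsilon> F x))\<^sup>2 \<partial>lborel) \<le> D\<^sup>2"
proof -
  note Fb[measurable] = square_integrable_borel[OF F]
  note [measurable] = borel_measurable_avg[OF Fb, of \<epsilon>]
  let ?B = "ball (0::'a) \<epsilon>"
  let ?b = "ind ?B"
  define \<beta> where "\<beta> = measure lborel ?B"
  have \<beta>: "0 < \<beta>" "emeasure lborel ?B = ennreal \<beta>"
    using \<open>0 < \<epsilon>\<close> emeasure_eq_ennreal_measure[of lborel ?B] emeasure_lborel_ball_finite[of "0::'a" \<epsilon>]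
    by (auto simp: \<beta>_def content_ball_gt_0_iff)
  have D0: "0 \<le> D" using D[of 0] \<open>0 < \<epsilon>\<close> by (simp add: shift_0)
  have sq_b: "square_integrable ?b" by (rule square_integrable_ball)
  have pointwise: "ennreal ((cmod (F x - avg \<epsilon> F x))\<^sup>2)
      \<le> ennreal (1 / \<beta>) * (\<integral>\<^sup>+z. ennreal ((cmod (F x - F (x + z)))\<^sup>2) * indicator ?B z \<partial>lborel)" for x
  proof -
    define H where "H z = (F x - F (x + z)) * ?b z" for z
    have "square_integrable (\<lambda>z. F (z + x))" using F by (rule square_integrable_shift)
    then have sFx: "square_integrable (\<lambda>z. F (x + z))" by (simp add: add.commute)
    have "square_integrable (\<lambda>z. indicat_real ?B z *\<^sub>R F (x + z))"
      by (rule square_integrable_mul[OF bounded_borel_indicator sFx]) simp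
    then have "square_integrable (\<lambda>z. F x * ?b z - indicat_real ?B z *\<^sub>R F (x + z))"
      by (intro square_integrable_diff square_integrable_cmult sq_b)
    moreover have "(\<lambda>z. F x * ?b z - indicat_real ?B z *\<^sub>R F (x + z)) = H"
      by (auto simp: H_def scaleR_conv_of_real algebra_simps)
    ultimately have H: "square_integrable H" by simp
    have int1: "integrable lborel (\<lambda>z. F (x + z) * ?b z)"
      using integrable_mult_cnj[OF sFx sq_b] by simp
    have intb: "integrable lborel ?b"
      using integrable_mult_cnj[OF sq_b sq_b] by (simp add: indicator_def of_bool_def if_distrib cong: if_cong)
    have "(\<integral>z. H z * cnj (?b z) \<partial>lborel) = (\<integral>z. F x * ?b z - F (x + z) * ?b z \<partial>lborel)"
      by (intro Bochner_Integration.integral_cong) (auto simp: H_def indicator_def algebra_simps)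
    also have "\<dots> = F x * of_real \<beta> - (\<integral>z. F (x + z) * ?b z \<partial>lborel)"
      using int1 intb by (subst Bochner_Integration.integral_diff) (auto simp: \<beta>_def)
    also have "\<dots> = of_real \<beta> * (F x - avg \<epsilon> F x)"
      using \<beta>(1) by (simp add: avg_def \<beta>_def[symmetric] right_diff_distrib mult.commute)
    finally have "cinner (abs_l2 H) (abs_l2 ?b) = of_real \<beta> * (F x - avg \<epsilon> F x)"
      by (simp add: cinner_abs[OF H sq_b])
    then have "\<beta> * cmod (F x - avg \<epsilon> F x) \<le> norm (abs_l2 H) * norm (abs_l2 ?b)"
      using norm_cinner_le[of "abs_l2 H" "abs_l2 ?b"] \<beta>(1) by (simp add: norm_mult)
    then have "(\<beta> * cmod (F x - avg \<epsilon> F x))\<^sup>2 \<le> (norm (abs_l2 H) * norm (abs_l2 ?b))\<^sup>2"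
      using \<beta>(1) by (intro power_mono) auto
    also have "\<dots> = (norm (abs_l2 H))\<^sup>2 * \<beta>"
      using norm_ball_sq[of "0::'a" \<epsilon>] by (simp add: power_mult_distrib \<beta>_def)
    finally have "(cmod (F x - avg \<epsilon> F x))\<^sup>2 \<le> 1 / \<beta> * (norm (abs_l2 H))\<^sup>2"
      using \<beta>(1) by (simp add: power_mult_distrib field_simps power2_eq_square)
    then have "ennreal ((cmod (F x - avg \<epsilon> F x))\<^sup>2) \<le> ennreal (1 / \<beta>) * ennreal ((norm (abs_l2 H))\<^sup>2)"
      using \<beta>(1) by (subst ennreal_mult[symmetric]) (auto intro!: ennreal_leI)
    also have "ennreal ((norm (abs_l2 H))\<^sup>2) = (\<integral>\<^sup>+z. ennreal ((cmod (H z))\<^sup>2) \<partial>lborel)"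
      using H by (simp add: norm_abs_sq[OF H] square_integrable_def nn_integral_eq_integral)
    also have "\<dots> = (\<integral>\<^sup>+z. ennreal ((cmod (F x - F (x + z)))\<^sup>2) * indicator ?B z \<partial>lborel)"
      by (intro nn_integral_cong) (auto simp: H_def indicator_def)
    finally show ?thesis .
  qed
  have "(\<integral>\<^sup>+x. ennreal ((cmod (F x - avg \<epsilon> F x))\<^sup>2) \<partial>lborel)
      \<le> (\<integral>\<^sup>+x. ennreal (1 / \<beta>) * (\<integral>\<^sup>+z. ennreal ((cmod (F x - F (x + z)))\<^sup>2) * indicator ?B z \<partial>lborel) \<partial>lborel)"
    by (intro nn_integral_mono pointwise)
  also have "\<dots> = ennreal (1 / \<beta>) * (\<integral>\<^sup>+x. (\<integral>\<^sup>+z. ennreal ((cmod (F x - F (x + z)))\<^sup>2) * indicator ?B z \<partial>lborel) \<partial>lborel)"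
    by (rule nn_integral_cmult) measurable
  also have "(\<integral>\<^sup>+x. (\<integral>\<^sup>+z. ennreal ((cmod (F x - F (x + z)))\<^sup>2) * indicator ?B z \<partial>lborel) \<partial>lborel)
     = (\<integral>\<^sup>+z. (\<integral>\<^sup>+x. ennreal ((cmod (F x - F (x + z)))\<^sup>2) * indicator ?B z \<partial>lborel) \<partial>lborel)"
    by (rule lborel_pair.Fubini') measurable
  also have "\<dots> = (\<integral>\<^sup>+z. (\<integral>\<^sup>+x. ennreal ((cmod (F x - F (x + z)))\<^sup>2) \<partial>lborel) * indicator ?B z \<partial>lborel)"
    by (intro nn_integral_cong nn_integral_multc) measurable
  also have "\<dots> \<le> (\<integral>\<^sup>+z. ennreal (D\<^sup>2) * indicator ?B z \<partial>lborel)"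
  proof (intro nn_integral_mono)
    fix z :: 'a
    show "(\<integral>\<^sup>+x. ennreal ((cmod (F x - F (x + z)))\<^sup>2) \<partial>lborel) * indicator ?B z \<le> ennreal (D\<^sup>2) * indicator ?B z"
    proof (cases "z \<in> ?B")
      case True
      have s: "square_integrable (\<lambda>x. F (x + z) - F x)"
        by (intro square_integrable_diff square_integrable_shift F)
      have "(\<integral>\<^sup>+x. ennreal ((cmod (F x - F (x + z)))\<^sup>2) \<partial>lborel) = (\<integral>\<^sup>+x. ennreal ((cmod (F (x + z) - F x))\<^sup>2) \<partial>lborel)"
        by (simp add: norm_minus_commute)
      also have "\<dots> = ennreal ((norm (abs_l2 (\<lambda>x. F (x + z) - F x)))\<^sup>2)"
        using s by (simp add: norm_abs_sq[OF s] square_integrable_def nn_integral_eq_integral)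
      also have "abs_l2 (\<lambda>x. F (x + z) - F x) = shift z (abs_l2 F) - abs_l2 F"
        by (simp add: abs_l2_diff square_integrable_shift F shift_abs)
      also have "ennreal ((norm (shift z (abs_l2 F) - abs_l2 F))\<^sup>2) \<le> ennreal (D\<^sup>2)"
        using D[of z] True by (intro ennreal_leI power_mono) (auto simp: dist_norm)
      finally show ?thesis using True by simp
    qed simp
  qed
  also have "\<dots> = ennreal (D\<^sup>2) * ennreal \<beta>"
    by (simp add: nn_integral_cmult_indicator \<beta>(2))
  also have "ennreal (1 / \<beta>) * (ennreal (D\<^sup>2) * ennreal \<beta>) = ennreal (D\<^sup>2)"
    using \<beta>(1) by (simp add: ennreal_mult[symmetric] flip: ennreal_mult)
  finally have bound: "(\<integral>\<^sup>+x. ennreal ((cmod (F x - avg \<epsilon> F x))\<^sup>2) \<partial>lborel) \<le> ennreal (D\<^sup>2)"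
    by (simp add: mult_left_mono)
  have int: "integrable lborel (\<lambda>x. (cmod (F x - avg \<epsilon> F x))\<^sup>2)"
  proof (rule integrableI_nonneg)
    show "(\<integral>\<^sup>+x. ennreal ((cmod (F x - avg \<epsilon> F x))\<^sup>2) \<partial>lborel) < \<infinity>"
      using bound by (rule le_less_trans) simp
  qed auto
  then show "square_integrable (\<lambda>x. F x - avg \<epsilon> F x)"
    by (simp add: square_integrable_def)
  show "(\<integral>x. (cmod (F x - avg \<epsilon> F x))\<^sup>2 \<partial>lborel) \<le> D\<^sup>2"
    using bound int by (simp add: nn_integral_eq_integral)
qed

text \<open>Each \<open>f k\<close> differs little from its average. The value of an average at a point is an inner product with the
indicator of a ball, whose squared norm is the volume of the ball; by the Bessel inequality the squares of
the averages therefore sum up, at every point, to a constant independent of the size of the family. The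
factor two in this constant accounts for real and imaginary parts.\<close>

lemma concentration_bound:
  fixes f :: "'i \<Rightarrow> 'a::euclidean_space l2"
  assumes fin: "finite I" and "0 < \<epsilon>"
    and bessel: "\<And>g. (\<Sum>k\<in>I. (inner (f k) g)\<^sup>2) \<le> E * (norm g)\<^sup>2"
    and D: "\<And>k z. k \<in> I \<Longrightarrow> norm z < \<epsilon> \<Longrightarrow> norm (shift z (f k) - f k) \<le> D k"
    and w: "w \<in> borel_measurable borel" "\<And>x. 0 \<le> w x" "\<And>x. w x \<le> 1" "integrable lborel (\<lambda>x. (w x)\<^sup>2)"
  shows "(\<Sum>k\<in>I. (norm (mul w (f k)))\<^sup>2)
    \<le> 2 * (\<Sum>k\<in>I. (D k)\<^sup>2) + 4 * E * (\<integral>x. (w x)\<^sup>2 \<partial>lborel) / measure lborel (ball (0::'a) \<epsilon>)"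
proof -
  define F where "F k = rep_l2 (f k)" for k
  have F: "square_integrable (F k)" "abs_l2 (F k) = f k" for k
    by (simp_all add: F_def square_integrable_rep abs_rep_l2)
  note Fb[measurable] = square_integrable_borel[OF F(1)]
  note [measurable] = borel_measurable_avg[OF Fb, of \<epsilon>] w(1)
  define \<beta> where "\<beta> = measure lborel (ball (0::'a) \<epsilon>)"
  have \<beta>: "0 < \<beta>" using \<open>0 < \<epsilon>\<close> by (simp add: \<beta>_def content_ball_gt_0_iff)
  let ?b = "\<lambda>x. abs_l2 (ind (ball x \<epsilon>))"
  have bw: "bounded_borel w" using w by (intro bounded_borelI[of _ 1]) auto
  have sum_avg: "(\<Sum>k\<in>I. (cmod (avg \<epsilon> (F k) x))\<^sup>2) \<le> 2 * E / \<beta>" for x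
  proof -
    have "(\<Sum>k\<in>I. (cmod (avg \<epsilon> (F k) x))\<^sup>2) = (\<Sum>k\<in>I. (cmod (cinner (f k) (?b x)))\<^sup>2) / \<beta>\<^sup>2"
      using \<beta> by (simp add: avg_eq_cinner[OF F(1)] F(2) \<beta>_def[symmetric] norm_divide power_divide sum_divide_distrib)
    also have "(\<Sum>k\<in>I. (cmod (cinner (f k) (?b x)))\<^sup>2)
        = (\<Sum>k\<in>I. (inner (f k) (?b x))\<^sup>2) + (\<Sum>k\<in>I. (inner (f k) (scaleC \<i> (?b x)))\<^sup>2)"
      by (simp add: norm_cinner_sq_eq sum.distrib)
    also have "\<dots> \<le> E * (norm (?b x))\<^sup>2 + E * (norm (scaleC \<i> (?b x)))\<^sup>2"
      by (intro add_mono bessel)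
    also have "\<dots> = 2 * E * \<beta>"
      using norm_ball_sq[of x \<epsilon>] by (simp add: norm_scaleC \<beta>_def)
    finally show ?thesis using \<beta> by (simp add: divide_right_mono power2_eq_square)
  qed
  have int_avg: "integrable lborel (\<lambda>x. (w x)\<^sup>2 * (cmod (avg \<epsilon> (F k) x))\<^sup>2)" if "k \<in> I" for k
  proof (rule Bochner_Integration.integrable_bound)
    show "integrable lborel (\<lambda>x. 2 * E / \<beta> * (w x)\<^sup>2)" using w(4) by simp
    have "norm ((w x)\<^sup>2 * (cmod (avg \<epsilon> (F k) x))\<^sup>2) \<le> norm (2 * E / \<beta> * (w x)\<^sup>2)" for x
    proof -
      have "(cmod (avg \<epsilon> (F k) x))\<^sup>2 \<le> 2 * E / \<beta>"
        by (rule order_trans[OF member_le_sum[OF that _ fin] sum_avg]) simp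
      then have "(w x)\<^sup>2 * (cmod (avg \<epsilon> (F k) x))\<^sup>2 \<le> (w x)\<^sup>2 * (2 * E / \<beta>)"
        by (rule mult_left_mono) simp
      also have "\<dots> = 2 * E / \<beta> * (w x)\<^sup>2" by (rule mult.commute)
      also have "\<dots> \<le> norm (2 * E / \<beta> * (w x)\<^sup>2)" by (simp only: real_norm_def abs_ge_self)
      finally show ?thesis by simp
    qed
    then show "AE x in lborel. norm ((w x)\<^sup>2 * (cmod (avg \<epsilon> (F k) x))\<^sup>2) \<le> norm (2 * E / \<beta> * (w x)\<^sup>2)"
      by simp
  qed measurable
  have est: "(norm (mul w (f k)))\<^sup>2 \<le> 2 * (\<integral>x. (w x)\<^sup>2 * (cmod (avg \<epsilon> (F k) x))\<^sup>2 \<partial>lborel) + 2 * (D k)\<^sup>2"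
    if k: "k \<in> I" for k
  proof -
    note err = avg_error[OF F(1) \<open>0 < \<epsilon>\<close>, of k "D k", unfolded F(2), OF D[OF k]]
    have sq: "square_integrable (\<lambda>x. w x *\<^sub>R F k x)" by (rule square_integrable_mul[OF bw F(1)])
    have "(norm (mul w (f k)))\<^sup>2 = (\<integral>x. (cmod (w x *\<^sub>R F k x))\<^sup>2 \<partial>lborel)"
      using mul_abs[OF bw F(1), of k] norm_abs_sq[OF sq] by (simp only: F(2))
    also have "\<dots> \<le> (\<integral>x. 2 * ((w x)\<^sup>2 * (cmod (avg \<epsilon> (F k) x))\<^sup>2) + 2 * (cmod (F k x - avg \<epsilon> (F k) x))\<^sup>2 \<partial>lborel)"
    proof (rule integral_mono)
      show "integrable lborel (\<lambda>x. (cmod (w x *\<^sub>R F k x))\<^sup>2)" using sq by (simp add: square_integrable_def)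
      show "integrable lborel (\<lambda>x. 2 * ((w x)\<^sup>2 * (cmod (avg \<epsilon> (F k) x))\<^sup>2) + 2 * (cmod (F k x - avg \<epsilon> (F k) x))\<^sup>2)"
        using int_avg[OF k] err(1) by (simp add: square_integrable_def)
      fix x
      have "cmod (w x *\<^sub>R F k x) \<le> w x * cmod (avg \<epsilon> (F k) x) + cmod (F k x - avg \<epsilon> (F k) x)"
      proof -
        have "cmod (w x *\<^sub>R F k x) \<le> w x * (cmod (avg \<epsilon> (F k) x) + cmod (F k x - avg \<epsilon> (F k) x))"
          using norm_triangle_ineq[of "avg \<epsilon> (F k) x" "F k x - avg \<epsilon> (F k) x"] w(2)[of x]
          by (simp add: mult_left_mono)
        also have "\<dots> \<le> w x * cmod (avg \<epsilon> (F k) x) + cmod (F k x - avg \<epsilon> (F k) x)"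
          using w(2,3)[of x] by (simp add: distrib_left mult_left_le_one_le)
        finally show ?thesis .
      qed
      then have "(cmod (w x *\<^sub>R F k x))\<^sup>2 \<le> (w x * cmod (avg \<epsilon> (F k) x) + cmod (F k x - avg \<epsilon> (F k) x))\<^sup>2"
        by (intro power_mono) simp_all
      also have "\<dots> \<le> 2 * (w x * cmod (avg \<epsilon> (F k) x))\<^sup>2 + 2 * (cmod (F k x - avg \<epsilon> (F k) x))\<^sup>2"
        using sum_squares_bound[of "w x * cmod (avg \<epsilon> (F k) x)" "cmod (F k x - avg \<epsilon> (F k) x)"]
        unfolding power2_sum by linarith
      finally show "(cmod (w x *\<^sub>R F k x))\<^sup>2 \<le> 2 * ((w x)\<^sup>2 * (cmod (avg \<epsilon> (F k) x))\<^sup>2) + 2 * (cmod (F k x - avg \<epsilon> (F k) x))\<^sup>2"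
        by (simp only: power_mult_distrib)
    qed
    also have "\<dots> = 2 * (\<integral>x. (w x)\<^sup>2 * (cmod (avg \<epsilon> (F k) x))\<^sup>2 \<partial>lborel) + 2 * (\<integral>x. (cmod (F k x - avg \<epsilon> (F k) x))\<^sup>2 \<partial>lborel)"
      using int_avg[OF k] err(1) by (simp add: square_integrable_def)
    also have "\<dots> \<le> 2 * (\<integral>x. (w x)\<^sup>2 * (cmod (avg \<epsilon> (F k) x))\<^sup>2 \<partial>lborel) + 2 * (D k)\<^sup>2"
      using err(2) by simp
    finally show ?thesis .
  qed
  have "(\<Sum>k\<in>I. (norm (mul w (f k)))\<^sup>2)
      \<le> (\<Sum>k\<in>I. 2 * (\<integral>x. (w x)\<^sup>2 * (cmod (avg \<epsilon> (F k) x))\<^sup>2 \<partial>lborel) + 2 * (D k)\<^sup>2)"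
    by (intro sum_mono est)
  also have "\<dots> = 2 * (\<integral>x. (\<Sum>k\<in>I. (w x)\<^sup>2 * (cmod (avg \<epsilon> (F k) x))\<^sup>2) \<partial>lborel) + 2 * (\<Sum>k\<in>I. (D k)\<^sup>2)"
    using int_avg by (simp add: sum.distrib sum_distrib_left Bochner_Integration.integral_sum)
  also have "(\<integral>x. (\<Sum>k\<in>I. (w x)\<^sup>2 * (cmod (avg \<epsilon> (F k) x))\<^sup>2) \<partial>lborel) \<le> (\<integral>x. 2 * E / \<beta> * (w x)\<^sup>2 \<partial>lborel)"
  proof (rule integral_mono)
    show "integrable lborel (\<lambda>x. \<Sum>k\<in>I. (w x)\<^sup>2 * (cmod (avg \<epsilon> (F k) x))\<^sup>2)"
      using int_avg by (intro Bochner_Integration.integrable_sum)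
    show "integrable lborel (\<lambda>x. 2 * E / \<beta> * (w x)\<^sup>2)" using w(4) by simp
    show "(\<Sum>k\<in>I. (w x)\<^sup>2 * (cmod (avg \<epsilon> (F k) x))\<^sup>2) \<le> 2 * E / \<beta> * (w x)\<^sup>2" for x
      using mult_left_mono[OF sum_avg[of x], of "(w x)\<^sup>2"] by (simp add: sum_distrib_left mult.commute)
  qed
  also have "(\<integral>x. 2 * E / \<beta> * (w x)\<^sup>2 \<partial>lborel) = 2 * E / \<beta> * (\<integral>x. (w x)\<^sup>2 \<partial>lborel)" by simp
  finally show ?thesis by (simp add: \<beta>_def)
qed

section \<open>The Dirichlet and the Neumann Laplacian\<close>

lemma neg_laplacianE:
  assumes "(u, a) \<in> neg_laplacian bc \<Omega>"
  obtains g h where "u \<in> laplacian_domain bc \<Omega>" "a = - (\<Sum>b\<in>Basis. h b)"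
    "\<And>b. b \<in> Basis \<Longrightarrow> weak_partial \<Omega> b u (g b)" "\<And>b. b \<in> Basis \<Longrightarrow> weak_partial \<Omega> b (g b) (h b)"
  using assms unfolding neg_laplacian_def by blast

text \<open>The approximants that define \<open>H10\<close> may be inserted into the weak derivatives of the gradient; in the limit
this yields Green's identity.\<close>

lemma dirichlet_approximation:
  assumes "open \<Omega>" "(u, a) \<in> neg_laplacian Dirichlet \<Omega>"
  obtains G \<Phi> where "\<And>k::nat. test_function \<Omega> (\<Phi> k)" "(\<lambda>k. abs_l2 (\<Phi> k)) \<longlonglongrightarrow> u"
    "\<And>b. b \<in> Basis \<Longrightarrow> (\<lambda>k. abs_l2 (partial b (\<Phi> k))) \<longlonglongrightarrow> G b"
    "inner a u = (\<Sum>b\<in>Basis. (norm (G b))\<^sup>2)"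
proof -
  obtain g h where gh: "u \<in> laplacian_domain Dirichlet \<Omega>" "a = - (\<Sum>b\<in>Basis. h b)"
    "\<And>b. b \<in> Basis \<Longrightarrow> weak_partial \<Omega> b u (g b)" "\<And>b. b \<in> Basis \<Longrightarrow> weak_partial \<Omega> b (g b) (h b)"
    by (rule neg_laplacianE[OF assms(2)]) (rule that)
  obtain \<Phi> where \<Phi>: "\<And>k::nat. test_function \<Omega> (\<Phi> k)" "H1_tendsto \<Omega> \<Phi> u"
    using gh(1) by (auto simp: H10_def)
  have lim: "(\<lambda>k. abs_l2 (\<Phi> k)) \<longlonglongrightarrow> u"
    using \<Phi>(2) by (simp add: H1_tendsto_def restrict_l2_test[OF \<Phi>(1)])
  have lim': "(\<lambda>k. abs_l2 (partial b (\<Phi> k))) \<longlonglongrightarrow> g b" if b: "b \<in> Basis" for b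
  proof -
    obtain g' where g': "weak_partial \<Omega> b u g'" "(\<lambda>k. restrict_l2 \<Omega> (partial b (\<Phi> k))) \<longlonglongrightarrow> g'"
      using \<Phi>(2) b by (auto simp: H1_tendsto_def)
    have "g' = g b" using weak_partial_unique[OF assms(1) g'(1) gh(3)[OF b]] .
    then show ?thesis
      using g'(2) by (simp add: restrict_l2_test[OF test_partial[OF \<Phi>(1) b]])
  qed
  have "inner (h b) u = - (norm (g b))\<^sup>2" if b: "b \<in> Basis" for b
  proof (rule LIMSEQ_unique)
    show "(\<lambda>k. inner (h b) (abs_l2 (\<Phi> k))) \<longlonglongrightarrow> inner (h b) u"
      by (intro tendsto_intros lim)
    have "(\<lambda>k. - inner (g b) (abs_l2 (partial b (\<Phi> k)))) \<longlonglongrightarrow> - inner (g b) (g b)"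
      by (intro tendsto_intros lim'[OF b])
    then show "(\<lambda>k. inner (h b) (abs_l2 (\<Phi> k))) \<longlonglongrightarrow> - (norm (g b))\<^sup>2"
      by (simp add: weak_partialD[OF gh(4)[OF b] \<Phi>(1)] power2_norm_eq_inner)
  qed
  then have "inner a u = (\<Sum>b\<in>Basis. (norm (g b))\<^sup>2)"
    by (simp add: gh(2) inner_sum_left sum_negf)
  with \<Phi>(1) lim lim' show ?thesis by (rule that)
qed

text \<open>As limits of test functions, elements of \<open>H10\<close> have weak derivatives in the whole space after extension by
zero.\<close>

lemma dirichlet_shift_estimate:
  assumes "open \<Omega>" "(u, a) \<in> neg_laplacian Dirichlet \<Omega>"
  shows "norm (shift z u - u) \<le> norm z * sqrt (inner a u)"
proof (rule dirichlet_approximation[OF assms])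
  fix G \<Phi>
  assume \<Phi>: "\<And>k::nat. test_function \<Omega> (\<Phi> k)" "(\<lambda>k. abs_l2 (\<Phi> k)) \<longlonglongrightarrow> u"
    "\<And>b. b \<in> Basis \<Longrightarrow> (\<lambda>k. abs_l2 (partial b (\<Phi> k))) \<longlonglongrightarrow> G b"
    "inner a u = (\<Sum>b\<in>Basis. (norm (G b))\<^sup>2)"
  have "weak_partial UNIV b u (G b)" if b: "b \<in> Basis" for b
  proof (rule weak_partialI)
    show "u \<in> L2 UNIV" "G b \<in> L2 UNIV" by (simp_all add: L2_def)
    fix \<psi> :: "'a \<Rightarrow> complex" assume \<psi>: "test_function UNIV \<psi>"
    show "inner u (abs_l2 (partial b \<psi>)) = - inner (G b) (abs_l2 \<psi>)"
    proof (rule LIMSEQ_unique)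
      show "(\<lambda>k. inner (abs_l2 (\<Phi> k)) (abs_l2 (partial b \<psi>))) \<longlonglongrightarrow> inner u (abs_l2 (partial b \<psi>))"
        by (intro tendsto_intros \<Phi>(2))
      have "(\<lambda>k. - inner (abs_l2 (partial b (\<Phi> k))) (abs_l2 \<psi>)) \<longlonglongrightarrow> - inner (G b) (abs_l2 \<psi>)"
        by (intro tendsto_intros \<Phi>(3)[OF b])
      then show "(\<lambda>k. inner (abs_l2 (\<Phi> k)) (abs_l2 (partial b \<psi>))) \<longlonglongrightarrow> - inner (G b) (abs_l2 \<psi>)"
        by (simp add: inner_partial_test[OF test_function_mono[OF \<Phi>(1)] \<psi>])
    qed
  qed
  then have "norm (shift z u - u) \<le> norm z * sqrt (\<Sum>b\<in>Basis. (norm (G b))\<^sup>2)"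
    by (rule shift_estimate)
  then show ?thesis by (simp add: \<Phi>(4))
qed

lemma bounded_borel_smooth_supported:
  assumes "smooth_on UNIV c" "compact K" "\<And>x. x \<notin> K \<Longrightarrow> c x = 0" shows "bounded_borel c"
proof -
  obtain C where "\<And>x. norm (c x) \<le> C" by (rule smooth_supported_bounded[OF assms(1,2)]) (use assms(3) that in auto)
  then show ?thesis using smooth_borel[OF assms(1)] by (intro bounded_borelI[of _ C]) auto
qed

lemma square_integrable_restrict_smooth:
  assumes "smooth_on UNIV \<Phi>" "open \<Omega>" "bounded \<Omega>"
  shows "square_integrable (\<lambda>x. if x \<in> \<Omega> then \<Phi> x else 0)"
proof -
  have K: "compact (closure \<Omega>)" using assms(3) by (simp add: compact_closure)
  have "bounded (\<Phi> ` closure \<Omega>)"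
    by (intro compact_imp_bounded compact_continuous_image K)
      (rule continuous_on_subset[OF smooth_continuous_on[OF assms(1)] subset_UNIV])
  then obtain C where C: "\<And>x. x \<in> closure \<Omega> \<Longrightarrow> cmod (\<Phi> x) \<le> C" by (auto simp: bounded_iff)
  have "cmod (if x \<in> \<Omega> then \<Phi> x else 0) \<le> C * indicator (closure \<Omega>) x" for x
    using C[of x] closure_subset[of \<Omega>] order_trans[OF norm_ge_zero C[of x]] by (auto simp: indicator_def)
  moreover have "(\<lambda>x. if x \<in> \<Omega> then \<Phi> x else 0) \<in> borel_measurable borel"
    using assms(2) smooth_borel[OF assms(1)] by (intro measurable_If_set) auto
  ultimately show ?thesis by (intro square_integrable_of_bounded[OF _ K])
qed

text \<open>A local version of Green's identity: the first term under the root equals the squared norm of the gradient of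
\<open>\<eta> \<theta>\<close> minus that of \<open>\<theta>\<close> times the gradient of \<open>\<eta>\<close>. To justify it one needs to insert \<open>\<eta>\<^sup>2\<close> times a
partial derivative of \<open>\<theta>\<close> as a test function into the weak derivative of \<open>\<theta>\<close>. The Neumann condition
requires the partial derivatives of \<open>\<theta>\<close> to have traces, and the definition of a trace provides smooth
functions that approximate them; these become test functions when multiplied by \<open>\<eta>\<^sup>2\<close>.\<close>

lemma neumann_cutoff_estimate:
  fixes \<Omega> :: "'a::euclidean_space set"
  assumes "open \<Omega>" "bounded \<Omega>" and N: "(\<theta>, a) \<in> neg_laplacian Neumann \<Omega>"
    and cut: "cutoff \<Omega> \<eta>"
  shows "norm (shift z (mul \<eta> \<theta>) - mul \<eta> \<theta>) \<le> norm z * sqrt (inner a (mul (\<lambda>x. \<eta> x * \<eta> x) \<theta>)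
    + (\<Sum>b\<in>Basis. (norm (mul (partial b \<eta>) \<theta>))\<^sup>2))"
    and "0 \<le> inner a (mul (\<lambda>x. \<eta> x * \<eta> x) \<theta>) + (\<Sum>b\<in>Basis. (norm (mul (partial b \<eta>) \<theta>))\<^sup>2)"
proof -
  obtain K where "compact K" "K \<subseteq> \<Omega>" "\<And>x. x \<notin> K \<Longrightarrow> \<eta> x = 0"
    by (rule cutoffE[OF cut]) (rule that)
  note \<eta> = cutoffD(1)[OF cut] this
  obtain g h where gh: "\<theta> \<in> laplacian_domain Neumann \<Omega>" "a = - (\<Sum>b\<in>Basis. h b)"
    "\<And>b. b \<in> Basis \<Longrightarrow> weak_partial \<Omega> b \<theta> (g b)" "\<And>b. b \<in> Basis \<Longrightarrow> weak_partial \<Omega> b (g b) (h b)"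
    by (rule neg_laplacianE[OF N]) (rule that)
  have d\<eta>: "smooth_on UNIV (partial b \<eta>)" "\<And>x. x \<notin> K \<Longrightarrow> partial b \<eta> x = 0" if "b \<in> Basis" for b
    using smooth_partial[OF \<eta>(1) that] partial_zero_outside[of K \<eta> _ b] \<eta>(2,4) by auto
  have bm: "bounded_borel \<eta>" "\<And>b. b \<in> Basis \<Longrightarrow> bounded_borel (partial b \<eta>)"
    using bounded_borel_smooth_supported[OF \<eta>(1,2,4)] bounded_borel_smooth_supported[OF d\<eta>(1) \<eta>(2) d\<eta>(2)] by auto
  note bm2 = bounded_borel_mult[OF bm(1) bm(1)]
  let ?\<eta>2 = "\<lambda>x. \<eta> x * \<eta> x"
  define k where "k b = mul \<eta> (g b) + mul (partial b \<eta>) \<theta>" for b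
  have key: "inner (h b) (mul ?\<eta>2 \<theta>) = (norm (mul (partial b \<eta>) \<theta>))\<^sup>2 - (norm (k b))\<^sup>2" if b: "b \<in> Basis" for b
  proof -
    obtain \<gamma> where \<gamma>: "has_trace \<Omega> (g b) \<gamma>"
    proof -
      obtain G g' where "weak_partial \<Omega> b \<theta> (G b)" "has_trace \<Omega> (G b) (g' b)"
        using gh(1) b by (auto simp: normal_derivative_zero_def)
      then show ?thesis
        using weak_partial_unique[OF assms(1) _ gh(3)[OF b]] that by metis
    qed
    then obtain \<Phi> where \<Phi>: "\<And>n::nat. smooth_on UNIV (\<Phi> n)" "H1_tendsto \<Omega> \<Phi> (g b)"
      unfolding has_trace_def by blast
    have lim: "(\<lambda>n. restrict_l2 \<Omega> (\<Phi> n)) \<longlonglongrightarrow> g b"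
      using \<Phi>(2) by (simp add: H1_tendsto_def)
    have lim': "(\<lambda>n. restrict_l2 \<Omega> (partial b (\<Phi> n))) \<longlonglongrightarrow> h b"
    proof -
      obtain h' where "weak_partial \<Omega> b (g b) h'" "(\<lambda>n. restrict_l2 \<Omega> (partial b (\<Phi> n))) \<longlonglongrightarrow> h'"
        using \<Phi>(2) b by (auto simp: H1_tendsto_def)
      then show ?thesis using weak_partial_unique[OF assms(1) _ gh(4)[OF b]] by metis
    qed
    have e2: "smooth_on UNIV ?\<eta>2" using \<eta>(1) by (intro smooth_mult)
    have de2: "partial b ?\<eta>2 x = 2 * (\<eta> x * partial b \<eta> x)" for x
      using partial_scaleR[OF \<eta>(1) \<eta>(1), where b = b and x = x] by simp
    have bm': "bounded_borel (\<lambda>x. \<eta> x * partial b \<eta> x)" by (rule bounded_borel_mult[OF bm(1) bm(2)[OF b]])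
    have step: "inner \<theta> (mul ?\<eta>2 (restrict_l2 \<Omega> (partial b (\<Phi> n))) + 2 *\<^sub>R mul (\<lambda>x. \<eta> x * partial b \<eta> x) (restrict_l2 \<Omega> (\<Phi> n)))
      = - inner (g b) (mul ?\<eta>2 (restrict_l2 \<Omega> (\<Phi> n)))" for n
    proof -
      let ?\<xi> = "\<lambda>x. ?\<eta>2 x *\<^sub>R \<Phi> n x"
      have t: "test_function \<Omega> ?\<xi>"
        using \<eta>(4) by (intro test_functionI[OF smooth_scaleR[OF e2 \<Phi>(1)] \<eta>(2,3)]) simp
      note sq = square_integrable_restrict_smooth[OF \<Phi>(1) assms(1,2), of n]
      note sq' = square_integrable_restrict_smooth[OF smooth_partial[OF \<Phi>(1) b] assms(1,2), of n]
      have zero: "\<eta> x = 0" if "x \<notin> \<Omega>" for x using \<eta>(3,4) that by blast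
      have e: "mul ?\<eta>2 (restrict_l2 \<Omega> (\<Phi> n)) = abs_l2 ?\<xi>"
        unfolding restrict_l2_def mul_abs[OF bm2 sq]
        by (rule arg_cong[of _ _ abs_l2]) (auto simp: zero)
      have "abs_l2 (partial b ?\<xi>) = abs_l2 (\<lambda>x. ?\<eta>2 x *\<^sub>R (if x \<in> \<Omega> then partial b (\<Phi> n) x else 0)
          + 2 *\<^sub>R ((\<eta> x * partial b \<eta> x) *\<^sub>R (if x \<in> \<Omega> then \<Phi> n x else 0)))"
        by (rule arg_cong[of _ _ abs_l2], rule ext)
          (simp add: partial_scaleR[OF e2 \<Phi>(1)] de2 zero)
      also have "\<dots> = mul ?\<eta>2 (restrict_l2 \<Omega> (partial b (\<Phi> n))) + 2 *\<^sub>R mul (\<lambda>x. \<eta> x * partial b \<eta> x) (restrict_l2 \<Omega> (\<Phi> n))"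
        unfolding restrict_l2_def mul_abs[OF bm2 sq'] mul_abs[OF bm' sq]
          abs_l2_scaleR[OF square_integrable_mul[OF bm' sq], symmetric]
        by (rule abs_l2_add[OF square_integrable_mul[OF bm2 sq'] square_integrable_scaleR[OF square_integrable_mul[OF bm' sq]]])
      finally show ?thesis
        using weak_partialD[OF gh(3)[OF b] t] by (simp add: e)
    qed
    have "inner \<theta> (mul ?\<eta>2 (h b) + 2 *\<^sub>R mul (\<lambda>x. \<eta> x * partial b \<eta> x) (g b)) = - inner (g b) (mul ?\<eta>2 (g b))"
    proof (rule LIMSEQ_unique)
      show "(\<lambda>n. inner \<theta> (mul ?\<eta>2 (restrict_l2 \<Omega> (partial b (\<Phi> n))) + 2 *\<^sub>R mul (\<lambda>x. \<eta> x * partial b \<eta> x) (restrict_l2 \<Omega> (\<Phi> n))))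
        \<longlonglongrightarrow> inner \<theta> (mul ?\<eta>2 (h b) + 2 *\<^sub>R mul (\<lambda>x. \<eta> x * partial b \<eta> x) (g b))"
        by (intro tendsto_intros tendsto_mul bm2 bm' lim lim')
      show "(\<lambda>n. inner \<theta> (mul ?\<eta>2 (restrict_l2 \<Omega> (partial b (\<Phi> n))) + 2 *\<^sub>R mul (\<lambda>x. \<eta> x * partial b \<eta> x) (restrict_l2 \<Omega> (\<Phi> n))))
        \<longlonglongrightarrow> - inner (g b) (mul ?\<eta>2 (g b))"
        unfolding step by (intro tendsto_intros tendsto_mul bm2 lim)
    qed
    moreover have "inner \<theta> (mul (\<lambda>x. \<eta> x * partial b \<eta> x) (g b)) = inner (mul (partial b \<eta>) \<theta>) (mul \<eta> (g b))"
    proof -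
      have "mul (\<lambda>x. \<eta> x * partial b \<eta> x) (g b) = mul (partial b \<eta>) (mul \<eta> (g b))"
        using mul_mul[OF bm(2)[OF b] bm(1), of "g b"] by (simp add: mult.commute)
      then show ?thesis by (simp add: inner_mul[OF bm(2)[OF b]])
    qed
    moreover have "inner (g b) (mul ?\<eta>2 (g b)) = (norm (mul \<eta> (g b)))\<^sup>2"
      using inner_mul[OF bm(1), of "g b" "mul \<eta> (g b)"] mul_mul[OF bm(1) bm(1), of "g b"]
      by (simp add: power2_norm_eq_inner)
    moreover have "inner (h b) (mul ?\<eta>2 \<theta>) = inner \<theta> (mul ?\<eta>2 (h b))"
      using inner_mul[OF bm2, of "h b" \<theta>] by (simp add: inner_commute)
    ultimately show ?thesis
      by (simp add: k_def inner_add_right power2_norm_eq_inner inner_add_left inner_commute)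
  qed
  have sum_k: "inner a (mul ?\<eta>2 \<theta>) + (\<Sum>b\<in>Basis. (norm (mul (partial b \<eta>) \<theta>))\<^sup>2) = (\<Sum>b\<in>Basis. (norm (k b))\<^sup>2)"
    by (simp add: gh(2) inner_sum_left key sum_subtractf)
  have "weak_partial UNIV b (mul \<eta> \<theta>) (k b)" if b: "b \<in> Basis" for b
  proof (rule weak_partialI)
    show "mul \<eta> \<theta> \<in> L2 UNIV" "k b \<in> L2 UNIV" by (simp_all add: L2_def)
    fix \<psi> :: "'a \<Rightarrow> complex" assume \<psi>: "test_function UNIV \<psi>"
    let ?\<xi> = "\<lambda>x. \<eta> x *\<^sub>R \<psi> x"
    have t: "test_function \<Omega> ?\<xi>"
      using \<eta>(4) by (intro test_functionI[OF smooth_scaleR[OF \<eta>(1) test_smooth[OF \<psi>]] \<eta>(2,3)]) simp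
    note sq = square_integrable_test[OF \<psi>] and sq' = square_integrable_test[OF test_partial[OF \<psi> b]]
    have "abs_l2 (partial b ?\<xi>) = abs_l2 (\<lambda>x. \<eta> x *\<^sub>R partial b \<psi> x + partial b \<eta> x *\<^sub>R \<psi> x)"
      by (rule arg_cong[of _ _ abs_l2], rule ext) (rule partial_scaleR[OF \<eta>(1) test_smooth[OF \<psi>]])
    also have "\<dots> = mul \<eta> (abs_l2 (partial b \<psi>)) + mul (partial b \<eta>) (abs_l2 \<psi>)"
      unfolding mul_abs[OF bm(1) sq'] mul_abs[OF bm(2)[OF b] sq]
      by (rule abs_l2_add[OF square_integrable_mul[OF bm(1) sq'] square_integrable_mul[OF bm(2)[OF b] sq]])
    finally have "inner \<theta> (mul \<eta> (abs_l2 (partial b \<psi>)) + mul (partial b \<eta>) (abs_l2 \<psi>)) = - inner (g b) (mul \<eta> (abs_l2 \<psi>))"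
      using weak_partialD[OF gh(3)[OF b] t] mul_abs[OF bm(1) sq] by simp
    then show "inner (mul \<eta> \<theta>) (abs_l2 (partial b \<psi>)) = - inner (k b) (abs_l2 \<psi>)"
      by (simp add: k_def inner_mul[OF bm(1)] inner_mul[OF bm(2)[OF b]] inner_add_left inner_add_right)
  qed
  then show "norm (shift z (mul \<eta> \<theta>) - mul \<eta> \<theta>) \<le> norm z * sqrt (inner a (mul ?\<eta>2 \<theta>)
      + (\<Sum>b\<in>Basis. (norm (mul (partial b \<eta>) \<theta>))\<^sup>2))"
    unfolding sum_k by (rule shift_estimate)
  show "0 \<le> inner a (mul ?\<eta>2 \<theta>) + (\<Sum>b\<in>Basis. (norm (mul (partial b \<eta>) \<theta>))\<^sup>2)"
    unfolding sum_k by (intro sum_nonneg) simp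
qed

section \<open>The square root of a Laplacian\<close>

locale square_root =
  fixes \<Omega> :: "'a::euclidean_space set" and bc :: boundary_condition and S :: "'a l2_operator"
  assumes open_domain: "open \<Omega>"
    and square_root: "square_root_on (L2 \<Omega>) (neg_laplacian bc \<Omega>) S"
begin

lemma S_adjoint: "S = adjoint_on (L2 \<Omega>) S"
  and S_dense: "L2 \<Omega> \<subseteq> closure (Domain S)"
  and S_square: "neg_laplacian bc \<Omega> = S O S"
  using square_root by (auto simp: square_root_on_def self_adjoint_on_def)

lemma S_iff: "(x, y) \<in> S \<longleftrightarrow> x \<in> L2 \<Omega> \<and> y \<in> L2 \<Omega> \<and> (\<forall>(u, a)\<in>S. cinner a x = cinner u y)"
  by (subst S_adjoint) (simp add: adjoint_on_def)

lemma S_add: "(x, y) \<in> S \<Longrightarrow> (x', y') \<in> S \<Longrightarrow> (x + x', y + y') \<in> S"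
  unfolding S_iff by (fastforce intro: L2_add simp: cinner_add_right)

lemma S_scaleC: "(x, y) \<in> S \<Longrightarrow> (scaleC c x, scaleC c y) \<in> S"
  unfolding S_iff by (fastforce intro: L2_scaleC simp: cinner_scaleC_right)

lemma S_symmetric: "(x, y) \<in> S \<Longrightarrow> (x', y') \<in> S \<Longrightarrow> inner y x' = inner x y'"
  using S_iff[of x' y'] by (fastforce simp: inner_l2_def)

text \<open>Two values differ by a vector orthogonal to the dense domain.\<close>

lemma S_unique:
  assumes "(x, y) \<in> S" "(x, y') \<in> S" shows "y = y'"
proof -
  have 0: "inner u (y - y') = 0" if "u \<in> Domain S" for u
    using that S_symmetric[OF _ assms(1)] S_symmetric[OF _ assms(2)] by (auto simp: inner_diff_right)
  have "y - y' \<in> closure (Domain S)"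
    using assms S_dense S_iff[of x y] S_iff[of x y'] by (auto intro: L2_diff)
  then obtain X where X: "\<And>n. X n \<in> Domain S" "X \<longlonglongrightarrow> y - y'"
    unfolding closure_sequential by blast
  have "(\<lambda>n. inner (X n) (y - y')) \<longlonglongrightarrow> inner (y - y') (y - y')" by (intro tendsto_intros X(2))
  then have "inner (y - y') (y - y') = 0" using 0[OF X(1)] by (simp add: LIMSEQ_const_iff)
  then show ?thesis by simp
qed

abbreviation op :: "'a l2 \<Rightarrow> 'a l2" where "op \<equiv> op_value S"

lemma op_eq: "(x, y) \<in> S \<Longrightarrow> op x = y"
  unfolding op_value_def using S_unique by blast

lemma op_mem: "x \<in> Domain S \<Longrightarrow> (x, op x) \<in> S"
  using op_eq by blast

lemma op_add: "x \<in> Domain S \<Longrightarrow> y \<in> Domain S \<Longrightarrow> op (x + y) = op x + op y"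
  by (rule op_eq[OF S_add[OF op_mem op_mem]])

lemma op_scaleC: "x \<in> Domain S \<Longrightarrow> op (scaleC c x) = scaleC c (op x)"
  by (rule op_eq[OF S_scaleC[OF op_mem]])

lemma op_scaleR: "x \<in> Domain S \<Longrightarrow> op (a *\<^sub>R x) = a *\<^sub>R op x"
  by (simp add: scaleR_l2_def op_scaleC)

lemma Domain_add: "x \<in> Domain S \<Longrightarrow> y \<in> Domain S \<Longrightarrow> x + y \<in> Domain S"
  using S_add by blast

lemma Domain_scaleC: "x \<in> Domain S \<Longrightarrow> scaleC c x \<in> Domain S"
  using S_scaleC by blast

lemma Domain_zero: "0 \<in> Domain S"
proof -
  have "cinner a 0 = 0" for a :: "'a l2" by (subst cinner_commute) (simp add: cinner_zero_left)
  then have "(0, 0) \<in> S" using S_iff[of 0 0] L2_zero by auto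
  then show ?thesis by blast
qed

lemma neg_laplacian_Domain: "(u, a) \<in> neg_laplacian bc \<Omega> \<Longrightarrow> u \<in> Domain S"
  unfolding S_square by blast

lemma inner_op_op:
  assumes "(u, a) \<in> neg_laplacian bc \<Omega>" "x \<in> Domain S"
  shows "inner a x = inner (op u) (op x)"
proof -
  obtain y where y: "(u, y) \<in> S" "(y, a) \<in> S" using assms(1) unfolding S_square by blast
  then have "inner a x = inner y (op x)" using S_symmetric[OF y(2) op_mem[OF assms(2)]] by simp
  then show ?thesis using op_eq[OF y(1)] by simp
qed

lemma norm_op_sq: "(u, a) \<in> neg_laplacian bc \<Omega> \<Longrightarrow> (norm (op u))\<^sup>2 = inner a u"
  using inner_op_op[of u a u] neg_laplacian_Domain[of u a] by (simp add: power2_norm_eq_inner)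

lemma test_Domain: "test_function \<Omega> \<phi> \<Longrightarrow> abs_l2 \<phi> \<in> Domain S"
  by (rule neg_laplacian_Domain[OF test_in_neg_laplacian[OF _ open_domain]])

lemma norm_op_test:
  "test_function \<Omega> \<phi> \<Longrightarrow> (norm (op (abs_l2 \<phi>)))\<^sup>2 = (\<Sum>b\<in>Basis. (norm (abs_l2 (partial b \<phi>)))\<^sup>2)"
  using norm_op_sq[OF test_in_neg_laplacian[OF _ open_domain]] norm_gradient_test by metis

text \<open>For a test function \<open>\<phi>\<close> in place of \<open>\<theta>\<close> the left-hand side is \<open>\<langle>S \<phi>, S q\<rangle>\<close>, and \<open>|S \<phi>| = |\<nabla>\<phi>|\<close> whichever
boundary condition \<open>S\<close> belongs to. The estimate extends to \<open>\<theta>\<close> by approximation in \<open>H10\<close>.\<close>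

lemma dirichlet_duality:
  assumes "(\<theta>, a') \<in> neg_laplacian Dirichlet \<Omega>" "(q, a) \<in> neg_laplacian bc \<Omega>"
  shows "\<bar>inner \<theta> a\<bar> \<le> sqrt (inner a' \<theta>) * norm (op q)"
proof (rule dirichlet_approximation[OF open_domain assms(1)])
  fix G \<Phi>
  assume \<Phi>: "\<And>k::nat. test_function \<Omega> (\<Phi> k)" "(\<lambda>k. abs_l2 (\<Phi> k)) \<longlonglongrightarrow> \<theta>"
    "\<And>b. b \<in> Basis \<Longrightarrow> (\<lambda>k. abs_l2 (partial b (\<Phi> k))) \<longlonglongrightarrow> G b"
    "inner a' \<theta> = (\<Sum>b\<in>Basis. (norm (G b))\<^sup>2)"
  have bound: "\<bar>inner (abs_l2 (\<Phi> k)) a\<bar> \<le> sqrt (\<Sum>b\<in>Basis. (norm (abs_l2 (partial b (\<Phi> k))))\<^sup>2) * norm (op q)" for k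
  proof -
    have "inner (abs_l2 (\<Phi> k)) a = inner (op (abs_l2 (\<Phi> k))) (op q)"
      using inner_op_op[OF assms(2) test_Domain[OF \<Phi>(1)]] by (simp add: inner_commute)
    then have "\<bar>inner (abs_l2 (\<Phi> k)) a\<bar> \<le> norm (op (abs_l2 (\<Phi> k))) * norm (op q)"
      by (simp add: Cauchy_Schwarz_ineq2)
    also have "norm (op (abs_l2 (\<Phi> k))) = sqrt (\<Sum>b\<in>Basis. (norm (abs_l2 (partial b (\<Phi> k))))\<^sup>2)"
      using norm_op_test[OF \<Phi>(1), of k] by (metis norm_ge_zero real_sqrt_unique)
    finally show ?thesis .
  qed
  have lim1: "(\<lambda>k. \<bar>inner (abs_l2 (\<Phi> k)) a\<bar>) \<longlonglongrightarrow> \<bar>inner \<theta> a\<bar>"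
    by (intro tendsto_intros \<Phi>(2))
  have lim2: "(\<lambda>k. sqrt (\<Sum>b\<in>Basis. (norm (abs_l2 (partial b (\<Phi> k))))\<^sup>2) * norm (op q))
      \<longlonglongrightarrow> sqrt (\<Sum>b\<in>Basis. (norm (G b))\<^sup>2) * norm (op q)"
    by (intro tendsto_intros \<Phi>(3))
  show ?thesis
    unfolding \<Phi>(4) using bound by (intro LIMSEQ_le[OF lim1 lim2]) simp
qed

end

section \<open>Orbits of the coupled system\<close>

lemma increment_ge:
  fixes f :: "real \<Rightarrow> real"
  assumes "0 \<le> t" and der: "\<And>s. 0 \<le> s \<Longrightarrow> \<exists>D. (f has_real_derivative D) (at s within {0..}) \<and> - c \<le> D"
  shows "f 0 - c * t \<le> f t"
proof -
  obtain f' where f': "\<And>s. 0 \<le> s \<Longrightarrow> (f has_real_derivative f' s) (at s within {0..})" "\<And>s. 0 \<le> s \<Longrightarrow> - c \<le> f' s"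
    using der by metis
  have "\<exists>s\<in>{0..t}. f t - f 0 = f' s * (t - 0)"
  proof (rule mvt_very_simple[OF assms(1)])
    fix s assume s: "0 \<le> s" "s \<le> t"
    show "(f has_derivative (*) (f' s)) (at s within {0..t})"
      using f'(1)[OF s(1)] unfolding has_field_derivative_def
      by (rule has_derivative_subset) auto
  qed
  then obtain s where s: "0 \<le> s" "f t - f 0 = f' s * t" by auto
  have "- c * t \<le> f' s * t" using f'(2)[OF s(1)] assms(1) by (rule mult_right_mono)
  then show ?thesis using s(2) by simp
qed

lemma has_real_derivative_norm_sq:
  fixes f :: "real \<Rightarrow> 'a::real_inner"
  assumes "(f has_vector_derivative f') (at t within A)"
  shows "((\<lambda>s. (norm (f s))\<^sup>2) has_real_derivative 2 * inner (f t) f') (at t within A)"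
  using bounded_bilinear.has_vector_derivative[OF bounded_bilinear_inner assms assms]
  by (simp add: power2_norm_eq_inner has_real_derivative_iff_has_vector_derivative inner_commute)

locale coupled_system = square_root +
  fixes bc' :: boundary_condition and \<gamma> :: real and T :: "real \<Rightarrow> 'a state \<Rightarrow> 'a state"
  assumes semigroup: "C0_semigroup (state_space \<Omega> S) (graph_norm S) T"
    and contractive: "contractive (state_space \<Omega> S) (state_norm S) T"
    and generator: "generator (state_space \<Omega> S) (graph_norm S) T = coupled_operator bc bc' \<Omega> \<gamma> S"
begin

abbreviation X :: "'a state set" where "X \<equiv> state_space \<Omega> S"
abbreviation gen :: "('a state \<times> 'a state) set" where "gen \<equiv> generator X (graph_norm S) T"

text \<open>Energy coordinates: they turn the state norm into the norm of a product of inner product spaces, where orbits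
can be differentiated.\<close>

definition E :: "'a state \<Rightarrow> 'a l2 \<times> 'a l2 \<times> 'a l2" where
  "E U = (op (fst U), snd U)"

lemma X_iff: "(u, v, \<theta>) \<in> X \<longleftrightarrow> u \<in> Domain S \<and> v \<in> L2 \<Omega> \<and> \<theta> \<in> L2 \<Omega>"
  by (simp add: state_space_def)

lemma X_add: "U \<in> X \<Longrightarrow> V \<in> X \<Longrightarrow> U + V \<in> X"
  by (cases U; cases V) (simp only: X_iff add_Pair Domain_add L2_add simp_thms)

lemma scaleR_eq: "c *\<^sub>R U = state_scaleC (complex_of_real c) U"
  by (cases U) (simp add: scaleR_l2_def)

lemma X_scaleR: "U \<in> X \<Longrightarrow> c *\<^sub>R U \<in> X"
  by (cases U) (simp only: scaleR_Pair X_iff, simp add: scaleR_l2_def Domain_scaleC L2_scaleC)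

lemma X_diff: "U \<in> X \<Longrightarrow> V \<in> X \<Longrightarrow> U - V \<in> X"
  using X_add[OF _ X_scaleR[of V "-1"], of U] by simp

lemma X_zero: "0 \<in> X"
  by (simp only: zero_prod_def X_iff Domain_zero L2_zero simp_thms)

lemma E_add: "U \<in> X \<Longrightarrow> V \<in> X \<Longrightarrow> E (U + V) = E U + E V"
  by (cases U; cases V) (simp only: X_iff E_def add_Pair fst_conv snd_conv op_add)

lemma E_scaleR: "U \<in> X \<Longrightarrow> E (c *\<^sub>R U) = c *\<^sub>R E U"
  by (cases U) (simp only: X_iff E_def scaleR_Pair fst_conv snd_conv op_scaleR)

lemma E_diff: "U \<in> X \<Longrightarrow> V \<in> X \<Longrightarrow> E (U - V) = E U - E V"
  using E_add[OF _ X_scaleR[of V "-1"], of U] E_scaleR[of V "-1"] by simp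

lemma E_zero: "E 0 = 0"
  using E_scaleR[OF X_zero, of 0] by simp

lemma state_norm_eq: "state_norm S U = norm (E U)"
  by (cases U) (simp add: state_norm_def E_def norm_eq_sqrt_inner[of "(_, _)"] inner_Pair inner_l2_def)

lemma norm_E_le_graph_norm: "norm (E U) \<le> graph_norm S U"
  unfolding graph_norm_def state_norm_eq by (rule real_le_rsqrt) simp

lemma graph_norm_nonneg: "0 \<le> graph_norm S U"
  by (simp add: graph_norm_def)

lemma T_mem: "0 \<le> t \<Longrightarrow> U \<in> X \<Longrightarrow> T t U \<in> X"
  and T_add: "0 \<le> t \<Longrightarrow> U \<in> X \<Longrightarrow> V \<in> X \<Longrightarrow> T t (U + V) = T t U + T t V"
  and T_bound: "0 \<le> t \<Longrightarrow> \<exists>C. \<forall>U\<in>X. graph_norm S (T t U) \<le> C * graph_norm S U"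
  and T_0: "U \<in> X \<Longrightarrow> T 0 U = U"
  and T_plus: "0 \<le> s \<Longrightarrow> 0 \<le> t \<Longrightarrow> U \<in> X \<Longrightarrow> T (s + t) U = T s (T t U)"
  using semigroup unfolding C0_semigroup_def bounded_operator_on_def by blast+

lemma T_scaleR: "0 \<le> t \<Longrightarrow> U \<in> X \<Longrightarrow> T t (c *\<^sub>R U) = c *\<^sub>R T t U"
  using semigroup unfolding C0_semigroup_def bounded_operator_on_def scaleR_eq by blast

lemma T_diff: "0 \<le> t \<Longrightarrow> U \<in> X \<Longrightarrow> V \<in> X \<Longrightarrow> T t (U - V) = T t U - T t V"
  using T_add[OF _ _ X_scaleR[of V "-1"], of t U] T_scaleR[of t V "-1"] by simp

lemma T_contraction: "0 \<le> t \<Longrightarrow> U \<in> X \<Longrightarrow> norm (E (T t U)) \<le> norm (E U)"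
  using contractive unfolding contractive_def state_norm_eq by blast

lemma tendsto_E_of_graph_norm:
  assumes "((\<lambda>h. graph_norm S (f h)) \<longlongrightarrow> 0) F" shows "((\<lambda>h. norm (E (f h))) \<longlongrightarrow> 0) F"
  by (rule Lim_null_comparison[OF _ assms]) (simp add: norm_E_le_graph_norm)

lemma T_continuous_0:
  assumes "U \<in> X" shows "((\<lambda>h. norm (E (T h U - U))) \<longlongrightarrow> 0) (at_right 0)"
  using assms semigroup unfolding C0_semigroup_def by (intro tendsto_E_of_graph_norm) blast

lemma gen_mem: "(U, V) \<in> gen \<Longrightarrow> U \<in> X" "(U, V) \<in> gen \<Longrightarrow> V \<in> X"
  by (auto simp: generator_def)

lemma gen_tendsto:
  "(U, V) \<in> gen \<Longrightarrow> ((\<lambda>h. graph_norm S ((1 / h) *\<^sub>R (T h U - U) - V)) \<longlongrightarrow> 0) (at_right 0)"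
  by (simp add: generator_def)

lemma gen_T:
  assumes "(U, V) \<in> gen" "0 \<le> t" shows "(T t U, T t V) \<in> gen"
proof -
  note m = gen_mem[OF assms(1)]
  obtain C where C: "\<And>W. W \<in> X \<Longrightarrow> graph_norm S (T t W) \<le> C * graph_norm S W"
    using T_bound[OF assms(2)] by blast
  let ?W = "\<lambda>h. (1 / h) *\<^sub>R (T h U - U) - V"
  have "((\<lambda>h. graph_norm S ((1 / h) *\<^sub>R (T h (T t U) - T t U) - T t V)) \<longlongrightarrow> 0) (at_right 0)"
  proof (rule Lim_null_comparison)
    show "((\<lambda>h. C * graph_norm S (?W h)) \<longlongrightarrow> 0) (at_right 0)"
      using tendsto_mult_left[OF gen_tendsto[OF assms(1)], of C] by simp
    have "norm (graph_norm S ((1 / h) *\<^sub>R (T h (T t U) - T t U) - T t V)) \<le> C * graph_norm S (?W h)"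
      if h: "0 < h" for h
    proof -
      have Th: "T h U \<in> X" using h m by (intro T_mem) auto
      have "T h (T t U) = T t (T h U)"
        using T_plus[of h t U] T_plus[of t h U] h assms(2) m by (simp add: add.commute)
      then have "(1 / h) *\<^sub>R (T h (T t U) - T t U) - T t V = T t (?W h)"
        using assms(2) m Th by (simp add: T_diff T_scaleR X_diff X_scaleR)
      then show ?thesis
        using C[of "?W h"] m Th by (simp add: graph_norm_nonneg X_diff X_scaleR)
    qed
    then show "\<forall>\<^sub>F h in at_right 0. norm (graph_norm S ((1 / h) *\<^sub>R (T h (T t U) - T t U) - T t V)) \<le> C * graph_norm S (?W h)"
      by (auto simp: eventually_at_filter)
  qed
  then show ?thesis using m assms(2) by (simp add: generator_def T_mem)
qed

text \<open>The generator describes derivatives from the right at time zero. By contractivity the error of the difference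
quotient at a later time is no larger than at time zero. A quotient to the left of \<open>t\<close> is a quotient to the
right of the earlier time \<open>s\<close>; this costs the additional term \<open>T h V - V\<close>, which tends to zero by strong
continuity.\<close>

lemma orbit_derivative:
  assumes "(U, V) \<in> gen" "0 \<le> t"
  shows "((\<lambda>s. E (T s U)) has_vector_derivative E (T t V)) (at t within {0..})"
proof -
  note m = gen_mem[OF assms(1)]
  define r where "r h = norm (E ((1 / h) *\<^sub>R (T h U - U) - V)) + norm (E (T h V - V))" for h
  have r: "(r \<longlongrightarrow> 0) (at_right 0)"
    unfolding r_def
    using tendsto_add[OF tendsto_E_of_graph_norm[OF gen_tendsto[OF assms(1)]] T_continuous_0[OF m(2)]] by simp
  have forward: "norm (E (T (s + h) U) - E (T s U) - h *\<^sub>R E (T s V)) \<le> h * norm (E ((1 / h) *\<^sub>R (T h U - U) - V))"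
    if "0 \<le> s" "0 < h" for s h
  proof -
    have Th: "T h U \<in> X" using that m by (intro T_mem) auto
    let ?W = "(1 / h) *\<^sub>R (T h U - U) - V"
    have W: "?W \<in> X" using Th m by (intro X_diff X_scaleR)
    have "E (T (s + h) U) - E (T s U) - h *\<^sub>R E (T s V) = h *\<^sub>R E (T s ?W)"
    proof -
      have "T s ?W = (1 / h) *\<^sub>R (T (s + h) U - T s U) - T s V"
        using that m Th by (simp add: T_diff T_scaleR X_diff X_scaleR T_plus)
      then have "E (T s ?W) = (1 / h) *\<^sub>R (E (T (s + h) U) - E (T s U)) - E (T s V)"
        using that m by (simp add: E_diff E_scaleR X_diff X_scaleR T_mem)
      then show ?thesis using that by (simp add: scaleR_diff_right)
    qed
    then have "norm (E (T (s + h) U) - E (T s U) - h *\<^sub>R E (T s V)) = h * norm (E (T s ?W))"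
      using that by simp
    also have "\<dots> \<le> h * norm (E ?W)"
      using that T_contraction[OF that(1) W] by (intro mult_left_mono) auto
    finally show ?thesis .
  qed
  have bound: "norm (E (T s U) - E (T t U) - (s - t) *\<^sub>R E (T t V)) / norm (s - t) \<le> r \<bar>s - t\<bar>"
    if s: "0 \<le> s" "s \<noteq> t" for s
  proof (cases "t < s")
    case True
    have "norm (E (T s U) - E (T t U) - (s - t) *\<^sub>R E (T t V)) \<le> (s - t) * norm (E ((1 / (s - t)) *\<^sub>R (T (s - t) U - U) - V))"
      using forward[of t "s - t"] True assms(2) by simp
    also have "\<dots> \<le> (s - t) * r (s - t)" using True by (intro mult_left_mono) (auto simp: r_def)
    finally show ?thesis using True by (simp add: divide_le_eq mult.commute)
  next
    case False
    define h where "h = t - s"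
    have h: "0 < h" "t = s + h" using False s by (auto simp: h_def)
    have Th: "T h V \<in> X" using h m by (intro T_mem) auto
    have "norm (E (T s V) - E (T t V)) = norm (E (T s (T h V - V)))"
      using h s m Th by (simp add: T_plus T_diff E_diff T_mem norm_minus_commute)
    also have "\<dots> \<le> norm (E (T h V - V))"
      using s m Th by (intro T_contraction X_diff)
    finally have 1: "norm (h *\<^sub>R (E (T s V) - E (T t V))) \<le> h * norm (E (T h V - V))"
      using h by simp
    have "E (T s U) - E (T t U) - (s - t) *\<^sub>R E (T t V)
      = - ((E (T (s + h) U) - E (T s U) - h *\<^sub>R E (T s V)) + h *\<^sub>R (E (T s V) - E (T t V)))"
      by (simp add: h(2) scaleR_diff_right)
    then have "norm (E (T s U) - E (T t U) - (s - t) *\<^sub>R E (T t V))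
      \<le> norm (E (T (s + h) U) - E (T s U) - h *\<^sub>R E (T s V)) + norm (h *\<^sub>R (E (T s V) - E (T t V)))"
      by (simp only: norm_minus_cancel norm_triangle_ineq)
    also have "\<dots> \<le> h * r h"
      using forward[OF s(1) h(1)] 1 by (simp add: r_def distrib_left)
    finally show ?thesis using h by (simp add: divide_le_eq mult.commute)
  qed
  have lim: "((\<lambda>s. r \<bar>s - t\<bar>) \<longlongrightarrow> 0) (at t within {0..})"
  proof (rule filterlim_compose[OF r])
    have "((\<lambda>s. \<bar>s - t\<bar>) \<longlongrightarrow> \<bar>t - t\<bar>) (at t within {0..})"
      by (intro tendsto_intros)
    then show "filterlim (\<lambda>s. \<bar>s - t\<bar>) (at_right 0) (at t within {0..})"
      by (auto simp: filterlim_at eventually_at_filter)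
  qed
  have "((\<lambda>s. norm (E (T s U) - E (T t U) - (s - t) *\<^sub>R E (T t V)) / norm (s - t)) \<longlongrightarrow> 0) (at t within {0..})"
    by (rule Lim_null_comparison[OF _ lim]) (use bound in \<open>auto simp: eventually_at_filter\<close>)
  then show ?thesis
    unfolding has_vector_derivative_def has_derivative_iff_norm
    by (simp add: bounded_linear_scaleR_left)
qed

lemma genE:
  assumes "(U, V) \<in> gen"
  obtains u v \<theta> a a' where "U = (u, v, \<theta>)" "V = (v, - a - \<gamma> *\<^sub>R \<theta>, - a' + \<gamma> *\<^sub>R v)"
    "(u, a) \<in> neg_laplacian bc \<Omega>" "v \<in> Domain S" "(\<theta>, a') \<in> neg_laplacian bc' \<Omega>"
  using assms unfolding generator coupled_operator_def by blast

lemma genI: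
  assumes "(u, a) \<in> neg_laplacian bc \<Omega>" "v \<in> Domain S" "(\<theta>, a') \<in> neg_laplacian bc' \<Omega>"
  shows "((u, v, \<theta>), (v, - a - \<gamma> *\<^sub>R \<theta>, - a' + \<gamma> *\<^sub>R v)) \<in> gen"
  using assms unfolding generator coupled_operator_def by blast

definition wave_energy :: "'a state \<Rightarrow> real" where
  "wave_energy U = (norm (op (fst U)))\<^sup>2 + (norm (fst (snd U)))\<^sup>2"

lemma norm_E_sq: "(norm (E U))\<^sup>2 = wave_energy U + (norm (snd (snd U)))\<^sup>2"
  by (cases U) (simp add: E_def wave_energy_def norm_prod_def)

lemma component_derivatives:
  assumes "(U, V) \<in> gen" "0 \<le> t" "T t U = (u, v, \<theta>)" "T t V = (v, v', \<theta>')"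
  shows "((\<lambda>s. op (fst (T s U))) has_vector_derivative op v) (at t within {0..})"
    "((\<lambda>s. fst (snd (T s U))) has_vector_derivative v') (at t within {0..})"
    "((\<lambda>s. snd (snd (T s U))) has_vector_derivative \<theta>') (at t within {0..})"
proof -
  note d = orbit_derivative[OF assms(1,2)]
  note d1 = bounded_linear.has_vector_derivative[OF bounded_linear_fst d]
  note d2 = bounded_linear.has_vector_derivative[OF bounded_linear_snd d]
  note d21 = bounded_linear.has_vector_derivative[OF bounded_linear_fst d2]
  note d22 = bounded_linear.has_vector_derivative[OF bounded_linear_snd d2]
  show "((\<lambda>s. op (fst (T s U))) has_vector_derivative op v) (at t within {0..})"
    using d1 by (simp add: E_def assms(4))
  show "((\<lambda>s. fst (snd (T s U))) has_vector_derivative v') (at t within {0..})"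
    using d21 by (simp add: E_def assms(4))
  show "((\<lambda>s. snd (snd (T s U))) has_vector_derivative \<theta>') (at t within {0..})"
    using d22 by (simp add: E_def assms(4))
qed

text \<open>In the derivative of the wave energy the terms \<open>\<langle>S v, S u\<rangle>\<close> and \<open>\<langle>v, A u\<rangle>\<close> cancel, which leaves the coupling;
in that of the total energy the coupling cancels as well.\<close>

lemma orbitE:
  assumes "(U, V) \<in> gen" "0 \<le> t"
  obtains u v \<theta> a a' where "T t U = (u, v, \<theta>)" "T t V = (v, - a - \<gamma> *\<^sub>R \<theta>, - a' + \<gamma> *\<^sub>R v)"
    "(u, a) \<in> neg_laplacian bc \<Omega>" "v \<in> Domain S" "(\<theta>, a') \<in> neg_laplacian bc' \<Omega>"
    "((\<lambda>s. wave_energy (T s U)) has_real_derivative - 2 * \<gamma> * inner \<theta> v) (at t within {0..})"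
    "((\<lambda>s. (norm (E (T s U)))\<^sup>2) has_real_derivative - 2 * inner a' \<theta>) (at t within {0..})"
    "((\<lambda>s. snd (snd (T s U))) has_vector_derivative - a' + \<gamma> *\<^sub>R v) (at t within {0..})"
proof -
  obtain u v \<theta> a a' where *: "T t U = (u, v, \<theta>)" "T t V = (v, - a - \<gamma> *\<^sub>R \<theta>, - a' + \<gamma> *\<^sub>R v)"
    "(u, a) \<in> neg_laplacian bc \<Omega>" "v \<in> Domain S" "(\<theta>, a') \<in> neg_laplacian bc' \<Omega>"
    by (rule genE[OF gen_T[OF assms]]) (rule that)
  note d = component_derivatives[OF assms *(1,2)]
  have W: "((\<lambda>s. wave_energy (T s U)) has_real_derivative - 2 * \<gamma> * inner \<theta> v) (at t within {0..})"
    unfolding wave_energy_def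
    using DERIV_add[OF has_real_derivative_norm_sq[OF d(1)] has_real_derivative_norm_sq[OF d(2)]]
      inner_op_op[OF *(3,4)]
    by (simp add: *(1) inner_diff_right inner_commute algebra_simps)
  have "((\<lambda>s. (norm (E (T s U)))\<^sup>2) has_real_derivative - 2 * inner a' \<theta>) (at t within {0..})"
    unfolding norm_E_sq
    using DERIV_add[OF W has_real_derivative_norm_sq[OF d(3)]]
    by (simp add: *(1) inner_add_right inner_commute algebra_simps)
  with * W d(3) show ?thesis by (intro that)
qed

lemma zero_neg_laplacian: "(0, 0) \<in> neg_laplacian bc0 \<Omega>"
proof -
  have "partial b (\<lambda>x::'a. 0::complex) = (\<lambda>x. 0)" for b
    by (intro ext) (rule partial_eqI[OF has_derivative_const])
  then have "lap (\<lambda>x::'a. 0) = (\<lambda>x. 0)" by (intro ext) (simp add: lap_def)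
  then show ?thesis
    using test_in_neg_laplacian[OF test_zero open_domain, of bc0] by (simp add: abs_l2_zero)
qed

lemma test_data_gen:
  assumes t: "test_function \<Omega> \<psi>"
  shows "((0, abs_l2 \<psi>, 0), (abs_l2 \<psi>, 0, \<gamma> *\<^sub>R abs_l2 \<psi>)) \<in> gen"
    and "((abs_l2 \<psi>, 0, \<gamma> *\<^sub>R abs_l2 \<psi>),
      (0, abs_l2 (lap \<psi>) - (\<gamma> * \<gamma>) *\<^sub>R abs_l2 \<psi>, \<gamma> *\<^sub>R abs_l2 (lap \<psi>))) \<in> gen"
proof -
  show "((0, abs_l2 \<psi>, 0), (abs_l2 \<psi>, 0, \<gamma> *\<^sub>R abs_l2 \<psi>)) \<in> gen"
    using genI[OF zero_neg_laplacian test_Domain[OF t] zero_neg_laplacian] by simp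
  let ?c = "\<lambda>x. complex_of_real \<gamma> * \<psi> x"
  have c: "test_function \<Omega> ?c" by (rule test_cmult[OF t])
  have "partial b ?c = (\<lambda>x. complex_of_real \<gamma> * partial b \<psi> x)" for b
    by (intro ext partial_cmult test_smooth[OF t])
  moreover have "partial b (\<lambda>x. complex_of_real \<gamma> * partial b \<psi> x) x = complex_of_real \<gamma> * partial b (partial b \<psi>) x" for b x
    by (intro partial_cmult test_smooth[OF test_partial_general[OF t]])
  ultimately have "lap ?c = (\<lambda>x. complex_of_real \<gamma> * lap \<psi> x)"
    by (intro ext) (simp add: lap_def sum_distrib_left)
  then have "abs_l2 (lap ?c) = \<gamma> *\<^sub>R abs_l2 (lap \<psi>)"
    by (simp add: abs_l2_scaleC square_integrable_test[OF test_lap[OF t]] scaleR_l2_def)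
  then have "(\<gamma> *\<^sub>R abs_l2 \<psi>, - (\<gamma> *\<^sub>R abs_l2 (lap \<psi>))) \<in> neg_laplacian bc' \<Omega>"
    using test_in_neg_laplacian[OF c open_domain, of bc']
    by (simp add: abs_l2_scaleC square_integrable_test[OF t] scaleR_l2_def)
  from genI[OF test_in_neg_laplacian[OF t open_domain] Domain_zero this]
  show "((abs_l2 \<psi>, 0, \<gamma> *\<^sub>R abs_l2 \<psi>),
      (0, abs_l2 (lap \<psi>) - (\<gamma> * \<gamma>) *\<^sub>R abs_l2 \<psi>, \<gamma> *\<^sub>R abs_l2 (lap \<psi>))) \<in> gen"
    by simp
qed

end

section \<open>Families of bumps at a given scale\<close>

lemma inner_abs_disjoint:
  assumes "square_integrable F" "square_integrable G" "\<And>x. F x = 0 \<or> G x = 0"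
  shows "inner (abs_l2 F) (abs_l2 G) = 0"
proof -
  have "(\<lambda>x. F x * cnj (G x)) = (\<lambda>x. 0)" using assms(3) by (intro ext) auto
  then show ?thesis by (simp add: inner_abs assms(1,2))
qed

lemma integral_affine:
  fixes g :: "'a::euclidean_space \<Rightarrow> real"
  assumes "g \<in> borel_measurable borel" "0 < c"
  shows "(\<integral>x. g (t + c *\<^sub>R x) \<partial>lborel) = (\<integral>x. g x \<partial>lborel) / c ^ DIM('a)"
proof -
  have "(\<integral>x. g x \<partial>lborel) = (\<integral>x. g x \<partial>density (distr lborel borel (\<lambda>x. t + c *\<^sub>R x)) (\<lambda>_. ennreal (\<bar>c\<bar> ^ DIM('a))))"
    using lborel_affine[of c t] assms(2) by (simp flip: ennreal_power)
  also have "\<dots> = (\<integral>x. \<bar>c\<bar> ^ DIM('a) * g x \<partial>distr lborel borel (\<lambda>x. t + c *\<^sub>R x))"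
    using assms by (subst integral_density) auto
  also have "\<dots> = (\<integral>x. \<bar>c\<bar> ^ DIM('a) * g (t + c *\<^sub>R x) \<partial>lborel)"
    using assms(1) by (subst integral_distr) auto
  finally show ?thesis using assms(2) by simp
qed

lemma norm_scaled_affine:
  fixes F :: "'a::euclidean_space \<Rightarrow> complex"
  assumes "F \<in> borel_measurable borel" "0 < c" "square_integrable (\<lambda>x. a *\<^sub>R F (t + c *\<^sub>R x))" "square_integrable F"
  shows "(norm (abs_l2 (\<lambda>x. a *\<^sub>R F (t + c *\<^sub>R x))))\<^sup>2 = a\<^sup>2 / c ^ DIM('a) * (norm (abs_l2 F))\<^sup>2"
proof -
  have "(\<integral>x. (cmod (F (t + c *\<^sub>R x)))\<^sup>2 \<partial>lborel) = (\<integral>x. (cmod (F x))\<^sup>2 \<partial>lborel) / c ^ DIM('a)"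
    using assms by (intro integral_affine) measurable
  then show ?thesis
    unfolding norm_abs_sq[OF assms(3)] norm_abs_sq[OF assms(4)] norm_scaleR
    by (simp add: power_mult_distrib)
qed

lemma test_affine:
  fixes \<phi> :: "'a::euclidean_space \<Rightarrow> complex"
  assumes "smooth_on UNIV \<phi>" "\<And>x. x \<notin> ball 0 r \<Longrightarrow> \<phi> x = 0" "0 < c" "cball p (r / c) \<subseteq> \<Omega>"
  shows "test_function \<Omega> (\<lambda>x. a *\<^sub>R \<phi> (- c *\<^sub>R p + c *\<^sub>R x))"
    and "x \<notin> cball p (r / c) \<Longrightarrow> a *\<^sub>R \<phi> (- c *\<^sub>R p + c *\<^sub>R x) = 0"
proof -
  have zero: "a *\<^sub>R \<phi> (- c *\<^sub>R p + c *\<^sub>R x) = 0" if "x \<notin> cball p (r / c)" for x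
  proof -
    have "- c *\<^sub>R p + c *\<^sub>R x = c *\<^sub>R (x - p)" by (simp add: algebra_simps)
    then have "norm (- c *\<^sub>R p + c *\<^sub>R x) = c * norm (x - p)" using assms(3) by simp
    moreover have "r / c < norm (x - p)" using that by (simp add: dist_norm norm_minus_commute)
    ultimately have "- c *\<^sub>R p + c *\<^sub>R x \<notin> ball 0 r" using assms(3) by (simp add: field_simps)
    then show ?thesis using assms(2) by simp
  qed
  show "test_function \<Omega> (\<lambda>x. a *\<^sub>R \<phi> (- c *\<^sub>R p + c *\<^sub>R x))"
    by (rule test_functionI[OF smooth_bounded_linear[OF bounded_linear_scaleR_right smooth_affine[OF assms(1)]]
          compact_cball assms(4) zero])
  show "x \<notin> cball p (r / c) \<Longrightarrow> a *\<^sub>R \<phi> (- c *\<^sub>R p + c *\<^sub>R x) = 0" by (rule zero)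
qed

text \<open>The gradient cannot vanish: otherwise \<open>shift_estimate\<close> would make the bump invariant under translations,
although far translates are orthogonal to it.\<close>

lemma base_bump:
  assumes "0 < r"
  obtains \<phi> :: "'a::euclidean_space \<Rightarrow> complex" where
    "smooth_on UNIV \<phi>" "\<And>x. x \<notin> ball 0 r \<Longrightarrow> \<phi> x = 0" "test_function UNIV \<phi>"
    "0 < (\<Sum>b\<in>Basis. (norm (abs_l2 (partial b \<phi>)))\<^sup>2)"
proof -
  define \<phi> where "\<phi> x = complex_of_real (bump (0::'a) r x)" for x
  have sm: "smooth_on UNIV \<phi>" unfolding \<phi>_def[abs_def] by (intro smooth_of_real smooth_bump)
  have zero: "\<phi> x = 0 \<longleftrightarrow> x \<notin> ball 0 r" for x
    using bump_pos_iff[OF assms, of "0::'a" x] bump_nonneg[of "0::'a" r x] by (auto simp: \<phi>_def)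
  have t: "test_function UNIV \<phi>"
    by (rule test_functionI[OF sm compact_cball[of 0 r]]) (use zero in auto)
  note sq = square_integrable_test[OF t]
  have "abs_l2 \<phi> \<noteq> 0"
  proof
    assume "abs_l2 \<phi> = 0"
    then have "AE x in lborel. \<phi> x = 0"
      using sq by (simp add: abs_l2_zero[symmetric] abs_l2_eq_iff square_integrable_zero)
    then have "AE x in lborel. x \<notin> ball (0::'a) r" by (simp add: zero)
    then have "ball (0::'a) r \<in> null_sets lborel"
      by (subst AE_iff_null_sets) simp_all
    then have "emeasure lborel (ball (0::'a) r) = 0" by (rule null_setsD1)
    then show False using assms content_ball_gt_0_iff[of "0::'a" r] by (simp add: measure_def)
  qed
  have "(\<Sum>b\<in>Basis. (norm (abs_l2 (partial b \<phi>)))\<^sup>2) \<noteq> 0"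
  proof
    assume 0: "(\<Sum>b\<in>Basis. (norm (abs_l2 (partial b \<phi>)))\<^sup>2) = 0"
    obtain b :: 'a where b: "b \<in> Basis" using nonempty_Basis by blast
    \<comment> \<open>translating by the diameter of the ball makes the supports disjoint\<close>
    define z where "z = (2 * r) *\<^sub>R b"
    have "norm (shift z (abs_l2 \<phi>) - abs_l2 \<phi>) \<le> norm z * sqrt (\<Sum>b\<in>Basis. (norm (abs_l2 (partial b \<phi>)))\<^sup>2)"
      by (rule shift_estimate) (rule weak_partial_test[OF t])
    then have "shift z (abs_l2 \<phi>) = abs_l2 \<phi>" using 0 by simp
    moreover have "inner (shift z (abs_l2 \<phi>)) (abs_l2 \<phi>) = 0"
      unfolding shift_abs[OF sq]
    proof (rule inner_abs_disjoint[OF square_integrable_shift[OF sq] sq])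
      fix x
      have "x + z \<notin> ball 0 r \<or> x \<notin> ball 0 r"
      proof (rule ccontr)
        assume "\<not> ?thesis"
        then have "norm (x + z) < r" "norm x < r" by auto
        moreover have "norm z \<le> norm (x + z) + norm x" using norm_triangle_ineq4[of "x + z" x] by simp
        ultimately show False using b assms by (simp add: z_def)
      qed
      then show "\<phi> (x + z) = 0 \<or> \<phi> x = 0" by (simp only: zero)
    qed
    ultimately show False using \<open>abs_l2 \<phi> \<noteq> 0\<close> by simp
  qed
  then have "0 < (\<Sum>b\<in>Basis. (norm (abs_l2 (partial b \<phi>)))\<^sup>2)"
    by (simp add: order_less_le sum_nonneg)
  with sm zero t show ?thesis by (intro that[of \<phi>]) auto
qed

text \<open>Translates of one bump, scaled by \<open>1/m\<close> and placed on a cubic grid of mesh \<open>d/m\<close> inside \<open>\<Omega>\<close>. The amplitude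
\<open>s m\<close> is chosen such that the norm of the gradient does not depend on \<open>m\<close>; every derivative then costs one
factor \<open>m\<close>.\<close>

lemma bump_family:
  fixes \<Omega> :: "'a::euclidean_space set"
  assumes "open \<Omega>" "\<Omega> \<noteq> {}"
  obtains B0 B1 B2 and I :: "nat \<Rightarrow> ('a \<Rightarrow> nat) set" and \<psi> :: "nat \<Rightarrow> ('a \<Rightarrow> nat) \<Rightarrow> 'a \<Rightarrow> complex" where
    "0 \<le> B0" "0 < B1" "0 \<le> B2"
    "\<And>m. 0 < m \<Longrightarrow> finite (I m) \<and> card (I m) = m ^ DIM('a)"
    "\<And>m k. 0 < m \<Longrightarrow> k \<in> I m \<Longrightarrow> test_function \<Omega> (\<psi> m k)"
    "\<And>m k. 0 < m \<Longrightarrow> k \<in> I m \<Longrightarrow> (norm (abs_l2 (\<psi> m k)))\<^sup>2 = B0 / (real m)\<^sup>2"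
    "\<And>m k. 0 < m \<Longrightarrow> k \<in> I m \<Longrightarrow> (\<Sum>b\<in>Basis. (norm (abs_l2 (partial b (\<psi> m k))))\<^sup>2) = B1"
    "\<And>m k. 0 < m \<Longrightarrow> k \<in> I m \<Longrightarrow> (norm (abs_l2 (lap (\<psi> m k))))\<^sup>2 = B2 * (real m)\<^sup>2"
    "\<And>m j k. 0 < m \<Longrightarrow> j \<in> I m \<Longrightarrow> k \<in> I m \<Longrightarrow> j \<noteq> k \<Longrightarrow>
      inner (abs_l2 (\<psi> m j)) (abs_l2 (\<psi> m k)) = 0 \<and> inner (abs_l2 (lap (\<psi> m j))) (abs_l2 (\<psi> m k)) = 0"
proof -
  obtain p where "p \<in> \<Omega>" using assms(2) by blast
  then obtain \<rho> where \<rho>: "0 < \<rho>" "cball p \<rho> \<subseteq> \<Omega>" using assms(1) open_contains_cball by blast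
  define d where "d = \<rho> / (real DIM('a) + 1)"
  have d: "0 < d" "d * (real DIM('a) + 1) = \<rho>" using \<rho>(1) by (auto simp: d_def add_nonneg_eq_0_iff)
  obtain \<phi> :: "'a \<Rightarrow> complex" where \<phi>: "smooth_on UNIV \<phi>" "\<And>x. x \<notin> ball 0 (d / 3) \<Longrightarrow> \<phi> x = 0"
    "test_function UNIV \<phi>" "0 < (\<Sum>b\<in>Basis. (norm (abs_l2 (partial b \<phi>)))\<^sup>2)"
    by (rule base_bump[of "d / 3"]) (use d(1) that in auto)
  define I where "I m = PiE (Basis :: 'a set) (\<lambda>_. {..<m})" for m :: nat
  define q where "q m k = p + (d / real m) *\<^sub>R (\<Sum>b\<in>Basis. real (k b) *\<^sub>R b)" for m and k :: "'a \<Rightarrow> nat"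
  \<comment> \<open>scaling by \<open>m\<close> divides the squared norm by \<open>m\<^sup>n\<close>, and the gradient gains a factor \<open>m\<close>\<close>
  define s where "s m = sqrt (real m ^ DIM('a)) / real m" for m
  define \<psi> where "\<psi> m k x = s m *\<^sub>R \<phi> (- real m *\<^sub>R q m k + real m *\<^sub>R x)" for m k x
  have ball_sub: "cball (q m k) (d / 3 / real m) \<subseteq> \<Omega>" if m: "0 < m" "k \<in> I m" for m k
  proof -
    have "norm (\<Sum>b\<in>Basis. real (k b) *\<^sub>R b :: 'a) \<le> (\<Sum>b\<in>(Basis::'a set). real m)"
      by (rule sum_norm_le) (use m in \<open>auto simp: I_def PiE_iff less_imp_le\<close>)
    then have "d / real m * norm (\<Sum>b\<in>Basis. real (k b) *\<^sub>R b :: 'a) \<le> d / real m * (real DIM('a) * real m)"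
      using d(1) by (intro mult_left_mono) auto
    moreover have "dist p (q m k) = d / real m * norm (\<Sum>b\<in>Basis. real (k b) *\<^sub>R b :: 'a)"
      using d(1) by (simp add: q_def dist_norm)
    ultimately have "dist p (q m k) \<le> d / real m * (real DIM('a) * real m)" by simp
    also have "\<dots> = d * real DIM('a)" using m by simp
    finally have "dist p (q m k) \<le> d * real DIM('a)" .
    moreover have "d / 3 / real m \<le> d"
    proof -
      have "d * 1 \<le> d * (3 * real m)" using d(1) m by (intro mult_left_mono) auto
      then show ?thesis using m by (simp add: field_simps)
    qed
    ultimately have "dist p (q m k) + d / 3 / real m \<le> \<rho>" using d(2) by (simp add: distrib_left)
    then have "cball (q m k) (d / 3 / real m) \<subseteq> cball p \<rho>" by (simp add: cball_subset_cball_iff dist_commute)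
    then show ?thesis using \<rho>(2) by blast
  qed
  have disj: "x \<notin> cball (q m j) (d / 3 / real m) \<or> x \<notin> cball (q m k) (d / 3 / real m)"
    if m: "0 < m" "j \<in> I m" "k \<in> I m" "j \<noteq> k" for m j k x
  proof (rule ccontr)
    assume "\<not> ?thesis"
    then have close: "dist (q m j) x \<le> d / 3 / real m" "dist (q m k) x \<le> d / 3 / real m" by auto
    obtain b where b: "b \<in> Basis" "j b \<noteq> k b"
      using m(2-4) PiE_ext[of j Basis "\<lambda>_. {..<m}" k] by (auto simp: I_def)
    have "(q m j - q m k) \<bullet> b = d / real m * (real (j b) - real (k b))"
      using b(1) by (simp add: q_def inner_diff_left inner_add_left inner_sum_left_Basis algebra_simps)
    then have "\<bar>(q m j - q m k) \<bullet> b\<bar> = d / real m * \<bar>real (j b) - real (k b)\<bar>"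
      using d(1) by (simp add: abs_mult)
    also have "\<dots> \<ge> d / real m * 1"
      using b(2) d(1) by (intro mult_left_mono) auto
    finally have "d / real m \<le> dist (q m j) (q m k)"
      using Basis_le_norm[OF b(1), of "q m j - q m k"] by (simp add: dist_norm)
    also have "\<dots> \<le> d / 3 / real m + d / 3 / real m"
      using dist_triangle2[of "q m j" "q m k" x] close by linarith
    also have "\<dots> = 2 / 3 * (d / real m)" by simp
    finally have "d / real m \<le> 2 / 3 * (d / real m)" .
    moreover have "0 < d / real m" using d(1) m(1) by simp
    ultimately show False by linarith
  qed
  have t: "test_function \<Omega> (\<psi> m k)" if "0 < m" "k \<in> I m" for m k
    unfolding \<psi>_def[abs_def]
    by (rule test_affine(1)[OF \<phi>(1,2) _ ball_sub[OF that]]) (use that in auto)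
  have \<psi>_zero: "\<psi> m k x = 0" if "0 < m" "k \<in> I m" "x \<notin> cball (q m k) (d / 3 / real m)" for m k x
    unfolding \<psi>_def
    by (rule test_affine(2)[OF \<phi>(1,2) _ ball_sub[OF that(1,2)] that(3)]) (use that in auto)
  have sm\<phi>: "smooth_on UNIV (\<lambda>x. \<phi> (- real m *\<^sub>R q m k + real m *\<^sub>R x))" for m k
    by (rule smooth_affine[OF \<phi>(1)])
  have p1: "partial b (\<psi> m k) = (\<lambda>x. (s m * real m) *\<^sub>R partial b \<phi> (- real m *\<^sub>R q m k + real m *\<^sub>R x))" for b m k
    unfolding \<psi>_def[abs_def]
    by (intro ext) (simp only: partial_bounded_linear[OF bounded_linear_scaleR_right sm\<phi>] partial_affine[OF \<phi>(1)] scaleR_scaleR)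
  have p2: "lap (\<psi> m k) = (\<lambda>x. (s m * (real m)\<^sup>2) *\<^sub>R lap \<phi> (- real m *\<^sub>R q m k + real m *\<^sub>R x))" for m k
  proof
    fix x
    have "partial b (partial b (\<psi> m k)) x
        = (s m * (real m)\<^sup>2) *\<^sub>R partial b (partial b \<phi>) (- real m *\<^sub>R q m k + real m *\<^sub>R x)" if b: "b \<in> Basis" for b
      unfolding p1[where b = b]
        partial_bounded_linear[OF bounded_linear_scaleR_right smooth_affine[OF smooth_partial[OF \<phi>(1) b]]]
        partial_affine[OF smooth_partial[OF \<phi>(1) b]]
      by (simp add: power2_eq_square)
    then show "lap (\<psi> m k) x = (s m * (real m)\<^sup>2) *\<^sub>R lap \<phi> (- real m *\<^sub>R q m k + real m *\<^sub>R x)"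
      by (simp add: lap_def scaleR_sum_right cong: sum.cong)
  qed
  have s2: "(s m)\<^sup>2 / real m ^ DIM('a) = 1 / (real m)\<^sup>2" if "0 < m" for m
    using that by (simp add: s_def power_divide)
  note sqt = square_integrable_test
  have n0: "(norm (abs_l2 (\<psi> m k)))\<^sup>2 = (norm (abs_l2 \<phi>))\<^sup>2 / (real m)\<^sup>2" if m: "0 < m" "k \<in> I m" for m k
    using norm_scaled_affine[OF smooth_borel[OF \<phi>(1)] _ sqt[OF t[OF m], unfolded \<psi>_def[abs_def]] sqt[OF \<phi>(3)]] m(1)
    by (simp add: s2 \<psi>_def[abs_def])
  have n1: "(\<Sum>b\<in>Basis. (norm (abs_l2 (partial b (\<psi> m k))))\<^sup>2) = (\<Sum>b\<in>Basis. (norm (abs_l2 (partial b \<phi>)))\<^sup>2)"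
    if m: "0 < m" "k \<in> I m" for m k
  proof (rule sum.cong[OF refl])
    fix b :: 'a assume b: "b \<in> Basis"
    have "(norm (abs_l2 (partial b (\<psi> m k))))\<^sup>2 = (s m * real m)\<^sup>2 / real m ^ DIM('a) * (norm (abs_l2 (partial b \<phi>)))\<^sup>2"
      unfolding p1[where b = b]
      by (rule norm_scaled_affine[OF smooth_borel[OF smooth_partial[OF \<phi>(1) b]] _
            sqt[OF test_partial[OF t[OF m] b], unfolded p1[where b = b]] sqt[OF test_partial[OF \<phi>(3) b]]]) (use m in simp)
    also have "(s m * real m)\<^sup>2 / real m ^ DIM('a) = 1"
    proof -
      have "(s m * real m)\<^sup>2 / real m ^ DIM('a) = (s m)\<^sup>2 / real m ^ DIM('a) * (real m)\<^sup>2"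
        by (simp only: power_mult_distrib times_divide_eq_left)
      also have "\<dots> = 1" unfolding s2[OF m(1)] using m(1) by simp
      finally show ?thesis .
    qed
    finally show "(norm (abs_l2 (partial b (\<psi> m k))))\<^sup>2 = (norm (abs_l2 (partial b \<phi>)))\<^sup>2" by simp
  qed
  have n2: "(norm (abs_l2 (lap (\<psi> m k))))\<^sup>2 = (norm (abs_l2 (lap \<phi>)))\<^sup>2 * (real m)\<^sup>2" if m: "0 < m" "k \<in> I m" for m k
  proof -
    have "(norm (abs_l2 (lap (\<psi> m k))))\<^sup>2 = (s m * (real m)\<^sup>2)\<^sup>2 / real m ^ DIM('a) * (norm (abs_l2 (lap \<phi>)))\<^sup>2"
      unfolding p2
      by (rule norm_scaled_affine[OF smooth_borel[OF test_smooth[OF test_lap[OF \<phi>(3)]]] _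
            sqt[OF test_lap[OF t[OF m]], unfolded p2] sqt[OF test_lap[OF \<phi>(3)]]]) (use m in simp)
    also have "(s m * (real m)\<^sup>2)\<^sup>2 / real m ^ DIM('a) = (real m)\<^sup>2"
    proof -
      have "(s m * (real m)\<^sup>2)\<^sup>2 / real m ^ DIM('a) = ((s m)\<^sup>2 / real m ^ DIM('a)) * ((real m)\<^sup>2)\<^sup>2"
        by (simp only: power_mult_distrib times_divide_eq_left)
      also have "\<dots> = (real m)\<^sup>2" unfolding s2[OF m(1)] using m(1) by (simp add: power2_eq_square)
      finally show ?thesis .
    qed
    finally show ?thesis by simp
  qed
  have orth: "inner (abs_l2 (\<psi> m j)) (abs_l2 (\<psi> m k)) = 0 \<and> inner (abs_l2 (lap (\<psi> m j))) (abs_l2 (\<psi> m k)) = 0"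
    if m: "0 < m" "j \<in> I m" "k \<in> I m" "j \<noteq> k" for m j k
  proof -
    let ?K = "\<lambda>k. cball (q m k) (d / 3 / real m)"
    have z1: "partial b (\<psi> m j) x = 0" if "x \<notin> ?K j" for b x
      using partial_zero_outside[of "?K j" "\<psi> m j" x b] \<psi>_zero[OF m(1,2)] that by simp
    have z2: "lap (\<psi> m j) x = 0" if "x \<notin> ?K j" for x
    proof -
      have "partial b (partial b (\<psi> m j)) x = 0" for b
        using partial_zero_outside[of "?K j" "partial b (\<psi> m j)" x b] z1 that by simp
      then show ?thesis unfolding lap_def by (intro sum.neutral) simp
    qed
    show ?thesis
      using disj[OF m] \<psi>_zero[OF m(1,2)] \<psi>_zero[OF m(1,3)] z2
      by (intro conjI inner_abs_disjoint sqt[OF t[OF m(1,2)]] sqt[OF t[OF m(1,3)]] sqt[OF test_lap[OF t[OF m(1,2)]]]) blast+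
  qed
  have I: "finite (I m) \<and> card (I m) = m ^ DIM('a)" for m
    by (simp add: I_def card_PiE finite_PiE)
  show ?thesis
    by (rule that[of "(norm (abs_l2 \<phi>))\<^sup>2" "\<Sum>b\<in>Basis. (norm (abs_l2 (partial b \<phi>)))\<^sup>2"
          "(norm (abs_l2 (lap \<phi>)))\<^sup>2" I \<psi>]) (use \<phi>(4) I t n0 n1 n2 orth in auto)
qed

context coupled_system
begin

lemma T_E_sum:
  assumes "finite J" "\<And>k. k \<in> J \<Longrightarrow> U k \<in> X" "0 \<le> t"
  shows "(\<Sum>k\<in>J. c k *\<^sub>R U k) \<in> X \<and> E (T t (\<Sum>k\<in>J. c k *\<^sub>R U k)) = (\<Sum>k\<in>J. c k *\<^sub>R E (T t (U k)))
    \<and> E (\<Sum>k\<in>J. c k *\<^sub>R U k) = (\<Sum>k\<in>J. c k *\<^sub>R E (U k))"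
  using assms(1,2)
proof (induction J)
  case empty
  have "T t 0 = 0" using T_scaleR[OF assms(3) X_zero, of 0] by simp
  then show ?case by (simp add: X_zero E_zero)
next
  case (insert k J)
  then have U: "U k \<in> X" and IH: "(\<Sum>k\<in>J. c k *\<^sub>R U k) \<in> X"
    "E (T t (\<Sum>k\<in>J. c k *\<^sub>R U k)) = (\<Sum>k\<in>J. c k *\<^sub>R E (T t (U k)))"
    "E (\<Sum>k\<in>J. c k *\<^sub>R U k) = (\<Sum>k\<in>J. c k *\<^sub>R E (U k))" by auto
  show ?case
    using insert.hyps assms(3) U IH
    by (simp add: X_add X_scaleR T_add T_scaleR E_add E_scaleR T_mem)
qed

text \<open>The orbits of orthogonal states need not stay orthogonal, but they inherit the Bessel inequality: apply the
contraction to the linear combination whose coefficients are the inner products in question.\<close>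

lemma bessel:
  assumes "finite J" "\<And>k. k \<in> J \<Longrightarrow> U k \<in> X" "0 \<le> t" "0 \<le> e"
    and orth: "\<And>j k. j \<in> J \<Longrightarrow> k \<in> J \<Longrightarrow> inner (E (U j)) (E (U k)) = (if j = k then e else 0)"
  shows "(\<Sum>k\<in>J. (inner (E (T t (U k))) F)\<^sup>2) \<le> e * (norm F)\<^sup>2"
proof -
  define c where "c k = inner (E (T t (U k))) F" for k
  define L where "L = (\<Sum>k\<in>J. c k *\<^sub>R U k)"
  define s where "s = (\<Sum>k\<in>J. (c k)\<^sup>2)"
  have L: "L \<in> X \<and> E (T t L) = (\<Sum>k\<in>J. c k *\<^sub>R E (T t (U k))) \<and> E L = (\<Sum>k\<in>J. c k *\<^sub>R E (U k))"
    unfolding L_def by (rule T_E_sum[OF assms(1) _ assms(3)]) (rule assms(2))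
  have "s = inner (E (T t L)) F"
    using L by (simp add: s_def inner_sum_left power2_eq_square c_def)
  also have "\<dots> \<le> norm (E (T t L)) * norm F" by (rule norm_cauchy_schwarz)
  also have "\<dots> \<le> norm (E L) * norm F"
    by (intro mult_right_mono T_contraction[OF assms(3) conjunct1[OF L]]) simp
  finally have "s \<le> norm (E L) * norm F" .
  moreover have "0 \<le> s" by (simp add: s_def sum_nonneg)
  ultimately have "s\<^sup>2 \<le> (norm (E L) * norm F)\<^sup>2" by (intro power_mono)
  also have "(norm (E L))\<^sup>2 = e * s"
  proof -
    have "(norm (E L))\<^sup>2 = (\<Sum>j\<in>J. \<Sum>k\<in>J. c j * (c k * inner (E (U k)) (E (U j))))"
      using L by (simp add: power2_norm_eq_inner inner_sum_left inner_sum_right sum_distrib_left)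
    also have "\<dots> = (\<Sum>j\<in>J. \<Sum>k\<in>J. if k = j then c j * (c j * e) else 0)"
      using orth by (intro sum.cong refl) auto
    also have "\<dots> = (\<Sum>j\<in>J. c j * (c j * e))"
      using assms(1) by (simp add: sum.delta)
    finally show ?thesis by (simp add: s_def sum_distrib_left power2_eq_square mult_ac)
  qed
  then have "(norm (E L) * norm F)\<^sup>2 = s * (e * (norm F)\<^sup>2)" by (simp add: power_mult_distrib)
  finally have "s * s \<le> s * (e * (norm F)\<^sup>2)" by (simp add: power2_eq_square)
  then have "s \<le> e * (norm F)\<^sup>2"
    using \<open>0 \<le> s\<close> assms(4) by (cases "s = 0") auto
  then show ?thesis by (simp add: s_def c_def)
qed

lemma half_time:
  assumes "exponentially_stable X (state_norm S) T"
  obtains t where "0 < t" "\<And>U. U \<in> X \<Longrightarrow> norm (E (T t U)) \<le> norm (E U) / 2"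
proof -
  obtain \<omega> M where s: "0 < \<omega>" "1 \<le> M" "\<And>t U. 0 < t \<Longrightarrow> U \<in> X \<Longrightarrow> norm (E (T t U)) \<le> M * exp (- \<omega> * t) * norm (E U)"
    using assms unfolding exponentially_stable_def state_norm_eq by blast
  define t where "t = ln (2 * M) / \<omega>"
  have "0 < t" using s by (simp add: t_def)
  moreover have "exp (- \<omega> * t) = 1 / (2 * M)" using s by (simp add: t_def exp_minus inverse_eq_divide)
  ultimately show ?thesis using s(2) s(3)[of t] by (intro that[of t]) auto
qed

lemma E_test_data:
  assumes "test_function \<Omega> \<phi>" "test_function \<Omega> \<psi>"
  shows "inner (E (abs_l2 \<phi>, 0, \<gamma> *\<^sub>R abs_l2 \<phi>)) (E (abs_l2 \<psi>, 0, \<gamma> *\<^sub>R abs_l2 \<psi>))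
    = - inner (abs_l2 (lap \<phi>)) (abs_l2 \<psi>) + \<gamma>\<^sup>2 * inner (abs_l2 \<phi>) (abs_l2 \<psi>)"
  using inner_op_op[OF test_in_neg_laplacian[OF assms(1) open_domain] test_Domain[OF assms(2)]]
  by (simp add: E_def power2_eq_square)

lemma norm_E_test_data:
  assumes "test_function \<Omega> \<psi>"
  shows "(norm (E (abs_l2 \<psi>, 0, \<gamma> *\<^sub>R abs_l2 \<psi>)))\<^sup>2
    = (\<Sum>b\<in>Basis. (norm (abs_l2 (partial b \<psi>)))\<^sup>2) + \<gamma>\<^sup>2 * (norm (abs_l2 \<psi>))\<^sup>2"
  using E_test_data[OF assms assms] norm_gradient_test[OF assms] by (simp add: power2_norm_eq_inner)

section \<open>Heat operators with a controlling form\<close>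

text \<open>Young's inequality splits the coupling into a multiple of the dissipation \<open>\<langle>A' \<theta>, \<theta>\<rangle>\<close> and a multiple of
\<open>|E Z|\<^sup>2\<close>. Subtracting a quarter of the total energy from the wave energy compensates the dissipation, so
that the difference decreases at most linearly with a small slope.\<close>

lemma energy_estimate:
  assumes form: "\<And>\<theta> a' q a. (\<theta>, a') \<in> neg_laplacian bc' \<Omega> \<Longrightarrow> (q, a) \<in> neg_laplacian bc \<Omega> \<Longrightarrow>
      0 \<le> inner a' \<theta> \<and> \<bar>inner \<theta> a\<bar> \<le> sqrt (inner a' \<theta>) * norm (op q)"
    and "(Z, U) \<in> gen" "(U, V) \<in> gen" "0 \<le> t"
  shows "wave_energy U - (norm (E U))\<^sup>2 / 4 - 2 * \<gamma>\<^sup>2 * ((norm (E Z))\<^sup>2 + norm (E U) * norm (E Z)) * t \<le> (norm (E (T t U)))\<^sup>2"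
proof -
  note m = gen_mem(1)[OF assms(2)] gen_mem(1)[OF assms(3)]
  define z where "z = norm (E Z)"
  define e where "e = norm (E U)"
  define c where "c = 2 * \<gamma>\<^sup>2 * (z\<^sup>2 + e * z)"
  let ?G = "\<lambda>t. wave_energy (T t U) - 1 / 4 * (norm (E (T t U)))\<^sup>2"
  have "?G 0 - c * t \<le> ?G t"
  proof (rule increment_ge[OF assms(4)])
    fix s :: real assume s: "0 \<le> s"
    obtain u v \<theta> a a' where U: "T s U = (u, v, \<theta>)" "(\<theta>, a') \<in> neg_laplacian bc' \<Omega>"
      and W: "((\<lambda>s. wave_energy (T s U)) has_real_derivative - 2 * \<gamma> * inner \<theta> v) (at s within {0..})"
      and N: "((\<lambda>s. (norm (E (T s U)))\<^sup>2) has_real_derivative - 2 * inner a' \<theta>) (at s within {0..})"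
      by (rule orbitE[OF assms(3) s]) (rule that)
    obtain z1 z2 z3 b b' where Z: "T s Z = (z1, z2, z3)" "T s U = (z2, - b - \<gamma> *\<^sub>R z3, - b' + \<gamma> *\<^sub>R z2)"
      "(z1, b) \<in> neg_laplacian bc \<Omega>"
      by (rule genE[OF gen_T[OF assms(2) s]]) (rule that)
    have v: "v = - b - \<gamma> *\<^sub>R z3" using U(1) Z(2) by simp
    define D where "D = inner a' \<theta>"
    note f = form[OF U(2) Z(3), folded D_def]
    have "(norm (op z1))\<^sup>2 + (norm z2)\<^sup>2 + (norm z3)\<^sup>2 \<le> z\<^sup>2"
      using T_contraction[OF s m(1)] power_mono[of "norm (E (T s Z))" z 2]
      by (simp add: norm_E_sq wave_energy_def Z(1) z_def)
    then have z13_sq: "(norm (op z1))\<^sup>2 \<le> z\<^sup>2" "(norm z3)\<^sup>2 \<le> z\<^sup>2"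
      using zero_le_power2[of "norm (op z1)"] zero_le_power2[of "norm z2"] zero_le_power2[of "norm z3"] by linarith+
    have "0 \<le> z" "0 \<le> e" by (simp_all add: z_def e_def)
    note z13 = z13_sq[THEN power2_le_imp_le, OF \<open>0 \<le> z\<close>]
    have "(norm (op u))\<^sup>2 + (norm v)\<^sup>2 + (norm \<theta>)\<^sup>2 \<le> e\<^sup>2"
      using T_contraction[OF s m(2)] power_mono[of "norm (E (T s U))" e 2]
      by (simp add: norm_E_sq wave_energy_def U(1) e_def)
    then have "(norm \<theta>)\<^sup>2 \<le> e\<^sup>2"
      using zero_le_power2[of "norm (op u)"] zero_le_power2[of "norm v"] by linarith
    then have \<theta>e: "norm \<theta> \<le> e" using \<open>0 \<le> e\<close> by (rule power2_le_imp_le)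
    have "\<bar>inner \<theta> v\<bar> \<le> \<bar>inner \<theta> b\<bar> + \<bar>\<gamma>\<bar> * \<bar>inner \<theta> z3\<bar>"
      unfolding v using abs_triangle_ineq4[of "- inner \<theta> b" "\<gamma> * inner \<theta> z3"]
      by (simp add: inner_diff_right abs_mult)
    also have "\<dots> \<le> sqrt D * z + \<bar>\<gamma>\<bar> * (e * z)"
    proof (intro add_mono mult_left_mono)
      show "\<bar>inner \<theta> b\<bar> \<le> sqrt D * z"
        using f z13(1) mult_left_mono[of "norm (op z1)" z "sqrt D"] by simp
      have "\<bar>inner \<theta> z3\<bar> \<le> norm \<theta> * norm z3" by (rule Cauchy_Schwarz_ineq2)
      also have "\<dots> \<le> e * z" using \<theta>e z13(2) by (intro mult_mono) (auto simp: e_def)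
      finally show "\<bar>inner \<theta> z3\<bar> \<le> e * z" .
    qed simp
    finally have "2 * \<bar>\<gamma>\<bar> * \<bar>inner \<theta> v\<bar> \<le> 2 * \<bar>\<gamma>\<bar> * (sqrt D * z + \<bar>\<gamma>\<bar> * (e * z))"
      by (rule mult_left_mono) simp
    also have "\<dots> = sqrt D * (2 * \<bar>\<gamma>\<bar> * z) + 2 * \<gamma>\<^sup>2 * (e * z)"
      by (simp add: algebra_simps power2_eq_square)
    also have "sqrt D * (2 * \<bar>\<gamma>\<bar> * z) \<le> (D + 4 * \<gamma>\<^sup>2 * z\<^sup>2) / 2"
      using sum_squares_bound[of "sqrt D" "2 * \<bar>\<gamma>\<bar> * z"] f by (simp add: power_mult_distrib)
    also have "(D + 4 * \<gamma>\<^sup>2 * z\<^sup>2) / 2 + 2 * \<gamma>\<^sup>2 * (e * z) = D / 2 + c"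
      by (simp add: c_def field_simps)
    finally have est: "2 * \<bar>\<gamma>\<bar> * \<bar>inner \<theta> v\<bar> \<le> D / 2 + c" by simp
    have "2 * \<gamma> * inner \<theta> v \<le> \<bar>2 * \<gamma> * inner \<theta> v\<bar>" by (rule abs_ge_self)
    then have "- c \<le> - 2 * \<gamma> * inner \<theta> v - 1 / 4 * (- 2 * inner a' \<theta>)"
      using est by (simp add: abs_mult D_def)
    moreover have "(?G has_real_derivative - 2 * \<gamma> * inner \<theta> v - 1 / 4 * (- 2 * inner a' \<theta>)) (at s within {0..})"
      by (rule DERIV_diff[OF W DERIV_cmult[OF N]])
    ultimately show "\<exists>D. (?G has_real_derivative D) (at s within {0..}) \<and> - c \<le> D"
      by blast
  qed
  moreover have "wave_energy (T t U) \<le> (norm (E (T t U)))\<^sup>2" by (simp add: norm_E_sq)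
  moreover have "0 \<le> (norm (E (T t U)))\<^sup>2" by simp
  ultimately show ?thesis
    unfolding T_0[OF m(2)] c_def z_def e_def by linarith
qed

lemma not_exponentially_stable_of_form_bound:
  assumes form: "\<And>\<theta> a' q a. (\<theta>, a') \<in> neg_laplacian bc' \<Omega> \<Longrightarrow> (q, a) \<in> neg_laplacian bc \<Omega> \<Longrightarrow>
      0 \<le> inner a' \<theta> \<and> \<bar>inner \<theta> a\<bar> \<le> sqrt (inner a' \<theta>) * norm (op q)"
    and "\<Omega> \<noteq> {}"
  shows "\<not> exponentially_stable X (state_norm S) T"
proof
  assume "exponentially_stable X (state_norm S) T"
  then obtain t where t: "0 < t" "\<And>U. U \<in> X \<Longrightarrow> norm (E (T t U)) \<le> norm (E U) / 2"
    by (rule half_time) (rule that)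
  obtain B0 B1 B2 and I :: "nat \<Rightarrow> ('a \<Rightarrow> nat) set" and \<psi> where B: "0 \<le> B0" "0 < B1"
    and I: "\<And>m. 0 < m \<Longrightarrow> finite (I m) \<and> card (I m) = m ^ DIM('a)"
    and test: "\<And>m k. 0 < m \<Longrightarrow> k \<in> I m \<Longrightarrow> test_function \<Omega> (\<psi> m k)"
    and n0: "\<And>m k. 0 < m \<Longrightarrow> k \<in> I m \<Longrightarrow> (norm (abs_l2 (\<psi> m k)))\<^sup>2 = B0 / (real m)\<^sup>2"
    and n1: "\<And>m k. 0 < m \<Longrightarrow> k \<in> I m \<Longrightarrow> (\<Sum>b\<in>Basis. (norm (abs_l2 (partial b (\<psi> m k))))\<^sup>2) = B1"
    by (rule bump_family[OF open_domain assms(2)]) (rule that)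
  define x where "x m = inverse (real (Suc m))" for m
  have x0: "x \<longlonglongrightarrow> 0" unfolding x_def[abs_def] by (rule LIMSEQ_inverse_real_of_nat)
  define e where "e m = B1 + \<gamma>\<^sup>2 * (B0 * (x m)\<^sup>2)" for m
  have main: "B1 \<le> e m / 2 + 2 * \<gamma>\<^sup>2 * (B0 * (x m)\<^sup>2 + sqrt (e m) * (sqrt B0 * x m)) * t" for m
  proof -
    have "I (Suc m) \<noteq> {}" using I[of "Suc m"] by auto
    then obtain k where k: "k \<in> I (Suc m)" by blast
    let ?\<psi> = "\<psi> (Suc m) k"
    let ?Z = "(0, abs_l2 ?\<psi>, 0)" and ?U = "(abs_l2 ?\<psi>, 0, \<gamma> *\<^sub>R abs_l2 ?\<psi>)"
    have tf: "test_function \<Omega> ?\<psi>" using test k by simp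
    note g = test_data_gen[OF tf]
    have nsq: "(norm (abs_l2 ?\<psi>))\<^sup>2 = B0 * (x m)\<^sup>2"
      using n0[OF _ k] by (simp add: x_def power_inverse divide_inverse)
    have "op 0 = 0" using op_scaleR[OF Domain_zero, of 0] by simp
    then have nZ: "norm (E ?Z) = norm (abs_l2 ?\<psi>)" by (simp add: E_def norm_prod_def)
    have "norm (abs_l2 ?\<psi>) = sqrt ((norm (abs_l2 ?\<psi>))\<^sup>2)" by simp
    also have "\<dots> = sqrt B0 * x m" unfolding nsq by (simp add: real_sqrt_mult x_def)
    finally have nZ': "norm (abs_l2 ?\<psi>) = sqrt B0 * x m" .
    have eU: "(norm (E ?U))\<^sup>2 = e m"
      using norm_E_test_data[OF tf] n1[OF _ k] nsq by (simp add: e_def)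
    then have nU: "norm (E ?U) = sqrt (e m)" by (metis norm_ge_zero real_sqrt_unique)
    have W: "wave_energy ?U = B1"
      using norm_op_test[OF tf] n1[OF _ k] by (simp add: wave_energy_def)
    have "(norm (E (T t ?U)))\<^sup>2 \<le> (norm (E ?U) / 2)\<^sup>2"
      using t(2)[OF gen_mem(1)[OF g(2)]] by (intro power_mono) auto
    also have "\<dots> = e m / 4" using eU by (simp add: power_divide)
    finally have "(norm (E (T t ?U)))\<^sup>2 \<le> e m / 4" .
    moreover have "wave_energy ?U - (norm (E ?U))\<^sup>2 / 4 - 2 * \<gamma>\<^sup>2 * ((norm (E ?Z))\<^sup>2 + norm (E ?U) * norm (E ?Z)) * t \<le> (norm (E (T t ?U)))\<^sup>2"
      using t(1) by (intro energy_estimate[OF form g]) auto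
    ultimately show ?thesis
      unfolding W eU unfolding nZ nU unfolding nsq unfolding nZ' by linarith
  qed
  have "(\<lambda>m. e m / 2 + 2 * \<gamma>\<^sup>2 * (B0 * (x m)\<^sup>2 + sqrt (e m) * (sqrt B0 * x m)) * t)
      \<longlonglongrightarrow> (B1 + \<gamma>\<^sup>2 * (B0 * 0\<^sup>2)) / 2 + 2 * \<gamma>\<^sup>2 * (B0 * 0\<^sup>2 + sqrt (B1 + \<gamma>\<^sup>2 * (B0 * 0\<^sup>2)) * (sqrt B0 * 0)) * t"
    unfolding e_def by (intro tendsto_intros x0) simp_all
  then have "B1 \<le> (B1 + \<gamma>\<^sup>2 * (B0 * 0\<^sup>2)) / 2 + 2 * \<gamma>\<^sup>2 * (B0 * 0\<^sup>2 + sqrt (B1 + \<gamma>\<^sup>2 * (B0 * 0\<^sup>2)) * (sqrt B0 * 0)) * t"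
    by (rule LIMSEQ_le_const) (use main in auto)
  then show False using B(2) by simp
qed


end

section \<open>Dirichlet waves coupled to Neumann heat\<close>

lemma gradient_multiplier_bound:
  fixes \<eta> :: "'a::euclidean_space \<Rightarrow> real"
  assumes cut: "cutoff \<Omega> \<eta>"
  obtains C where "0 \<le> C" "\<And>\<theta>. (\<Sum>b\<in>Basis. (norm (mul (partial b \<eta>) \<theta>))\<^sup>2) \<le> C * (norm \<theta>)\<^sup>2"
proof -
  obtain K where K: "compact K" "\<And>x. x \<notin> K \<Longrightarrow> \<eta> x = 0"
    by (rule cutoffE[OF cut]) (rule that)
  have "\<exists>C. \<forall>x. \<bar>partial b \<eta> x\<bar> \<le> C" and bm: "bounded_borel (partial b \<eta>)" if b: "b \<in> Basis" for b
  proof -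
    have "partial b \<eta> x = 0" if "x \<notin> K" for x
      using partial_zero_outside[of K \<eta> x b] K that by simp
    then show "bounded_borel (partial b \<eta>)"
      using bounded_borel_smooth_supported[OF smooth_partial[OF cutoffD(1)[OF cut] b] K(1)] by blast
    then show "\<exists>C. \<forall>x. \<bar>partial b \<eta> x\<bar> \<le> C" by (metis bounded_borelE)
  qed
  then obtain c where c: "\<And>b x. b \<in> Basis \<Longrightarrow> \<bar>partial b \<eta> x\<bar> \<le> c b" by metis
  show ?thesis
  proof (rule that[of "\<Sum>b\<in>Basis. (c b)\<^sup>2"])
    show "(\<Sum>b\<in>Basis. (norm (mul (partial b \<eta>) \<theta>))\<^sup>2) \<le> (\<Sum>b\<in>Basis. (c b)\<^sup>2) * (norm \<theta>)\<^sup>2" for \<theta>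
      unfolding sum_distrib_right
    proof (rule sum_mono)
      fix b :: 'a assume b: "b \<in> Basis"
      have "(norm (mul (partial b \<eta>) \<theta>))\<^sup>2 \<le> (c b * norm \<theta>)\<^sup>2"
        by (intro power_mono norm_mul_le bm[OF b] c[OF b]) simp
      then show "(norm (mul (partial b \<eta>) \<theta>))\<^sup>2 \<le> (c b)\<^sup>2 * (norm \<theta>)\<^sup>2" by (simp only: power_mult_distrib)
    qed
  qed (simp add: sum_nonneg)
qed

context coupled_system
begin

lemma orbit_projections:
  assumes "(U, V) \<in> gen" "0 \<le> s"
  shows "\<exists>a'. (snd (snd (T s U)), a') \<in> neg_laplacian bc' \<Omega> \<and>
    ((\<lambda>s. wave_energy (T s U)) has_real_derivative - 2 * \<gamma> * inner (snd (snd (T s U))) (fst (snd (T s U)))) (at s within {0..}) \<and>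
    ((\<lambda>s. snd (snd (T s U))) has_vector_derivative - a' + \<gamma> *\<^sub>R fst (snd (T s U))) (at s within {0..})"
    and "fst (T s V) = fst (snd (T s U))"
proof -
  obtain u v \<theta> a a' where *: "T s U = (u, v, \<theta>)" "T s V = (v, - a - \<gamma> *\<^sub>R \<theta>, - a' + \<gamma> *\<^sub>R v)"
    "(\<theta>, a') \<in> neg_laplacian bc' \<Omega>"
    "((\<lambda>s. wave_energy (T s U)) has_real_derivative - 2 * \<gamma> * inner \<theta> v) (at s within {0..})"
    "((\<lambda>s. snd (snd (T s U))) has_vector_derivative - a' + \<gamma> *\<^sub>R v) (at s within {0..})"
    by (rule orbitE[OF assms]) (rule that)
  show "\<exists>a'. (snd (snd (T s U)), a') \<in> neg_laplacian bc' \<Omega> \<and>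
    ((\<lambda>s. wave_energy (T s U)) has_real_derivative - 2 * \<gamma> * inner (snd (snd (T s U))) (fst (snd (T s U)))) (at s within {0..}) \<and>
    ((\<lambda>s. snd (snd (T s U))) has_vector_derivative - a' + \<gamma> *\<^sub>R fst (snd (T s U))) (at s within {0..})"
    using *(3-5) by (intro exI[of _ a']) (simp add: *(1))
  show "fst (T s V) = fst (snd (T s U))" by (simp add: *(1,2))
qed

lemma test_orbit_twice:
  assumes t: "test_function \<Omega> \<psi>"
  shows "\<exists>Y. ((0, abs_l2 (lap \<psi>) - (\<gamma> * \<gamma>) *\<^sub>R abs_l2 \<psi>, \<gamma> *\<^sub>R abs_l2 (lap \<psi>)), Y) \<in> gen"
proof -
  have l: "test_function \<Omega> (lap \<psi>)" by (rule test_lap[OF t])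
  have "abs_l2 (lap \<psi>) + (- (\<gamma> * \<gamma>)) *\<^sub>R abs_l2 \<psi> \<in> Domain S"
    by (intro Domain_add) (simp_all only: scaleR_l2_def Domain_scaleC test_Domain[OF l] test_Domain[OF t])
  then have "abs_l2 (lap \<psi>) - (\<gamma> * \<gamma>) *\<^sub>R abs_l2 \<psi> \<in> Domain S" by simp
  moreover have "\<exists>a'. (\<gamma> *\<^sub>R abs_l2 (lap \<psi>), a') \<in> neg_laplacian bc' \<Omega>"
    using test_in_neg_laplacian[OF test_cmult[OF l, of "complex_of_real \<gamma>"] open_domain, of bc']
    by (auto simp: abs_l2_scaleC square_integrable_test[OF l] scaleR_l2_def)
  ultimately show ?thesis using genI[OF zero_neg_laplacian] by blast
qed

text \<open>The sum of the wave energies of a family of orbits, with the coupling split by the cutoff \<open>\<eta>\<close> into a part near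
the boundary and one in the interior. Near the boundary \<open>concentration_bound\<close> limits the velocities; in the
interior it limits \<open>\<eta> \<theta>\<close> in terms of the gradient of \<open>\<eta> \<theta>\<close>, which is compensated by subtracting a small
multiple \<open>\<kappa>\<close> of the sum of \<open>|\<eta> \<theta>|\<^sup>2\<close> from the wave energies.\<close>

lemma summed_estimate:
  assumes bcs: "bc = Dirichlet" "bc' = Neumann" and "bounded \<Omega>"
    and cut: "cutoff \<Omega> \<eta>"
    and C: "0 \<le> C" "\<And>\<theta>. (\<Sum>b\<in>Basis. (norm (mul (partial b \<eta>) \<theta>))\<^sup>2) \<le> C * (norm \<theta>)\<^sup>2"
    and J: "finite J"
    and gens: "\<And>k. k \<in> J \<Longrightarrow> (U k, V k) \<in> gen" "\<And>k. k \<in> J \<Longrightarrow> (V k, Y k) \<in> gen"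
    and orth: "\<And>j k. j \<in> J \<Longrightarrow> k \<in> J \<Longrightarrow> inner (E (U j)) (E (U k)) = (if j = k then e else 0)" and "0 \<le> e"
    and VL: "\<And>k. k \<in> J \<Longrightarrow> norm (E (V k)) \<le> \<Lambda>"
    and pos: "0 < \<epsilon>" "0 < h" "0 < \<sigma>" "0 \<le> t"
    and W0: "\<And>k. k \<in> J \<Longrightarrow> wave_energy (U k) = B"
    and half: "\<And>k. k \<in> J \<Longrightarrow> (norm (E (T t (U k))))\<^sup>2 \<le> e / 4"
  defines "N \<equiv> real (card J)"
    and "\<delta> \<equiv> \<integral>x. (indicat_real \<Omega> x * (1 - \<eta> x))\<^sup>2 \<partial>lborel"
    and "\<beta> \<equiv> \<lambda>r. measure lborel (ball (0::'a) r)"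
  defines "layer \<equiv> 2 * (N * (\<epsilon> * \<Lambda>)\<^sup>2) + 4 * e * \<delta> / \<beta> \<epsilon>" and "core \<equiv> 4 * e * measure lborel \<Omega> / \<beta> h"
    and "\<kappa> \<equiv> \<bar>\<gamma>\<bar> * h\<^sup>2 / \<sigma>"
  shows "N * B \<le> N * e / 4 + \<kappa> * (N * e)
    + (\<bar>\<gamma>\<bar> * (2 * \<sigma> * (N * e) + layer / \<sigma> + core / \<sigma>) + \<kappa> * ((2 * C + 2 * \<bar>\<gamma>\<bar>) * (N * e))) * t"
proof -
  have \<Omega>[measurable]: "\<Omega> \<in> sets borel" using open_domain by simp
  have \<Omega>_fin: "emeasure lborel \<Omega> < \<infinity>" using assms(3) by (rule emeasure_bounded_finite)
  define w where "w x = indicat_real \<Omega> x * (1 - \<eta> x)" for x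
  have \<kappa>: "0 \<le> \<kappa>" using pos by (simp add: \<kappa>_def)
  note \<eta> = cutoffD(2,3)[OF cut]
  have \<eta>b[measurable]: "\<eta> \<in> borel_measurable borel" by (rule smooth_borel[OF cutoffD(1)[OF cut]])
  have bm: "bounded_borel \<eta>" using \<eta> by (intro bounded_borelI[of _ 1]) auto
  have w: "w \<in> borel_measurable borel" "\<And>x. 0 \<le> w x" "\<And>x. w x \<le> 1"
    unfolding w_def[abs_def] using \<eta> by (auto simp: indicator_def)
  have bw: "bounded_borel w" using w by (intro bounded_borelI[of _ 1]) auto
  have int_\<Omega>: "integrable lborel (indicat_real \<Omega>)" using \<Omega>_fin by simp
  have int_w: "integrable lborel (\<lambda>x. (w x)\<^sup>2)"
  proof (rule Bochner_Integration.integrable_bound[OF int_\<Omega>])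
    have "(w x)\<^sup>2 \<le> indicat_real \<Omega> x" for x
      using \<eta>[of x] by (auto simp: w_def indicator_def power_le_one)
    then show "AE x in lborel. norm ((w x)\<^sup>2) \<le> norm (indicat_real \<Omega> x)" by simp
  qed (use w(1) in measurable)
  have norm_\<eta>: "norm (mul \<eta> f) \<le> norm f" for f
    using norm_mul_le[OF bm, of 1 f] \<eta> by simp
  have split: "f = mul w f + mul \<eta> f" if "f \<in> L2 \<Omega>" for f
  proof -
    have "(\<lambda>x. w x + \<eta> x) = indicat_real \<Omega>"
    proof
      fix x show "w x + \<eta> x = indicat_real \<Omega> x"
        using cutoffD(4)[OF cut] by (cases "x \<in> \<Omega>") (auto simp: w_def)
    qed
    then show ?thesis
      using mul_add_left[OF bw bm, of f] mul_L2_eq_self[OF that \<Omega>] by simp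
  qed
  note UX = gen_mem(1)[OF gens(1)]
  have normU: "(norm (E (U k)))\<^sup>2 = e" if "k \<in> J" for k
    using orth[OF that that] by (simp add: power2_norm_eq_inner)
  define v where "v s k = fst (snd (T s (U k)))" for s k
  define \<theta> where "\<theta> s k = snd (snd (T s (U k)))" for s k
  have v\<theta>: "(norm (v s k))\<^sup>2 \<le> e" "(norm (\<theta> s k))\<^sup>2 \<le> e" "v s k \<in> L2 \<Omega>" "\<theta> s k \<in> L2 \<Omega>"
    if s: "0 \<le> s" and k: "k \<in> J" for s k
  proof -
    have "(norm (E (T s (U k))))\<^sup>2 \<le> (norm (E (U k)))\<^sup>2"
      by (intro power_mono T_contraction[OF s UX[OF k]]) simp
    then have "(norm (E (T s (U k))))\<^sup>2 \<le> e" by (simp only: normU[OF k])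
    then have "(norm (op (fst (T s (U k)))))\<^sup>2 + (norm (v s k))\<^sup>2 + (norm (\<theta> s k))\<^sup>2 \<le> e"
      by (simp add: norm_E_sq wave_energy_def v_def \<theta>_def)
    then show "(norm (v s k))\<^sup>2 \<le> e" "(norm (\<theta> s k))\<^sup>2 \<le> e"
      using zero_le_power2[of "norm (op (fst (T s (U k))))"] zero_le_power2[of "norm (v s k)"]
        zero_le_power2[of "norm (\<theta> s k)"] by linarith+
    show "v s k \<in> L2 \<Omega>" "\<theta> s k \<in> L2 \<Omega>"
      using T_mem[OF s UX[OF k]] by (auto simp: v_def \<theta>_def state_space_def)
  qed
  have bessel_v: "(\<Sum>k\<in>J. (inner (v s k) g)\<^sup>2) \<le> e * (norm g)\<^sup>2" if s: "0 \<le> s" for s g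
    using bessel[OF J UX s \<open>0 \<le> e\<close> orth, of "(0, g, 0)"]
    by (simp add: E_def inner_prod_def norm_prod_def v_def)
  have bessel_\<theta>: "(\<Sum>k\<in>J. (inner (mul \<eta> (\<theta> s k)) g)\<^sup>2) \<le> e * (norm g)\<^sup>2" if s: "0 \<le> s" for s g
  proof -
    have "(\<Sum>k\<in>J. (inner (mul \<eta> (\<theta> s k)) g)\<^sup>2) = (\<Sum>k\<in>J. (inner (\<theta> s k) (mul \<eta> g))\<^sup>2)"
      by (simp add: inner_mul[OF bm])
    also have "\<dots> \<le> e * (norm (mul \<eta> g))\<^sup>2"
      using bessel[OF J UX s \<open>0 \<le> e\<close> orth, of "(0, 0, mul \<eta> g)"]
      by (simp add: E_def inner_prod_def norm_prod_def \<theta>_def)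
    also have "\<dots> \<le> e * (norm g)\<^sup>2"
      using norm_\<eta>[of g] \<open>0 \<le> e\<close> by (intro mult_left_mono power_mono) auto
    finally show ?thesis .
  qed
  \<comment> \<open>The state \<open>V k\<close> lies in the domain of the generator, so its first component, the velocity of the orbit of
      \<open>U k\<close>, stays in the domain of the Dirichlet Laplacian, with \<open>|\<nabla>v| = |S v| \<le> \<Lambda>\<close>.\<close>
  have boundary_v: "(\<Sum>k\<in>J. (norm (mul w (v s k)))\<^sup>2) \<le> layer" if s: "0 \<le> s" for s
  proof -
    have "norm (shift z (v s k) - v s k) \<le> \<epsilon> * \<Lambda>" if k: "k \<in> J" and z: "norm z < \<epsilon>" for k z
    proof -
      obtain av where "(fst (T s (V k)), av) \<in> neg_laplacian bc \<Omega>"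
        by (rule genE[OF gen_T[OF gens(2)[OF k] s]]) auto
      then have av: "(v s k, av) \<in> neg_laplacian bc \<Omega>"
        using orbit_projections(2)[OF gens(1)[OF k] s] by (simp add: v_def)
      have "(norm (op (v s k)))\<^sup>2 \<le> (norm (E (T s (V k))))\<^sup>2"
        using orbit_projections(2)[OF gens(1)[OF k] s] by (simp add: norm_E_sq wave_energy_def v_def)
      then have "norm (op (v s k)) \<le> norm (E (T s (V k)))" by (rule power2_le_imp_le) simp
      also have "\<dots> \<le> norm (E (V k))" by (rule T_contraction[OF s gen_mem(2)[OF gens(1)[OF k]]])
      also have "\<dots> \<le> \<Lambda>" by (rule VL[OF k])
      finally have "norm (op (v s k)) \<le> \<Lambda>" .
      have "norm (shift z (v s k) - v s k) \<le> norm z * sqrt (inner av (v s k))"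
        using av by (intro dirichlet_shift_estimate[OF open_domain]) (simp add: bcs(1))
      also have "sqrt (inner av (v s k)) = norm (op (v s k))"
        unfolding norm_op_sq[OF av, symmetric] by simp
      also have "norm z * norm (op (v s k)) \<le> \<epsilon> * \<Lambda>"
        using z pos(1) \<open>norm (op (v s k)) \<le> \<Lambda>\<close> by (intro mult_mono) auto
      finally show ?thesis .
    qed
    from concentration_bound[OF J pos(1) bessel_v[OF s] this w int_w]
    show ?thesis by (simp add: layer_def N_def \<delta>_def \<beta>_def w_def[abs_def])
  qed
  \<comment> \<open>the squared norm of the gradient of \<open>\<eta> \<theta>\<close>\<close>
  let ?Q = "\<lambda>s a k. inner (a k) (mul (\<lambda>x. \<eta> x * \<eta> x) (\<theta> s k)) + (\<Sum>b\<in>Basis. (norm (mul (partial b \<eta>) (\<theta> s k)))\<^sup>2)"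
  have interior_\<theta>: "(\<Sum>k\<in>J. (norm (mul \<eta> (\<theta> s k)))\<^sup>2) \<le> 2 * (h\<^sup>2 * (\<Sum>k\<in>J. ?Q s a k)) + core"
    if s: "0 \<le> s" and a: "\<And>k. k \<in> J \<Longrightarrow> (\<theta> s k, a k) \<in> neg_laplacian Neumann \<Omega>" for s a
  proof -
    note cut = neumann_cutoff_estimate[OF open_domain assms(3) a cut]
    have D: "norm (shift z (mul \<eta> (\<theta> s k)) - mul \<eta> (\<theta> s k)) \<le> h * sqrt (?Q s a k)" if "k \<in> J" "norm z < h" for k z
      using that(2) cut(2)[OF that(1)]
      by (intro order_trans[OF cut(1)[OF that(1)] mult_right_mono]) auto
    have ind: "indicat_real \<Omega> \<in> borel_measurable borel" by measurable
    have "mul (indicat_real \<Omega>) (mul \<eta> (\<theta> s k)) = mul \<eta> (\<theta> s k)" if "k \<in> J" for k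
      by (intro mul_L2_eq_self[OF mul_L2[OF bm v\<theta>(4)[OF s that]] \<Omega>])
    then have "(\<Sum>k\<in>J. (norm (mul \<eta> (\<theta> s k)))\<^sup>2) = (\<Sum>k\<in>J. (norm (mul (indicat_real \<Omega>) (mul \<eta> (\<theta> s k))))\<^sup>2)"
      by (intro sum.cong) auto
    also have "\<dots> \<le> 2 * (\<Sum>k\<in>J. (h * sqrt (?Q s a k))\<^sup>2) + 4 * e * (\<integral>x. (indicat_real \<Omega> x)\<^sup>2 \<partial>lborel) / \<beta> h"
      unfolding \<beta>_def
    proof (rule concentration_bound[OF J pos(2) bessel_\<theta>[OF s] D ind])
      have "(\<lambda>x. (indicat_real \<Omega> x)\<^sup>2) = indicat_real \<Omega>" by (auto simp: indicator_def)
      then show "integrable lborel (\<lambda>x. (indicat_real \<Omega> x)\<^sup>2)" using int_\<Omega> by simp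
    qed auto
    also have "(\<lambda>x. (indicat_real \<Omega> x)\<^sup>2) = indicat_real \<Omega>" by (auto simp: indicator_def)
    also have "(\<Sum>k\<in>J. (h * sqrt (?Q s a k))\<^sup>2) = h\<^sup>2 * (\<Sum>k\<in>J. ?Q s a k)"
      using cut(2) by (simp add: power_mult_distrib sum_distrib_left)
    finally show ?thesis by (simp add: core_def)
  qed
  define c where "c = \<bar>\<gamma>\<bar> * (2 * \<sigma> * (N * e) + layer / \<sigma> + core / \<sigma>)
      + \<kappa> * ((2 * C + 2 * \<bar>\<gamma>\<bar>) * (N * e))"
  let ?G = "\<lambda>s. (\<Sum>k\<in>J. wave_energy (T s (U k))) - \<kappa> * (\<Sum>k\<in>J. (norm (mul \<eta> (\<theta> s k)))\<^sup>2)"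
  have "?G 0 - c * t \<le> ?G t"
  proof (rule increment_ge[OF pos(4)])
    fix s :: real assume s: "0 \<le> s"
    have "\<forall>k\<in>J. \<exists>a'. (\<theta> s k, a') \<in> neg_laplacian bc' \<Omega> \<and>
      ((\<lambda>s. wave_energy (T s (U k))) has_real_derivative - 2 * \<gamma> * inner (\<theta> s k) (v s k)) (at s within {0..}) \<and>
      ((\<lambda>s. \<theta> s k) has_vector_derivative - a' + \<gamma> *\<^sub>R v s k) (at s within {0..})"
      unfolding \<theta>_def v_def using orbit_projections(1)[OF gens(1) s] by blast
    from bchoice[OF this] obtain a where a_all: "\<forall>k\<in>J. (\<theta> s k, a k) \<in> neg_laplacian bc' \<Omega> \<and>
      ((\<lambda>s. wave_energy (T s (U k))) has_real_derivative - 2 * \<gamma> * inner (\<theta> s k) (v s k)) (at s within {0..}) \<and>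
      ((\<lambda>s. \<theta> s k) has_vector_derivative - a k + \<gamma> *\<^sub>R v s k) (at s within {0..})"
      by (elim exE) (rule that)
    have a: "(\<theta> s k, a k) \<in> neg_laplacian Neumann \<Omega>"
      and dW: "((\<lambda>s. wave_energy (T s (U k))) has_real_derivative - 2 * \<gamma> * inner (\<theta> s k) (v s k)) (at s within {0..})"
      and d\<theta>: "((\<lambda>s. \<theta> s k) has_vector_derivative - a k + \<gamma> *\<^sub>R v s k) (at s within {0..})"
      if k: "k \<in> J" for k
      using bspec[OF a_all k] by (simp_all only: bcs(2) simp_thms)
    define DJ where "DJ k = 2 * inner (mul \<eta> (\<theta> s k)) (mul \<eta> (- a k + \<gamma> *\<^sub>R v s k))" for k
    have dJ: "((\<lambda>s. (norm (mul \<eta> (\<theta> s k)))\<^sup>2) has_real_derivative DJ k) (at s within {0..})" if "k \<in> J" for k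
      unfolding DJ_def
      by (rule has_real_derivative_norm_sq[OF bounded_linear.has_vector_derivative[OF bounded_linear_mul[OF bm] d\<theta>[OF that]]])
    have DJ: "DJ k \<le> - 2 * ?Q s a k + (2 * C + 2 * \<bar>\<gamma>\<bar>) * e" if k: "k \<in> J" for k
    proof -
      have "inner (mul \<eta> (\<theta> s k)) (mul \<eta> (a k)) = inner (a k) (mul (\<lambda>x. \<eta> x * \<eta> x) (\<theta> s k))"
        using inner_mul[OF bm, of "a k" "mul \<eta> (\<theta> s k)"] by (simp add: mul_mul[OF bm bm] inner_commute)
      then have "DJ k = - 2 * inner (a k) (mul (\<lambda>x. \<eta> x * \<eta> x) (\<theta> s k)) + 2 * (\<gamma> * inner (mul \<eta> (\<theta> s k)) (mul \<eta> (v s k)))"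
        by (simp add: DJ_def mul_diff[OF bm] mul_scaleR[OF bm] inner_diff_right algebra_simps)
      also have "\<gamma> * inner (mul \<eta> (\<theta> s k)) (mul \<eta> (v s k)) \<le> \<bar>\<gamma>\<bar> * e"
      proof -
        have "\<bar>inner (mul \<eta> (\<theta> s k)) (mul \<eta> (v s k))\<bar> \<le> norm (mul \<eta> (\<theta> s k)) * norm (mul \<eta> (v s k))"
          by (rule Cauchy_Schwarz_ineq2)
        also have "\<dots> \<le> norm (\<theta> s k) * norm (v s k)" by (intro mult_mono norm_\<eta>) auto
        also have "\<dots> \<le> ((norm (\<theta> s k))\<^sup>2 + (norm (v s k))\<^sup>2) / 2"
          using sum_squares_bound[of "norm (\<theta> s k)" "norm (v s k)"] by simp
        also have "\<dots> \<le> e" using v\<theta>(1,2)[OF s k] by simp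
        finally have "\<bar>\<gamma>\<bar> * \<bar>inner (mul \<eta> (\<theta> s k)) (mul \<eta> (v s k))\<bar> \<le> \<bar>\<gamma>\<bar> * e"
          by (rule mult_left_mono) simp
        then show ?thesis unfolding abs_mult[symmetric] by linarith
      qed
      finally have "DJ k \<le> - 2 * inner (a k) (mul (\<lambda>x. \<eta> x * \<eta> x) (\<theta> s k)) + 2 * (\<bar>\<gamma>\<bar> * e)" by simp
      moreover have "(\<Sum>b\<in>Basis. (norm (mul (partial b \<eta>) (\<theta> s k)))\<^sup>2) \<le> C * e"
        by (rule order_trans[OF C(2) mult_left_mono[OF v\<theta>(2)[OF s k] C(1)]])
      ultimately show ?thesis by (simp add: algebra_simps)
    qed
    have coupling: "2 * \<bar>inner (\<theta> s k) (v s k)\<bar> \<le> 2 * \<sigma> * e + (norm (mul w (v s k)))\<^sup>2 / \<sigma> + (norm (mul \<eta> (\<theta> s k)))\<^sup>2 / \<sigma>"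
      if k: "k \<in> J" for k
    proof -
      have young: "2 * (x * y) \<le> \<sigma> * e + y\<^sup>2 / \<sigma>" if "x\<^sup>2 \<le> e" for x y :: real
      proof -
        have "0 \<le> (\<sigma> * x - y)\<^sup>2 / \<sigma>" using pos(3) by simp
        also have "\<dots> = \<sigma> * x\<^sup>2 - 2 * (x * y) + y\<^sup>2 / \<sigma>"
          using pos(3) by (simp add: power2_eq_square field_simps)
        also have "\<sigma> * x\<^sup>2 \<le> \<sigma> * e" using that pos(3) by simp
        finally show ?thesis by simp
      qed
      have "inner (\<theta> s k) (v s k) = inner (\<theta> s k) (mul w (v s k)) + inner (v s k) (mul \<eta> (\<theta> s k))"
        using arg_cong[OF split[OF v\<theta>(3)[OF s k]], of "inner (\<theta> s k)"] inner_mul[OF bm, of "\<theta> s k" "v s k"]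
        by (simp add: inner_add_right inner_commute)
      then have "\<bar>inner (\<theta> s k) (v s k)\<bar> \<le> norm (\<theta> s k) * norm (mul w (v s k)) + norm (v s k) * norm (mul \<eta> (\<theta> s k))"
        using Cauchy_Schwarz_ineq2[of "\<theta> s k" "mul w (v s k)"] Cauchy_Schwarz_ineq2[of "v s k" "mul \<eta> (\<theta> s k)"] by linarith
      then show ?thesis
        using young[OF v\<theta>(2)[OF s k], of "norm (mul w (v s k))"] young[OF v\<theta>(1)[OF s k], of "norm (mul \<eta> (\<theta> s k))"]
        by linarith
    qed
    define q where "q = (\<Sum>k\<in>J. ?Q s a k)"
    have "(\<Sum>k\<in>J. 2 * \<bar>inner (\<theta> s k) (v s k)\<bar>)
      \<le> (\<Sum>k\<in>J. 2 * \<sigma> * e + (norm (mul w (v s k)))\<^sup>2 / \<sigma> + (norm (mul \<eta> (\<theta> s k)))\<^sup>2 / \<sigma>)"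
      by (rule sum_mono[OF coupling])
    also have "\<dots> = 2 * \<sigma> * (N * e) + (\<Sum>k\<in>J. (norm (mul w (v s k)))\<^sup>2) / \<sigma> + (\<Sum>k\<in>J. (norm (mul \<eta> (\<theta> s k)))\<^sup>2) / \<sigma>"
      by (simp add: sum.distrib sum_divide_distrib N_def)
    also have "\<dots> \<le> 2 * \<sigma> * (N * e) + layer / \<sigma>
        + (2 * (h\<^sup>2 * q) + core) / \<sigma>"
      unfolding q_def using pos(3)
      by (intro add_mono divide_right_mono boundary_v[OF s] interior_\<theta>[OF s a] order_refl) auto
    finally have sum_bound: "\<bar>\<gamma>\<bar> * (\<Sum>k\<in>J. 2 * \<bar>inner (\<theta> s k) (v s k)\<bar>) \<le> \<bar>\<gamma>\<bar> * (2 * \<sigma> * (N * e) + layer / \<sigma>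
        + (2 * (h\<^sup>2 * q) + core) / \<sigma>)"
      by (rule mult_left_mono) simp
    have "(\<Sum>k\<in>J. DJ k) \<le> (\<Sum>k\<in>J. - 2 * ?Q s a k + (2 * C + 2 * \<bar>\<gamma>\<bar>) * e)"
      by (rule sum_mono[OF DJ])
    also have "\<dots> = - 2 * q + (2 * C + 2 * \<bar>\<gamma>\<bar>) * (N * e)"
      by (simp only: q_def N_def sum.distrib sum_distrib_left[symmetric] sum_constant mult.left_commute[of _ "real (card J)" e])
    finally have "\<kappa> * (\<Sum>k\<in>J. DJ k) \<le> \<kappa> * (- 2 * q + (2 * C + 2 * \<bar>\<gamma>\<bar>) * (N * e))"
      using \<kappa> by (rule mult_left_mono)
    moreover have "- (\<bar>\<gamma>\<bar> * (\<Sum>k\<in>J. 2 * \<bar>inner (\<theta> s k) (v s k)\<bar>)) \<le> (\<Sum>k\<in>J. - 2 * \<gamma> * inner (\<theta> s k) (v s k))"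
    proof -
      have "- 2 * \<gamma> * inner (\<theta> s k) (v s k) \<ge> - (\<bar>\<gamma>\<bar> * (2 * \<bar>inner (\<theta> s k) (v s k)\<bar>))" for k
        using abs_ge_self[of "2 * \<gamma> * inner (\<theta> s k) (v s k)"] by (simp add: abs_mult)
      then have "(\<Sum>k\<in>J. - (\<bar>\<gamma>\<bar> * (2 * \<bar>inner (\<theta> s k) (v s k)\<bar>))) \<le> (\<Sum>k\<in>J. - 2 * \<gamma> * inner (\<theta> s k) (v s k))"
        by (intro sum_mono)
      then show ?thesis by (simp only: sum_negf sum_distrib_left)
    qed
    moreover have "\<bar>\<gamma>\<bar> * (2 * \<sigma> * (N * e) + layer / \<sigma>
        + (2 * (h\<^sup>2 * q) + core) / \<sigma>) + \<kappa> * (- 2 * q + (2 * C + 2 * \<bar>\<gamma>\<bar>) * (N * e)) = c"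
      by (simp add: c_def \<kappa>_def add_divide_distrib algebra_simps)
    ultimately have "- c \<le> (\<Sum>k\<in>J. - 2 * \<gamma> * inner (\<theta> s k) (v s k)) - \<kappa> * (\<Sum>k\<in>J. DJ k)"
      using sum_bound by linarith
    moreover have "(?G has_real_derivative (\<Sum>k\<in>J. - 2 * \<gamma> * inner (\<theta> s k) (v s k)) - \<kappa> * (\<Sum>k\<in>J. DJ k)) (at s within {0..})"
      by (intro DERIV_diff DERIV_cmult DERIV_sum dW dJ)
    ultimately show "\<exists>D. (?G has_real_derivative D) (at s within {0..}) \<and> - c \<le> D" by blast
  qed
  moreover have "N * B - \<kappa> * (N * e) \<le> ?G 0"
  proof -
    have "(\<Sum>k\<in>J. wave_energy (T 0 (U k))) = N * B"
      using W0 by (simp add: T_0[OF UX] N_def cong: sum.cong)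
    moreover have "(\<Sum>k\<in>J. (norm (mul \<eta> (\<theta> 0 k)))\<^sup>2) \<le> (\<Sum>k\<in>J. e)"
    proof (rule sum_mono)
      fix k assume k: "k \<in> J"
      have "(norm (mul \<eta> (\<theta> 0 k)))\<^sup>2 \<le> (norm (\<theta> 0 k))\<^sup>2" by (intro power_mono norm_\<eta>) simp
      then show "(norm (mul \<eta> (\<theta> 0 k)))\<^sup>2 \<le> e" by (rule order_trans[OF _ v\<theta>(2)[OF order_refl k]])
    qed
    then have "\<kappa> * (\<Sum>k\<in>J. (norm (mul \<eta> (\<theta> 0 k)))\<^sup>2) \<le> \<kappa> * (N * e)"
      using \<kappa> by (intro mult_left_mono) (simp_all add: N_def)
    ultimately show ?thesis by simp
  qed
  moreover have "?G t \<le> N * e / 4"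
  proof -
    have "(\<Sum>k\<in>J. wave_energy (T t (U k))) \<le> (\<Sum>k\<in>J. e / 4)"
    proof (rule sum_mono)
      fix k assume k: "k \<in> J"
      have "wave_energy (T t (U k)) \<le> (norm (E (T t (U k))))\<^sup>2" by (simp add: norm_E_sq)
      then show "wave_energy (T t (U k)) \<le> e / 4" using half[OF k] by simp
    qed
    moreover have "0 \<le> \<kappa> * (\<Sum>k\<in>J. (norm (mul \<eta> (\<theta> t k)))\<^sup>2)" using \<kappa> by (simp add: sum_nonneg)
    ultimately show ?thesis by (simp add: N_def)
  qed
  ultimately have "N * B \<le> N * e / 4 + \<kappa> * (N * e) + c * t" by linarith
  then show ?thesis unfolding c_def .
qed

text \<open>The number \<open>N = m\<^sup>n\<close> of bumps matches the factor \<open>(m/a)\<^sup>n\<close> that \<open>concentration_bound\<close> produces for balls of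
radius \<open>a/m\<close>, so that after division by \<open>N\<close> the boundary term is independent of \<open>m\<close>.\<close>

lemma not_exponentially_stable_dirichlet_neumann:
  assumes bcs: "bc = Dirichlet" "bc' = Neumann" and "bounded \<Omega>" "\<Omega> \<noteq> {}"
  shows "\<not> exponentially_stable X (state_norm S) T"
proof
  assume "exponentially_stable X (state_norm S) T"
  then obtain t where t: "0 < t" "\<And>U. U \<in> X \<Longrightarrow> norm (E (T t U)) \<le> norm (E U) / 2"
    by (rule half_time) (rule that)
  obtain B0 B1 B2 and I :: "nat \<Rightarrow> ('a \<Rightarrow> nat) set" and \<psi> where B: "0 \<le> B0" "0 < B1" "0 \<le> B2"
    and I: "\<And>m. 0 < m \<Longrightarrow> finite (I m) \<and> card (I m) = m ^ DIM('a)"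
    and test: "\<And>m k. 0 < m \<Longrightarrow> k \<in> I m \<Longrightarrow> test_function \<Omega> (\<psi> m k)"
    and n0: "\<And>m k. 0 < m \<Longrightarrow> k \<in> I m \<Longrightarrow> (norm (abs_l2 (\<psi> m k)))\<^sup>2 = B0 / (real m)\<^sup>2"
    and n1: "\<And>m k. 0 < m \<Longrightarrow> k \<in> I m \<Longrightarrow> (\<Sum>b\<in>Basis. (norm (abs_l2 (partial b (\<psi> m k))))\<^sup>2) = B1"
    and n2: "\<And>m k. 0 < m \<Longrightarrow> k \<in> I m \<Longrightarrow> (norm (abs_l2 (lap (\<psi> m k))))\<^sup>2 = B2 * (real m)\<^sup>2"
    and orth: "\<And>m j k. 0 < m \<Longrightarrow> j \<in> I m \<Longrightarrow> k \<in> I m \<Longrightarrow> j \<noteq> k \<Longrightarrow>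
      inner (abs_l2 (\<psi> m j)) (abs_l2 (\<psi> m k)) = 0 \<and> inner (abs_l2 (lap (\<psi> m j))) (abs_l2 (\<psi> m k)) = 0"
    by (rule bump_family[OF open_domain assms(4)]) (rule that)
  define g where "g = \<bar>\<gamma>\<bar>"
  define n where "n = DIM('a)"
  define b where "b = measure lborel (ball (0::'a) 1)"
  define C1 where "C1 = (2 + \<gamma>\<^sup>2) * B2 + 2 * \<gamma> ^ 4 * B0"
  have b: "0 < b" by (simp add: b_def content_ball_gt_0_iff)
  have ball: "measure lborel (ball (0::'a) r) = r ^ n * b" if "0 < r" for r
    using content_ball_conv_unit_ball[of r "0::'a"] that by (simp add: b_def n_def)
  have C1: "0 \<le> C1" using B by (simp add: C1_def)
  define x where "x j = inverse (real (Suc j))" for j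
  have x0: "x \<longlonglongrightarrow> 0" unfolding x_def[abs_def] by (rule LIMSEQ_inverse_real_of_nat)
  have xpos: "0 < x j" for j by (simp add: x_def)
  define e where "e y = B1 + \<gamma>\<^sup>2 * (B0 * y\<^sup>2)" for y :: real
  have e: "0 \<le> e y" for y using B by (simp add: e_def)
  define \<delta> where "\<delta> \<eta> = (\<integral>x. (indicat_real \<Omega> x * (1 - \<eta> x))\<^sup>2 \<partial>lborel)" for \<eta> :: "'a \<Rightarrow> real"
  define R where "R a h \<sigma> C d y z = e y / 4 + g * h\<^sup>2 / \<sigma> * e y
      + (g * (2 * \<sigma> * e y + (2 * (a\<^sup>2 * C1) + 4 * e y * d / (a ^ n * b)) / \<sigma>
          + 4 * e y * measure lborel \<Omega> / (h ^ n * b) / \<sigma> * z)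
        + g * h\<^sup>2 / \<sigma> * ((2 * C + 2 * g) * e y)) * t" for a h \<sigma> C d y z :: real
  \<comment> \<open>\<open>R\<close> is the right-hand side of \<open>summed_estimate\<close> divided by \<open>N\<close>, with \<open>y = 1/m\<close> and \<open>z\<close> in place of \<open>1/N\<close>.\<close>
  have per_mode: "B1 \<le> R a h \<sigma> C (\<delta> \<eta>) (x j) (x j)"
    if pos: "0 < a" "0 < h" "0 < \<sigma>" and cut: "cutoff \<Omega> \<eta>"
      and C: "0 \<le> C" "\<And>\<theta>. (\<Sum>b\<in>Basis. (norm (mul (partial b \<eta>) \<theta>))\<^sup>2) \<le> C * (norm \<theta>)\<^sup>2"
    for a h \<sigma> C :: real and \<eta> and j :: nat
  proof -
    define m where "m = Suc j"
    have m: "0 < m" "x j = 1 / real m" by (simp_all add: m_def x_def inverse_eq_divide)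
    define N where "N = real (card (I m))"
    have N: "N = real m ^ n" "0 < N" using I[OF m(1)] m(1) by (simp_all add: N_def n_def)
    let ?U = "\<lambda>k. (abs_l2 (\<psi> m k), 0, \<gamma> *\<^sub>R abs_l2 (\<psi> m k))"
    let ?V = "\<lambda>k. (0, abs_l2 (lap (\<psi> m k)) - (\<gamma> * \<gamma>) *\<^sub>R abs_l2 (\<psi> m k), \<gamma> *\<^sub>R abs_l2 (lap (\<psi> m k)))"
    have "\<exists>Y. (?V k, Y) \<in> gen" if k: "k \<in> I m" for k
      using test_orbit_twice[OF test[OF m(1) k]] .
    then obtain Y where Y: "\<And>k. k \<in> I m \<Longrightarrow> (?V k, Y k) \<in> gen" by metis
    have U: "(?U k, ?V k) \<in> gen" if "k \<in> I m" for k by (rule test_data_gen(2)[OF test[OF m(1) that]])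
    have normU: "(norm (E (?U k)))\<^sup>2 = e (x j)" if k: "k \<in> I m" for k
      using norm_E_test_data[OF test[OF m(1) k]] n1[OF m(1) k] n0[OF m(1) k]
      by (simp add: e_def m(2) power_divide)
    have orthU: "inner (E (?U i)) (E (?U k)) = (if i = k then e (x j) else 0)" if ik: "i \<in> I m" "k \<in> I m" for i k
    proof (cases "i = k")
      case True
      then show ?thesis using normU[OF ik(1)] by (simp add: power2_norm_eq_inner)
    next
      case False
      then show ?thesis
        using E_test_data[OF test[OF m(1) ik(1)] test[OF m(1) ik(2)]] orth[OF m(1) ik] by simp
    qed
    have normV: "norm (E (?V k)) \<le> sqrt C1 * real m" if k: "k \<in> I m" for k
    proof (rule power2_le_imp_le)
      have "op 0 = 0" using op_scaleR[OF Domain_zero, of 0] by simp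
      then have "(norm (E (?V k)))\<^sup>2 = (norm (abs_l2 (lap (\<psi> m k)) - (\<gamma> * \<gamma>) *\<^sub>R abs_l2 (\<psi> m k)))\<^sup>2
          + \<gamma>\<^sup>2 * (norm (abs_l2 (lap (\<psi> m k))))\<^sup>2"
        by (simp add: norm_E_sq wave_energy_def power_mult_distrib)
      also have "(norm (abs_l2 (lap (\<psi> m k)) - (\<gamma> * \<gamma>) *\<^sub>R abs_l2 (\<psi> m k)))\<^sup>2
          \<le> 2 * (norm (abs_l2 (lap (\<psi> m k))))\<^sup>2 + 2 * (\<gamma>\<^sup>2 * norm (abs_l2 (\<psi> m k)))\<^sup>2"
      proof -
        have "norm (abs_l2 (lap (\<psi> m k)) - (\<gamma> * \<gamma>) *\<^sub>R abs_l2 (\<psi> m k))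
            \<le> norm (abs_l2 (lap (\<psi> m k))) + \<gamma>\<^sup>2 * norm (abs_l2 (\<psi> m k))"
          using norm_triangle_ineq4[of "abs_l2 (lap (\<psi> m k))" "(\<gamma> * \<gamma>) *\<^sub>R abs_l2 (\<psi> m k)"]
          by (simp add: power2_eq_square)
        then have "(norm (abs_l2 (lap (\<psi> m k)) - (\<gamma> * \<gamma>) *\<^sub>R abs_l2 (\<psi> m k)))\<^sup>2
            \<le> (norm (abs_l2 (lap (\<psi> m k))) + \<gamma>\<^sup>2 * norm (abs_l2 (\<psi> m k)))\<^sup>2" by (intro power_mono) auto
        also have "\<dots> \<le> 2 * (norm (abs_l2 (lap (\<psi> m k))))\<^sup>2 + 2 * (\<gamma>\<^sup>2 * norm (abs_l2 (\<psi> m k)))\<^sup>2"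
          using sum_squares_bound[of "norm (abs_l2 (lap (\<psi> m k)))" "\<gamma>\<^sup>2 * norm (abs_l2 (\<psi> m k))"]
          unfolding power2_sum by linarith
        finally show ?thesis .
      qed
      also have "2 * (norm (abs_l2 (lap (\<psi> m k))))\<^sup>2 + 2 * (\<gamma>\<^sup>2 * norm (abs_l2 (\<psi> m k)))\<^sup>2 + \<gamma>\<^sup>2 * (norm (abs_l2 (lap (\<psi> m k))))\<^sup>2
          = (2 + \<gamma>\<^sup>2) * B2 * (real m)\<^sup>2 + 2 * \<gamma> ^ 4 * B0 * (1 / (real m)\<^sup>2)"
        unfolding power_mult_distrib n0[OF m(1) k] n2[OF m(1) k]
        by (simp add: distrib_right flip: power_mult)
      also have "\<dots> \<le> (2 + \<gamma>\<^sup>2) * B2 * (real m)\<^sup>2 + 2 * \<gamma> ^ 4 * B0 * (real m)\<^sup>2"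
      proof -
        have "1 \<le> (real m)\<^sup>2" using m(1) by simp
        then have "1 / (real m)\<^sup>2 \<le> 1" by (rule divide_le_eq_1[THEN iffD2, OF disjI1[OF conjI, rotated]]) (use m(1) in simp)
        then have "1 / (real m)\<^sup>2 \<le> (real m)\<^sup>2" using \<open>1 \<le> (real m)\<^sup>2\<close> by linarith
        then have "2 * \<gamma> ^ 4 * B0 * (1 / (real m)\<^sup>2) \<le> 2 * \<gamma> ^ 4 * B0 * (real m)\<^sup>2"
          using B(1) by (intro mult_left_mono) auto
        then show ?thesis by simp
      qed
      also have "\<dots> = (sqrt C1 * real m)\<^sup>2"
        using C1 by (simp add: power_mult_distrib C1_def distrib_right)
      finally show "(norm (E (?V k)))\<^sup>2 \<le> (sqrt C1 * real m)\<^sup>2" by simp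
      show "0 \<le> sqrt C1 * real m" using C1 by simp
    qed
    have W0: "wave_energy (?U k) = B1" if k: "k \<in> I m" for k
      using norm_op_test[OF test[OF m(1) k]] n1[OF m(1) k] by (simp add: wave_energy_def)
    have half: "(norm (E (T t (?U k))))\<^sup>2 \<le> e (x j) / 4" if k: "k \<in> I m" for k
    proof -
      have "(norm (E (T t (?U k))))\<^sup>2 \<le> (norm (E (?U k)) / 2)\<^sup>2"
        by (intro power_mono t(2) gen_mem(1)[OF U[OF k]]) simp
      then show ?thesis using normU[OF k] by (simp add: power_divide)
    qed
    have am: "0 < a / real m" using pos(1) m(1) by simp
    have fin: "finite (I m)" using I[OF m(1)] by simp
    note est = summed_estimate[OF bcs assms(3) cut C fin U Y orthU e normV am pos(2,3) less_imp_le[OF t(1)] W0 half,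
        folded N_def \<delta>_def g_def]
    have r1: "(a / real m * (sqrt C1 * real m))\<^sup>2 = a\<^sup>2 * C1"
      using m(1) C1 by (simp add: power_mult_distrib)
    have r2: "4 * e (x j) * \<delta> \<eta> / measure lborel (ball (0::'a) (a / real m)) = N * (4 * e (x j) * \<delta> \<eta> / (a ^ n * b))"
      unfolding ball[OF am] N(1) using m(1) by (simp add: power_divide)
    have "N * B1 \<le> N * R a h \<sigma> C (\<delta> \<eta>) (x j) (1 / N)"
    proof -
      define M where "M = 4 * e (x j) * \<delta> \<eta> / (a ^ n * b)"
      define L where "L = 4 * e (x j) * measure lborel \<Omega> / (h ^ n * b)"
      have "N * (L / \<sigma> * (1 / N)) = L / \<sigma>" using N(2) by simp
      then show ?thesis
        using est unfolding R_def r1 r2 ball[OF pos(2)] M_def[symmetric] L_def[symmetric]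
        by (simp add: distrib_left distrib_right add_divide_distrib mult_ac)
    qed
    then have "B1 \<le> R a h \<sigma> C (\<delta> \<eta>) (x j) (1 / N)"
      using N(2) by (simp only: mult_le_cancel_left_pos)
    also have "\<dots> \<le> R a h \<sigma> C (\<delta> \<eta>) (x j) (x j)"
    proof -
      have "real m ^ 1 \<le> real m ^ n" using m(1) by (intro power_increasing) (auto simp: n_def Suc_le_eq)
      then have "1 / N \<le> x j" unfolding N(1) m(2) using m(1) by (intro divide_left_mono) auto
      then show ?thesis
        unfolding R_def using t(1) e b pos
        by (intro add_left_mono mult_right_mono add_right_mono mult_left_mono) (auto simp: g_def)
    qed
    finally show ?thesis .
  qed
  have e0: "e 0 = B1" by (simp add: e_def)
  \<comment> \<open>\<open>m\<close> tends to infinity\<close>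
  have step1: "B1 \<le> R a h \<sigma> C (\<delta> \<eta>) 0 0"
    if "0 < a" "0 < h" "0 < \<sigma>" "cutoff \<Omega> \<eta>"
        "0 \<le> C" "\<And>\<theta>. (\<Sum>b\<in>Basis. (norm (mul (partial b \<eta>) \<theta>))\<^sup>2) \<le> C * (norm \<theta>)\<^sup>2"
    for a h \<sigma> C :: real and \<eta>
  proof -
    have "(\<lambda>j. R a h \<sigma> C (\<delta> \<eta>) (x j) (x j)) \<longlonglongrightarrow> R a h \<sigma> C (\<delta> \<eta>) 0 0"
      unfolding R_def e_def using that(1-3) b by (intro tendsto_intros x0) auto
    then show ?thesis
      by (rule LIMSEQ_le_const) (use per_mode[OF that] in blast)
  qed
  \<comment> \<open>\<open>h\<close> tends to zero\<close>
  have step2: "B1 \<le> R a 0 \<sigma> 0 (\<delta> \<eta>) 0 0" if pos: "0 < a" "0 < \<sigma>" and cut: "cutoff \<Omega> \<eta>" for a \<sigma> :: real and \<eta>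
  proof -
    obtain C where C: "0 \<le> C" "\<And>\<theta>. (\<Sum>b\<in>Basis. (norm (mul (partial b \<eta>) \<theta>))\<^sup>2) \<le> C * (norm \<theta>)\<^sup>2"
      by (rule gradient_multiplier_bound[OF cut]) (rule that)
    have R: "R a h \<sigma> C d 0 0 = B1 / 4 + g * h\<^sup>2 / \<sigma> * B1
      + (g * (2 * \<sigma> * B1 + (2 * (a\<^sup>2 * C1) + 4 * B1 * d / (a ^ n * b)) / \<sigma>) + g * h\<^sup>2 / \<sigma> * ((2 * C + 2 * g) * B1)) * t"
      for h C d unfolding R_def e0 by simp
    have "(\<lambda>j. R a (x j) \<sigma> C (\<delta> \<eta>) 0 0) \<longlonglongrightarrow> R a 0 \<sigma> C (\<delta> \<eta>) 0 0"
      unfolding R using pos by (intro tendsto_intros x0) auto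
    then have "B1 \<le> R a 0 \<sigma> C (\<delta> \<eta>) 0 0"
      by (rule LIMSEQ_le_const) (use step1[OF pos(1) xpos pos(2) cut C] in blast)
    then show ?thesis unfolding R by simp
  qed
  \<comment> \<open>the cutoffs exhaust \<open>\<Omega>\<close>\<close>
  have step3: "B1 \<le> R a 0 \<sigma> 0 0 0 0" if pos: "0 < a" "0 < \<sigma>" for a \<sigma> :: real
  proof -
    obtain \<eta> where \<eta>: "\<And>j::nat. cutoff \<Omega> (\<eta> j)" and lim: "\<And>x. (\<lambda>j. \<eta> j x) \<longlonglongrightarrow> indicator \<Omega> x"
      by (rule smooth_exhaustion[OF open_domain]) (rule that)
    have "(\<lambda>j. \<delta> (\<eta> j)) \<longlonglongrightarrow> integral\<^sup>L lborel (\<lambda>x::'a. 0::real)"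
      unfolding \<delta>_def
    proof (rule integral_dominated_convergence[where w = "indicat_real \<Omega>"])
      have \<Omega>[measurable]: "\<Omega> \<in> sets borel" using open_domain by simp
      show "integrable lborel (indicat_real \<Omega>)" using emeasure_bounded_finite[OF assms(3)] by simp
      have [measurable]: "\<eta> j \<in> borel_measurable borel" for j by (rule smooth_borel[OF cutoffD(1)[OF \<eta>]])
      show "(\<lambda>x. (indicat_real \<Omega> x * (1 - \<eta> j x))\<^sup>2) \<in> borel_measurable lborel" for j by measurable
      show "AE x in lborel. (\<lambda>j. (indicat_real \<Omega> x * (1 - \<eta> j x))\<^sup>2) \<longlonglongrightarrow> 0"
      proof (intro AE_I2)
        fix x
        have "(\<lambda>j. (indicat_real \<Omega> x * (1 - \<eta> j x))\<^sup>2) \<longlonglongrightarrow> (indicat_real \<Omega> x * (1 - indicat_real \<Omega> x))\<^sup>2"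
          by (intro tendsto_intros lim)
        then show "(\<lambda>j. (indicat_real \<Omega> x * (1 - \<eta> j x))\<^sup>2) \<longlonglongrightarrow> 0" by (cases "x \<in> \<Omega>") simp_all
      qed
      show "AE x in lborel. norm ((indicat_real \<Omega> x * (1 - \<eta> j x))\<^sup>2) \<le> indicat_real \<Omega> x" for j
        using cutoffD(2,3)[OF \<eta>, of j] by (intro AE_I2) (auto simp: indicator_def power_le_one)
    qed simp
    then have \<delta>0: "(\<lambda>j. \<delta> (\<eta> j)) \<longlonglongrightarrow> 0" by simp
    have "(\<lambda>j. R a 0 \<sigma> 0 (\<delta> (\<eta> j)) 0 0) \<longlonglongrightarrow> R a 0 \<sigma> 0 0 0 0"
      unfolding R_def using pos b by (intro tendsto_intros \<delta>0) auto
    then show ?thesis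
      by (rule LIMSEQ_le_const) (use step2[OF pos \<eta>] in blast)
  qed
  \<comment> \<open>with \<open>a = \<sigma>\<close> the two remaining terms tend to zero together\<close>
  have "B1 \<le> B1 / 4 + g * (2 * x j * B1 + 2 * (x j * C1)) * t" for j
    using step3[OF xpos xpos, of j j] xpos[of j] by (simp add: R_def e0 power2_eq_square)
  moreover have "(\<lambda>j. B1 / 4 + g * (2 * x j * B1 + 2 * (x j * C1)) * t) \<longlonglongrightarrow> B1 / 4 + g * (2 * 0 * B1 + 2 * (0 * C1)) * t"
    by (intro tendsto_intros x0)
  ultimately have "B1 \<le> B1 / 4 + g * (2 * 0 * B1 + 2 * (0 * C1)) * t"
    by (intro LIMSEQ_le_const) auto
  then show False using B(2) by simp
qed

end

theorem theorem3p3: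
  fixes \<Omega> :: "(real ^ 'n) set" and \<gamma> :: real
    and bc bc' :: boundary_condition
    and S :: "(real ^ 'n) l2_operator"
    and T :: "real \<Rightarrow> (real ^ 'n) state \<Rightarrow> (real ^ 'n) state"
  assumes "bounded \<Omega>" and "smooth_domain \<Omega>"
    and "\<gamma> \<noteq> 0"
    and "square_root_on (L2 \<Omega>) (neg_laplacian bc \<Omega>) S"
    and "C0_semigroup (state_space \<Omega> S) (graph_norm S) T"
    and "contractive (state_space \<Omega> S) (state_norm S) T"
    and "generator (state_space \<Omega> S) (graph_norm S) T = coupled_operator bc bc' \<Omega> \<gamma> S"
  shows "\<not> exponentially_stable (state_space \<Omega> S) (state_norm S) T"
proof -
  have \<Omega>: "open \<Omega>" "\<Omega> \<noteq> {}" using assms(2) by (auto simp: smooth_domain_def)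
  interpret coupled_system \<Omega> bc S bc' \<gamma> T
    using \<Omega>(1) assms(4-7) by unfold_locales
  consider "bc' = Dirichlet" | "bc' = bc" | "bc = Dirichlet" "bc' = Neumann"
    by (cases bc; cases bc') auto
  then show ?thesis
  proof cases
    case 1
    show ?thesis
    proof (rule not_exponentially_stable_of_form_bound[OF _ \<Omega>(2)])
      fix \<theta> a' q a
      assume \<theta>: "(\<theta>, a') \<in> neg_laplacian bc' \<Omega>" and q: "(q, a) \<in> neg_laplacian bc \<Omega>"
      have "0 \<le> inner a' \<theta>"
        using \<theta> unfolding 1 by (rule dirichlet_approximation[OF \<Omega>(1)]) (simp add: sum_nonneg)
      then show "0 \<le> inner a' \<theta> \<and> \<bar>inner \<theta> a\<bar> \<le> sqrt (inner a' \<theta>) * norm (op q)"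
        using dirichlet_duality[OF \<theta>[unfolded 1] q] by simp
    qed
  next
    case 2
    show ?thesis
    proof (rule not_exponentially_stable_of_form_bound[OF _ \<Omega>(2)])
      fix \<theta> a' q a
      assume \<theta>: "(\<theta>, a') \<in> neg_laplacian bc' \<Omega>" and q: "(q, a) \<in> neg_laplacian bc \<Omega>"
      have n: "inner a' \<theta> = (norm (op \<theta>))\<^sup>2" using norm_op_sq[of \<theta> a'] \<theta> by (simp add: 2)
      have "inner \<theta> a = inner (op \<theta>) (op q)"
        using inner_op_op[OF q neg_laplacian_Domain[of \<theta> a']] \<theta> by (simp add: 2 inner_commute)
      then show "0 \<le> inner a' \<theta> \<and> \<bar>inner \<theta> a\<bar> \<le> sqrt (inner a' \<theta>) * norm (op q)"
        using Cauchy_Schwarz_ineq2[of "op \<theta>" "op q"] by (simp add: n)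
    qed
  next
    case 3
    then show ?thesis by (rule not_exponentially_stable_dirichlet_neumann[OF _ _ assms(1) \<Omega>(2)])
  qed
qed

end
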